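(* Let $(\mathcal F_0,\mathbf a)$ be initial data for the completion problem in $\mathbb C^d$, let $\lambda=\lambda(S_{\mathcal F_0})$, let $f:[0,\infty)\to[0,\infty)$ be a strictly convex function, and let $F:\mathbb R_{\ge0}^d\to\mathbb R_{\ge 0}$ be $F(\gamma)=\sum_{i=1}^d f(\gamma_i)$. Let $\mu=\mu(\lambda,\mathbf a,f)$ be the vector described in the context and $E(\mathcal F_0,\mathbf a)$ the finite set described in the context. Then: (1) $\mu\in E(\mathcal F_0,\mathbf a)$. (2) Moreover, $\mu$ is uniquely determined (as an element of $E(\mathcal F_0,\mathbf a)$) by the equation $$F(\lambda+\mu)=\min\{F(\lambda+\gamma):\ \gamma\in E(\mathcal F_0,\mathbf a)\}.\qquad( * )$$ That is, a completion $\mathcal F=(\mathcal F_0,\mathcal G)\in\mathcal C_{\mathbf a}(\mathcal F_0)$ is a global minimizer of $P_f$ on $\mathcal C_{\mathbf a}(\mathcal F_0)$ if and only if $\mathcal F\in\mathcal C_{\mathbf a}^{\rm op}(\mathcal F_0)$ and the vector $\mu=\lambda^\uparrow(S_{\mathcal G})$ belongs to $E(\mathcal F_0,\mathbf a)$ and satisfies $( * )$.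
   Context: For a vector $x\in\mathbb R^m$, $x^\downarrow$ (resp. $x^\uparrow$) is its decreasing (resp. increasing) rearrangement. For a positive semidefinite $d\times d$ matrix $S$, $\lambda(S)\in\mathbb R_{\ge0}^d$ is the vector of eigenvalues (with multiplicity) in decreasing order, and $\lambda^\uparrow(S)$ the same in increasing order. $x\otimes y$ is the operator $z\mapsto\langle z,y\rangle x$. Majorization: $x\prec y$ means $\sum_{i\le j}x_i^\downarrow\le\sum_{i\le j}y_i^\downarrow$ for all $j$ with equality of total sums; if $x,y$ have different lengths the shorter is first padded with zeros. For a finite sequence $\mathcal F=\{f_i\}$ in $\mathbb C^d$, its frame operator is $S_{\mathcal F}=\sum_i f_i\otimes f_i$, and the convex potential of $f$ is $P_f(\mathcal F)=\operatorname{tr} f(S_{\mathcal F})$. Initial data for the completion problem is a pair $(\mathcal F_0,\mathbf a)$ with $\mathcal F_0=\{f_i\}_{i=1}^{n_0}$ a finite sequence in $\mathbb C^d$ and $\mathbf a=(\alpha_i)_{i=1}^k\in\mathbb R_{>0}^k$ such that $d-\operatorname{rk}S_{\mathcal F_0}\le k$; put $n=n_0+k$. $\mathcal C_{\mathbf a}(\mathcal F_0)$ is the set of sequences $\mathcal F=(\mathcal F_0,\mathcal G)=\{f_i\}_{i=1}^n$ whose first $n_0$ vectors are $\mathcal F_0$ and whose remaining vectors $\mathcal G=\{f_i\}_{i=n_0+1}^n$ satisfy $\|f_{n_0+i}\|^2=\alpha_i$ for $1\le i\le k$. Define $$\mathcal C_{\mathbf a}^{\rm op}(\mathcal F_0)=\{\mathcal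 F=(\mathcal F_0,\mathcal G)\in\mathcal C_{\mathbf a}(\mathcal F_0):\ \lambda(S_{\mathcal F})=(\lambda(S_{\mathcal F_0})+\lambda^\uparrow(S_{\mathcal G}))^\downarrow\}$$ and $\Gamma_d(\mathbf a)=\{\mu\in\mathbb R_{\ge0}^d:\ \mu=\mu^\uparrow,\ \mathbf a\prec\mu\}$. The vector $\mu(\lambda,\mathbf a,f)$: it is the (existing and unique) vector $\mu\in\Gamma_d(\mathbf a)$ such that $\mathcal F=(\mathcal F_0,\mathcal G)\in\mathcal C_{\mathbf a}(\mathcal F_0)$ is a global minimizer of $P_f$ on $\mathcal C_{\mathbf a}(\mathcal F_0)$ if and only if $\mathcal F\in\mathcal C_{\mathbf a}^{\rm op}(\mathcal F_0)$ and $\lambda^\uparrow(S_{\mathcal G})=\mu$; equivalently, it is the unique minimizer of $\gamma\mapsto F(\lambda+\gamma)$ on $\Gamma_d(\mathbf a)$. The set $E(\mathcal F_0,\mathbf a)$: it consists of all vectors $\mu\in\mathbb R^d$ obtained as follows. Choose $r\in\{1,\dots,d\}$, an integer $1\le p\le d-r+1$, a partition $\{K_i\}_{i=1}^p$ of $\{r,\dots,d\}$ and a partition $\{J_i\}_{i=1}^p$ of $\{1,\dots,k\}$ (into nonempty sets). For each $i$ put $\mathbf a_i=(\alpha_j)_{j\in J_i}$, $c_i=|K_i|^{-1}\big(\sum_{j\in K_i}\lambda_j+\sum_{j\in J_i}\alpha_j\big)$ and $\Gamma_i=(c_i-\lambda_j)_{j\in K_i}$. Let $\mu_j=c_i-\lambda_j$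 if $j\in K_i$, and $\mu_j=0$ if $j<r$. The vector $\mu$ is a member of $E(\mathcal F_0,\mathbf a)$ precisely when, for some such choice, for every $i$ one has $\Gamma_i\in\mathbb R_{\ge0}^{|K_i|}$ and $\mathbf a_i\prec\Gamma_i$, and moreover $\mu=\mu^\uparrow\in\mathbb R^d_{\ge 0}$. *)

theory Defs
  imports
    "Jordan_Normal_Form.Char_Poly"
    "Jordan_Normal_Form.Schur_Decomposition"
    "Jordan_Normal_Form.DL_Rank"
    "HOL-Library.Disjoint_Sets"
    "HOL-Analysis.Convex"
begin

text \<open>
  Vectors of $R^m$ are lists of length \<open>m\<close>, and finite sequences in $C^d$ are lists of elements
  of \<^term>\<open>carrier_vec d\<close>.  All index sets are 0-based.
\<close>

subsection \<open>Real vectors and majorization\<close>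

definition increasing :: "real list \<Rightarrow> real list" where
  "increasing x = sort x"

definition decreasing :: "real list \<Rightarrow> real list" where
  "decreasing x = rev (sort x)"

definition vadd :: "real list \<Rightarrow> real list \<Rightarrow> real list" where
  "vadd x y = map2 (+) x y"

definition zero_pad :: "nat \<Rightarrow> real list \<Rightarrow> real list" where
  "zero_pad m x = x @ replicate (m - length x) 0"

definition majorized :: "real list \<Rightarrow> real list \<Rightarrow> bool" where
  "majorized x y \<longleftrightarrow>
     (let m = max (length x) (length y); x' = zero_pad m x; y' = zero_pad m y in
        (\<forall>j\<le>m. sum_list (take j (decreasing x')) \<le> sum_list (take j (decreasing y'))) \<and>
        sum_list x' = sum_list y')"

definition strictly_convex_on :: "real set \<Rightarrow> (real \<Rightarrow> real) \<Rightarrow> bool" where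
  "strictly_convex_on I f \<longleftrightarrow> convex I \<and>
     (\<forall>x\<in>I. \<forall>y\<in>I. \<forall>t. x \<noteq> y \<longrightarrow> 0 < t \<longrightarrow> t < 1 \<longrightarrow>
        f ((1 - t) * x + t * y) < (1 - t) * f x + t * f y)"

definition sum_fun :: "(real \<Rightarrow> real) \<Rightarrow> real list \<Rightarrow> real" where
  "sum_fun f x = (\<Sum>t\<leftarrow>x. f t)"

subsection \<open>Spectra and functional calculus\<close>

text \<open>
  The spectrum with multiplicities is read off the characteristic polynomial.  It is only used
  for positive semidefinite matrices, whose eigenvalues are real, so that \<^const>\<open>Re\<close> merely
  changes the type.
\<close>

definition spec_inc :: "complex mat \<Rightarrow> real list" where
  "spec_inc S = sorted_list_of_multiset (image_mset Re (proots (char_poly S)))"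

definition spec_dec :: "complex mat \<Rightarrow> real list" where
  "spec_dec S = rev (spec_inc S)"

definition mat_trace :: "complex mat \<Rightarrow> complex" where
  "mat_trace A = sum_list (diag_mat A)"

text \<open>
  Functional calculus \<open>f(S) = U f(D) U\<^sup>*\<close> of a Hermitian matrix \<open>S = U D U\<^sup>*\<close>; the result does
  not depend on the chosen unitary diagonalization.
\<close>

definition mat_fun :: "(real \<Rightarrow> real) \<Rightarrow> complex mat \<Rightarrow> complex mat" where
  "mat_fun f S = (THE T. \<exists>U e. let n = dim_row S in
      U \<in> carrier_mat n n \<and> mat_adjoint U * U = 1\<^sub>m n \<and>
      S = U * mat_diag n (\<lambda>i. complex_of_real (e i)) * mat_adjoint U \<and>
      T = U * mat_diag n (\<lambda>i. complex_of_real (f (e i))) * mat_adjoint U)"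

subsection \<open>Frame operators, completions and convex potentials\<close>

text \<open>The matrix of the operator \<open>z \<mapsto> \<langle>z, y\<rangle> x\<close>.\<close>

definition rank_one :: "complex vec \<Rightarrow> complex vec \<Rightarrow> complex mat" where
  "rank_one x y = mat (dim_vec x) (dim_vec y) (\<lambda>(i, j). x $ i * cnj (y $ j))"

definition frame_op :: "nat \<Rightarrow> complex vec list \<Rightarrow> complex mat" where
  "frame_op d F = foldr (\<lambda>v A. rank_one v v + A) F (0\<^sub>m d d)"

definition potential :: "(real \<Rightarrow> real) \<Rightarrow> nat \<Rightarrow> complex vec list \<Rightarrow> real" where
  "potential f d F = Re (mat_trace (mat_fun f (frame_op d F)))"

text \<open>
  \<open>d \<ge> 1\<close> and \<open>k \<ge> 1\<close> are implicit in the mathematics: otherwise there are no partitions into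
  \<open>p \<ge> 1\<close> nonempty blocks as required in \<open>E_set\<close> below.
\<close>

definition initial_data :: "nat \<Rightarrow> complex vec list \<Rightarrow> real list \<Rightarrow> bool" where
  "initial_data d F0 a \<longleftrightarrow> 1 \<le> d \<and> 1 \<le> length a \<and>
     set F0 \<subseteq> carrier_vec d \<and> (\<forall>\<alpha>\<in>set a. 0 < \<alpha>) \<and>
     d - vec_space.rank d (frame_op d F0) \<le> length a"

definition completions :: "nat \<Rightarrow> complex vec list \<Rightarrow> real list \<Rightarrow> complex vec list set" where
  "completions d F0 a = {F0 @ G | G.
     length G = length a \<and> set G \<subseteq> carrier_vec d \<and>
     (\<forall>i<length a. G ! i \<bullet>c G ! i = complex_of_real (a ! i))}"

definition op_completions :: "nat \<Rightarrow> complex vec list \<Rightarrow> real list \<Rightarrow> complex vec list set" where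
  "op_completions d F0 a = {F0 @ G | G. F0 @ G \<in> completions d F0 a \<and>
     spec_dec (frame_op d (F0 @ G)) =
       decreasing (vadd (spec_dec (frame_op d F0)) (spec_inc (frame_op d G)))}"

definition global_minimizer ::
  "(real \<Rightarrow> real) \<Rightarrow> nat \<Rightarrow> complex vec list \<Rightarrow> real list \<Rightarrow> complex vec list \<Rightarrow> bool" where
  "global_minimizer f d F0 a F \<longleftrightarrow> F \<in> completions d F0 a \<and>
     (\<forall>F'\<in>completions d F0 a. potential f d F \<le> potential f d F')"

definition Gamma_set :: "nat \<Rightarrow> real list \<Rightarrow> real list set" where
  "Gamma_set d a = {\<mu>. length \<mu> = d \<and> (\<forall>t\<in>set \<mu>. 0 \<le> t) \<and> \<mu> = increasing \<mu> \<and> majorized a \<mu>}"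

definition opt_mu :: "nat \<Rightarrow> complex vec list \<Rightarrow> real list \<Rightarrow> (real \<Rightarrow> real) \<Rightarrow> real list" where
  "opt_mu d F0 a f = (THE \<mu>. \<mu> \<in> Gamma_set d a \<and>
     (\<forall>G. F0 @ G \<in> completions d F0 a \<longrightarrow>
        (global_minimizer f d F0 a (F0 @ G) \<longleftrightarrow>
           F0 @ G \<in> op_completions d F0 a \<and> spec_inc (frame_op d G) = \<mu>)))"

subsection \<open>The finite set of candidates\<close>

definition indexed_partition :: "nat \<Rightarrow> (nat \<Rightarrow> nat set) \<Rightarrow> nat set \<Rightarrow> bool" where
  "indexed_partition p K A \<longleftrightarrow>
     disjoint_family_on K {..<p} \<and> (\<Union>i<p. K i) = A \<and> (\<forall>i<p. K i \<noteq> {})"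

definition block_level :: "real list \<Rightarrow> real list \<Rightarrow> nat set \<Rightarrow> nat set \<Rightarrow> real" where
  "block_level lam a K J = ((\<Sum>j\<in>K. lam ! j) + (\<Sum>j\<in>J. a ! j)) / real (card K)"

text \<open>
  With 0-based indices \<open>r\<close> ranges over \<open>{0..<d}\<close>, so the bound \<open>p \<le> d - r + 1\<close> of the 1-based
  convention reads \<open>p \<le> d - r\<close>.
\<close>

definition E_set :: "nat \<Rightarrow> complex vec list \<Rightarrow> real list \<Rightarrow> real list set" where
  "E_set d F0 a = (let lam = spec_dec (frame_op d F0) in
     {\<mu>. length \<mu> = d \<and>
        (\<exists>r p K J. r < d \<and> 1 \<le> p \<and> p \<le> d - r \<and>
           indexed_partition p K {r..<d} \<and> indexed_partition p J {0..<length a} \<and>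
           (\<forall>j<r. \<mu> ! j = 0) \<and>
           (\<forall>i<p. \<forall>j\<in>K i. \<mu> ! j = block_level lam a (K i) (J i) - lam ! j) \<and>
           (\<forall>i<p. let \<Gamma> = map (\<lambda>t. block_level lam a (K i) (J i) - t) (nths lam (K i)) in
              (\<forall>t\<in>set \<Gamma>. 0 \<le> t) \<and> majorized (nths a (J i)) \<Gamma>)) \<and>
        \<mu> = increasing \<mu> \<and> (\<forall>t\<in>set \<mu>. 0 \<le> t)})"

text \<open>Finiteness makes \<^const>\<open>Min\<close> over an image of this set a genuine minimum when it is nonempty.\<close>

lemma finite_E_set: "finite (E_set d F0 a)"
proof -
  define lam where "lam = spec_dec (frame_op d F0)"
  define V where "V = insert 0 ((\<lambda>(A, B, j). block_level lam a A B - lam ! j) `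
    (Pow {..<d} \<times> Pow {..<length a} \<times> {..<d}))"
  have fin: "finite V" unfolding V_def by auto
  have "E_set d F0 a \<subseteq> {xs. set xs \<subseteq> V \<and> length xs = d}"
  proof
    fix \<mu> assume "\<mu> \<in> E_set d F0 a"
    then obtain r p K J where len: "length \<mu> = d"
      and K: "indexed_partition p K {r..<d}" and J: "indexed_partition p J {0..<length a}"
      and z: "\<forall>j<r. \<mu> ! j = 0"
      and b: "\<forall>i<p. \<forall>j\<in>K i. \<mu> ! j = block_level lam a (K i) (J i) - lam ! j"
      unfolding E_set_def Let_def mem_Collect_eq lam_def[symmetric] by (elim conjE exE) (rule that)
    have "\<mu> ! j \<in> V" if j: "j < d" for j
    proof (cases "j < r")
      case True
      then show ?thesis using z by (simp add: V_def)
    next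
      case False
      then have "j \<in> (\<Union>i<p. K i)" using K j unfolding indexed_partition_def by auto
      then obtain i where i: "i < p" "j \<in> K i" by auto
      have "K i \<subseteq> {..<d}" using K i(1) unfolding indexed_partition_def by auto
      moreover have "J i \<subseteq> {..<length a}"
        using J i(1) unfolding indexed_partition_def by auto
      ultimately have "(K i, J i, j) \<in> Pow {..<d} \<times> Pow {..<length a} \<times> {..<d}"
        using j by auto
      then have "block_level lam a (K i) (J i) - lam ! j \<in> V"
        unfolding V_def by (intro insertI2 image_eqI[where x = "(K i, J i, j)"]) simp_all
      then show ?thesis using b i by metis
    qed
    then show "\<mu> \<in> {xs. set xs \<subseteq> V \<and> length xs = d}"
      using len by (auto simp: in_set_conv_nth)
  qed
  then show ?thesis using finite_lists_length_eq[OF fin] finite_subset by blast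
qed

end

theory Submission
  imports Defs "HOL-Analysis.Function_Topology"
begin

text \<open>
  Throughout, \<open>excess t x\<close> is the sum of the positive parts \<open>(x\<^sub>i - t)\<^sup>+\<close>.  For vectors with the same
  sum and length, \<open>x\<close> is majorized by \<open>y\<close> iff \<open>excess t x \<le> excess t y\<close> for all \<open>t\<close>.  In this form
  majorization is additive over blocks and meets matrix inequalities directly.  On finitely many
  points a strictly convex \<open>f\<close> is an affine function plus positive multiples of the functions
  \<open>u \<mapsto> (u - t)\<^sup>+\<close>.  Hence majorization implies the inequality between the sums of \<open>f\<close>, with equality only
  for rearrangements (\<open>convex_order_sum_fun\<close>).  This finite representation also covers an \<open>f\<close> that
  jumps at \<open>0\<close>.

  \<^emph>\<open>From matrices to vectors.\<close>  Lidskii's inequality says that \<open>\<lambda>(S\<^sub>F\<^sub>0) + \<lambda>\<^sup>\<up>(S\<^sub>G)\<close> is majorized by \<open>\<lambda>(S\<^sub>F)\<close>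
  (\<open>lidskii_excess\<close>).  So the potential of \<open>(F\<^sub>0, G)\<close> is at least \<open>F(\<lambda> + \<lambda>\<^sup>\<up>(S\<^sub>G))\<close>, with equality iff the
  completion lies in \<^const>\<open>op_completions\<close>.  The two directions of the Schur-Horn theorem show that the
  vectors \<open>\<lambda>\<^sup>\<up>(S\<^sub>G)\<close> are exactly the elements of \<^const>\<open>Gamma_set\<close> (\<open>column_norms_excess\<close>,
  \<open>prescribed_rows_and_columns\<close>), and every such vector is realised by a \<open>G\<close> whose frame operator is
  diagonal in an eigenbasis of \<open>S\<^sub>F\<^sub>0\<close>, for which the bound is attained (\<open>aligned_completion\<close>).
  Minimising the potential is therefore the same as minimising \<open>\<gamma> \<mapsto> F(\<lambda> + \<gamma>)\<close> over \<^const>\<open>Gamma_set\<close>.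

  \<^emph>\<open>The problem for vectors.\<close>  The minimiser \<open>\<mu>\<close> of the sum of squares of \<open>\<lambda> + \<gamma>\<close> exists by compactness.
  Moving a little mass between two coordinates of \<open>\<mu>\<close> shows that \<open>\<lambda> + \<mu>\<close> decreases along the
  support of \<open>\<mu>\<close>, taken from the largest entry of \<open>\<mu>\<close> downwards, and drops only where the
  majorization constraint is tight.  Two things follow.  First, cutting the
  support at the tight constraints exhibits \<open>\<mu>\<close> as an element of \<^const>\<open>E_set\<close>
  (\<open>square_minimal_in_E_set\<close>).  Second, a summation by parts shows that \<open>\<lambda> + \<mu>\<close> is majorized by \<open>\<lambda> + \<gamma>\<close> for
  all \<open>\<gamma>\<close> in \<^const>\<open>Gamma_set\<close> (\<open>square_minimal_convex_minimal\<close>), so that the same \<open>\<mu>\<close> is optimal for every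
  convex \<open>f\<close>; strict convexity at the midpoint of two minimisers makes it unique.  As block-wise
  majorization adds up, \<^const>\<open>E_set\<close> is contained in \<^const>\<open>Gamma_set\<close>, and \<open>\<mu>\<close> is also the unique minimiser
  there.
\<close>

section \<open>Majorization and convex functions\<close>

lemma sum_fun_eq_sum_mset: "sum_fun f x = sum_mset (image_mset f (mset x))"
  unfolding sum_fun_def by (metis mset_map sum_mset_sum_list)

lemma sum_fun_cong_mset: "mset x = mset y \<Longrightarrow> sum_fun f x = sum_fun f y"
  by (simp add: sum_fun_eq_sum_mset)

lemma sum_fun_nth: "sum_fun f x = (\<Sum>i<length x. f (x ! i))"
  unfolding sum_fun_def by (simp add: sum_list_sum_nth atLeast0LessThan)

lemma sum_fun_map_upt: "sum_fun f (map g [0..<n]) = (\<Sum>i<n. f (g i))"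
  by (simp add: sum_fun_nth)

lemma sum_split_two:
  fixes F :: "'b \<Rightarrow> real"
  assumes "finite I" "P \<in> I" "Q \<in> I" "P \<noteq> Q"
  shows "(\<Sum>x\<in>I. F x) = F P + F Q + (\<Sum>x\<in>I - {P, Q}. F x)"
proof -
  have "I = insert P (insert Q (I - {P, Q}))" using assms by auto
  then have "(\<Sum>x\<in>I. F x) = (\<Sum>x\<in>insert P (insert Q (I - {P, Q})). F x)" by simp
  then show ?thesis using assms by (simp add: add.assoc)
qed

text \<open>
  The functions \<open>u \<mapsto> (u - t)\<^sup>+\<close> are, up to affine functions, the extreme convex functions of one
  variable; testing with them is enough both for majorization and for convex sums.
\<close>

definition excess :: "real \<Rightarrow> real list \<Rightarrow> real" where
  "excess t x = sum_fun (\<lambda>u. max 0 (u - t)) x"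

definition convex_order :: "real list \<Rightarrow> real list \<Rightarrow> bool" where
  "convex_order x y \<longleftrightarrow> length x = length y \<and> sum_list x = sum_list y \<and>
     (\<forall>t. excess t x \<le> excess t y)"

text \<open>
  Strict convexity in the form of the three-slope inequality, which is meaningful on finite sets.
\<close>

definition increasing_slopes :: "(real \<Rightarrow> real) \<Rightarrow> real set \<Rightarrow> bool" where
  "increasing_slopes f P \<longleftrightarrow> (\<forall>x\<in>P. \<forall>y\<in>P. \<forall>z\<in>P. x < y \<longrightarrow> y < z \<longrightarrow>
     (f y - f x) / (y - x) < (f z - f y) / (z - y))"

lemma strictly_convex_increasing_slopes:
  assumes "strictly_convex_on I f" "P \<subseteq> I"
  shows "increasing_slopes f P"
  unfolding increasing_slopes_def
proof (intro ballI impI)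
  fix x y z assume xyz: "x \<in> P" "y \<in> P" "z \<in> P" "x < y" "y < z"
  define t where "t = (y - x) / (z - x)"
  have t: "0 < t" "t < 1" using xyz by (auto simp: t_def field_simps)
  have tz: "t * (z - x) = y - x" using xyz by (simp add: t_def)
  have y: "(1 - t) * x + t * z = y" using tz by (simp add: algebra_simps)
  have "f ((1 - t) * x + t * z) < (1 - t) * f x + t * f z"
    using assms xyz t unfolding strictly_convex_on_def by (metis less_trans order.irrefl subsetD)
  then have "f y < (1 - t) * f x + t * f z" unfolding y .
  then have "(z - x) * f y < (z - x) * ((1 - t) * f x + t * f z)" using xyz by simp
  also have "\<dots> = ((z - x) - t * (z - x)) * f x + (t * (z - x)) * f z" by (simp add: algebra_simps)
  also have "\<dots> = (z - y) * f x + (y - x) * f z" unfolding tz by simp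
  finally have "(f y - f x) * (z - y) < (f z - f y) * (y - x)" by (simp add: algebra_simps)
  then show "(f y - f x) / (y - x) < (f z - f y) / (z - y)" using xyz by (simp add: divide_simps)
qed

text \<open>
  A kink at the old maximum \<open>m\<close> changes nothing on \<open>P\<close>, so its size can be chosen to match \<open>f b\<close>.
  To the right of the second largest point the old representation is affine; increasing slopes
  say that \<open>f b\<close> lies above this affine function, which makes the new coefficient positive.
\<close>

lemma piecewise_linear_extension:
  fixes f :: "real \<Rightarrow> real"
  assumes fin: "finite P" and ne: "P \<noteq> {}" and lt: "Min P < Max P" and b: "\<And>a. a \<in> P \<Longrightarrow> a < b"
    and rep: "\<And>u. u \<in> P \<Longrightarrow> f u = A + B * u + (\<Sum>t\<in>P. c t * max 0 (u - t))"
    and c0: "c (Min P) = 0" "c (Max P) = 0"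
    and cpos: "increasing_slopes f P \<Longrightarrow> \<forall>t\<in>P. t \<noteq> Min P \<longrightarrow> t \<noteq> Max P \<longrightarrow> 0 < c t"
  shows "\<exists>c'. (\<forall>u\<in>insert b P. f u = A + B * u + (\<Sum>t\<in>insert b P. c' t * max 0 (u - t))) \<and>
     c' (Min P) = 0 \<and> c' b = 0 \<and>
     (increasing_slopes f (insert b P) \<longrightarrow> (\<forall>t\<in>insert b P. t \<noteq> Min P \<longrightarrow> t \<noteq> b \<longrightarrow> 0 < c' t))"
proof -
  define m where "m = Max P"
  have c0: "c (Min P) = 0" "c m = 0" using c0 by (auto simp: m_def)
  define g where "g u = A + B * u + (\<Sum>t\<in>P. c t * max 0 (u - t))" for u
  define k where "k = (f b - g b) / (b - m)"
  define c' where "c' = c(m := k, b := 0)"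
  have mP: "m \<in> P" "\<And>t. t \<in> P \<Longrightarrow> t \<le> m" using fin ne by (auto simp: m_def)
  have mb: "m < b" using b mP by auto
  have bP: "b \<notin> P" using b by auto
  have sum': "(\<Sum>t\<in>insert b P. c' t * max 0 (u - t)) =
      (\<Sum>t\<in>P. c t * max 0 (u - t)) + k * max 0 (u - m)" for u
  proof -
    have "(\<Sum>t\<in>insert b P. c' t * max 0 (u - t)) = (\<Sum>t\<in>P. c' t * max 0 (u - t))"
      using fin bP by (simp add: c'_def)
    also have "\<dots> = k * max 0 (u - m) + (\<Sum>t\<in>P - {m}. c' t * max 0 (u - t))"
      using fin mP mb by (subst sum.remove[of P m]) (auto simp: c'_def)
    also have "(\<Sum>t\<in>P - {m}. c' t * max 0 (u - t)) = (\<Sum>t\<in>P - {m}. c t * max 0 (u - t))"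
      using bP by (intro sum.cong) (auto simp: c'_def)
    also have "\<dots> = (\<Sum>t\<in>P. c t * max 0 (u - t))"
      using c0 sum.remove[OF fin mP(1), of "\<lambda>t. c t * max 0 (u - t)"] by simp
    finally show ?thesis by simp
  qed
  have "f u = A + B * u + (\<Sum>t\<in>insert b P. c' t * max 0 (u - t))" if "u \<in> insert b P" for u
  proof (cases "u = b")
    case True
    have "k * (b - m) = f b - g b" using mb by (simp add: k_def)
    then show ?thesis unfolding sum' True using mb by (simp add: g_def)
  next
    case False
    then show ?thesis unfolding sum' using rep[of u] that mP(2)[of u] by (simp add: max_def)
  qed
  moreover have "0 < c' t"
    if sl: "increasing_slopes f (insert b P)" and t: "t \<in> insert b P" "t \<noteq> Min P" "t \<noteq> b" for t
  proof (cases "t = m")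
    case False
    have "increasing_slopes f P" using sl unfolding increasing_slopes_def by blast
    then show ?thesis using cpos False t by (auto simp: c'_def m_def)
  next
    case True
    define m' where "m' = Max (P - {m})"
    have "Min P \<in> P - {m}" using fin ne lt unfolding m_def by auto
    then have "P - {m} \<noteq> {}" "finite (P - {m})" using fin by blast+
    then have "m' \<in> P - {m}" unfolding m'_def by (intro Max_in)
    moreover have "t \<le> m'" if "t \<in> P - {m}" for t
      unfolding m'_def using that fin by (intro Max_ge) simp_all
    ultimately have m': "m' \<in> P - {m}" "\<And>t. t \<in> P - {m} \<Longrightarrow> t \<le> m'" by blast+
    have m'm: "m' < m" using m' mP(2)[of m'] by auto
    define \<beta> where "\<beta> = B + (\<Sum>t\<in>P - {m}. c t)"
    define \<alpha> where "\<alpha> = A - (\<Sum>t\<in>P - {m}. c t * t)"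
    have g_lin: "g u = \<alpha> + \<beta> * u" if "m' \<le> u" for u
    proof -
      have "(\<Sum>t\<in>P. c t * max 0 (u - t)) = (\<Sum>t\<in>P - {m}. c t * max 0 (u - t))"
        using fin mP c0 by (subst sum.remove[of P m]) auto
      also have "\<dots> = (\<Sum>t\<in>P - {m}. c t * u - c t * t)"
      proof (intro sum.cong refl)
        fix t assume "t \<in> P - {m}"
        then have "t \<le> u" using m'(2)[of t] that by auto
        then show "c t * max 0 (u - t) = c t * u - c t * t" by (simp add: max_def algebra_simps)
      qed
      finally show ?thesis unfolding g_def \<alpha>_def \<beta>_def
        by (simp add: sum_subtractf sum_distrib_left algebra_simps)
    qed
    have fm: "f m = \<alpha> + \<beta> * m" "f m' = \<alpha> + \<beta> * m'"
      using rep[OF mP(1)] rep[of m'] m'(1) g_lin[of m] g_lin[of m'] m'm unfolding g_def by auto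
    have "(f m - f m') / (m - m') < (f b - f m) / (b - m)"
      using sl m' mP m'm mb unfolding increasing_slopes_def by blast
    moreover have "f m - f m' = \<beta> * (m - m')" unfolding fm by (simp add: algebra_simps)
    ultimately have "\<beta> < (f b - f m) / (b - m)" using m'm by simp
    then have "\<beta> * (b - m) < f b - f m" using mb by (simp add: field_simps)
    then have "g b < f b" using g_lin[of b] m'm mb fm by (simp add: algebra_simps)
    then show ?thesis using mb True by (simp add: c'_def k_def)
  qed
  moreover have "c' (Min P) = 0" "c' b = 0"
    using c0 lt Min_in[OF fin ne] bP by (auto simp: c'_def m_def)
  ultimately show ?thesis by (intro exI[of _ c']) blast
qed

text \<open>
  Linear interpolation through finitely many points, written with one kink per interior point.
  The coefficients are differences of consecutive slopes, hence positive for a strictly convex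
  function; without their sign the representation holds for any function, such as the indicator
  of a single point.
\<close>

lemma piecewise_linear_representation:
  fixes f :: "real \<Rightarrow> real"
  assumes "finite P"
  shows "\<exists>A B c. (\<forall>u\<in>P. f u = A + B * u + (\<Sum>t\<in>P. c t * max 0 (u - t))) \<and>
     (P \<noteq> {} \<longrightarrow> c (Min P) = 0 \<and> c (Max P) = 0) \<and>
     (increasing_slopes f P \<longrightarrow> (\<forall>t\<in>P. t \<noteq> Min P \<longrightarrow> t \<noteq> Max P \<longrightarrow> 0 < c t))"
  using assms
proof (induction P rule: finite_linorder_max_induct)
  case empty
  then show ?case by simp
next
  case (insert b P)
  have fin: "finite P" by fact
  consider "P = {}" | m where "P = {m}" | "P \<noteq> {}" "Min P < Max P"
    by (metis Max_in Max_singleton Min_in Min_le fin insert.hyps(1) Max_ge antisym_conv2 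
        empty_iff is_singletonI' is_singleton_def order.antisym)
  then show ?case
  proof cases
    case 1
    then show ?thesis by (intro exI[of _ "f b"] exI[of _ 0] exI[of _ "\<lambda>_. 0"]) auto
  next
    case (2 m)
    define B where "B = (f b - f m) / (b - m)"
    have mb: "m < b" using insert 2 by auto
    then have "B * (b - m) = f b - f m" by (simp add: B_def)
    then have "f b = f m - B * m + B * b" by (simp add: algebra_simps)
    then show ?thesis using mb unfolding 2
      by (intro exI[of _ "f m - B * m"] exI[of _ B] exI[of _ "\<lambda>_. 0"]) auto
  next
    case 3
    then obtain A B c where rep: "\<And>u. u \<in> P \<Longrightarrow> f u = A + B * u + (\<Sum>t\<in>P. c t * max 0 (u - t))"
      and c0: "c (Min P) = 0" "c (Max P) = 0"
      and cpos: "increasing_slopes f P \<Longrightarrow> \<forall>t\<in>P. t \<noteq> Min P \<longrightarrow> t \<noteq> Max P \<longrightarrow> 0 < c t"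
      using insert.IH by blast
    have b: "\<And>a. a \<in> P \<Longrightarrow> a < b" using insert by blast
    have "Max P \<in> P" "Min P \<in> P" using fin 3 by auto
    then have "Max P < b" "Min P < b" using b by auto
    then have "Max (insert b P) = b" "Min (insert b P) = Min P"
      using fin 3 by (simp_all add: max_absorb1 min_absorb2)
    then show ?thesis
      using piecewise_linear_extension[of P b f A B c, OF fin 3 b rep c0 cpos] by auto
  qed
qed

lemma sum_fun_piecewise_linear:
  assumes "\<And>u. u \<in> P \<Longrightarrow> f u = A + B * u + (\<Sum>t\<in>P. c t * max 0 (u - t))" "set x \<subseteq> P"
  shows "sum_fun f x = A * length x + B * sum_list x + (\<Sum>t\<in>P. c t * excess t x)"
  using assms(2)
proof (induction x)
  case Nil
  then show ?case by (simp add: sum_fun_def excess_def)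
next
  case (Cons u x)
  have "sum_fun f (u # x) = f u + sum_fun f x" by (simp add: sum_fun_def)
  moreover have "excess t (u # x) = max 0 (u - t) + excess t x" for t
    by (simp add: excess_def sum_fun_def)
  ultimately show ?case using Cons assms(1)[of u]
    by (simp add: algebra_simps sum.distrib)
qed

text \<open>
  The difference of the two sums is a combination of differences of excesses with the kink sizes as
  coefficients.  If it vanishes, all excesses at entries of \<open>x\<close> and \<open>y\<close> agree: at the interior entries
  because the kinks are positive, at the extreme entries because the excess there only depends on
  the total sum.  Representing the indicator of a value then shows that it occurs equally
  often in \<open>x\<close> and \<open>y\<close>.
\<close>

lemma convex_order_sum_fun:
  assumes "convex_order x y" and sc: "strictly_convex_on I f" and I: "set x \<union> set y \<subseteq> I"
  shows "sum_fun f x \<le> sum_fun f y"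
    and "sum_fun f x = sum_fun f y \<Longrightarrow> mset x = mset y"
proof -
  define P where "P = set x \<union> set y"
  have fin: "finite P" and sub: "set x \<subseteq> P" "set y \<subseteq> P" by (auto simp: P_def)
  have len: "length x = length y" and tot: "sum_list x = sum_list y"
    and ex: "\<And>t. excess t x \<le> excess t y" using assms(1) by (auto simp: convex_order_def)
  have slopes: "increasing_slopes f P"
    using strictly_convex_increasing_slopes[OF sc] I by (simp add: P_def)
  obtain A B c where rep: "\<And>u. u \<in> P \<Longrightarrow> f u = A + B * u + (\<Sum>t\<in>P. c t * max 0 (u - t))"
    and c0: "P \<noteq> {} \<Longrightarrow> c (Min P) = 0 \<and> c (Max P) = 0"
    and cpos: "\<And>t. t \<in> P \<Longrightarrow> t \<noteq> Min P \<Longrightarrow> t \<noteq> Max P \<Longrightarrow> 0 < c t"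
    using piecewise_linear_representation[OF fin, of f] slopes by blast
  have cnn: "0 \<le> c t" if "t \<in> P" for t using cpos[OF that] c0 that by fastforce
  have diff: "sum_fun f y - sum_fun f x = (\<Sum>t\<in>P. c t * (excess t y - excess t x))"
    using sum_fun_piecewise_linear[OF rep sub(1)] sum_fun_piecewise_linear[OF rep sub(2)] len tot
    by (simp add: sum_subtractf algebra_simps)
  show "sum_fun f x \<le> sum_fun f y"
    using diff sum_nonneg[of P "\<lambda>t. c t * (excess t y - excess t x)"] cnn ex by simp
  assume eq: "sum_fun f x = sum_fun f y"
  have "\<forall>t\<in>P. c t * (excess t y - excess t x) = 0"
    using diff eq fin cnn ex by (subst sum_nonneg_eq_0_iff[symmetric]) auto
  moreover have "excess t x = excess t y" if "t = Min P" for t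
  proof -
    have "excess t z = sum_list z - length z * t" if z: "set z \<subseteq> P" for z
    proof -
      have "excess t z = (\<Sum>u\<leftarrow>z. u - t)"
        unfolding excess_def sum_fun_def
        by (rule arg_cong[of _ _ sum_list], rule map_cong) (use z fin \<open>t = Min P\<close> in \<open>auto simp: max_def\<close>)
      also have "\<dots> = sum_list z - length z * t" by (induction z) (auto simp: algebra_simps)
      finally show ?thesis .
    qed
    then show ?thesis using sub len tot by simp
  qed
  moreover have "excess t x = excess t y" if "t = Max P" for t
  proof -
    have "excess t z = 0" if z: "set z \<subseteq> P" for z
    proof -
      have "excess t z = (\<Sum>u\<leftarrow>z. 0)"
        unfolding excess_def sum_fun_def
        by (rule arg_cong[of _ _ sum_list], rule map_cong)
          (use z Max_ge[OF fin] \<open>t = Max P\<close> in \<open>force simp: max_def\<close>)+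
      then show ?thesis by simp
    qed
    then show ?thesis using sub by simp
  qed
  ultimately have exeq: "excess t x = excess t y" if "t \<in> P" for t
    using that cpos[OF that] by fastforce
  show "mset x = mset y"
  proof (rule multiset_eqI)
    fix v
    define ind :: "real \<Rightarrow> real" where "ind u = (if u = v then 1 else 0)" for u
    have cnt: "count (mset z) v = sum_fun ind z" for z
      by (induction z) (auto simp: sum_fun_def ind_def)
    obtain A B c where "\<And>u. u \<in> P \<Longrightarrow> ind u = A + B * u + (\<Sum>t\<in>P. c t * max 0 (u - t))"
      using piecewise_linear_representation[OF fin, of ind] by blast
    from sum_fun_piecewise_linear[OF this sub(1)] sum_fun_piecewise_linear[OF this sub(2)]
    have "sum_fun ind x = sum_fun ind y" using len tot exeq by simp
    then show "count (mset x) v = count (mset y) v" using cnt by (metis of_nat_eq_iff)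
  qed
qed

text \<open>
  Summation by parts; the induction needs the sharper bound in which the partial sum is multiplied
  by the current weight.
\<close>

lemma abel_weighted_sum_nonneg:
  fixes w \<delta> :: "nat \<Rightarrow> real"
  assumes "antimono w" "0 \<le> w v" "u \<le> v" "\<And>j. u \<le> j \<Longrightarrow> j \<le> v \<Longrightarrow> 0 \<le> (\<Sum>i\<in>{u..<j}. \<delta> i)"
  shows "0 \<le> (\<Sum>i\<in>{u..<v}. w i * \<delta> i)"
proof -
  have "w j * (\<Sum>i\<in>{u..<j}. \<delta> i) \<le> (\<Sum>i\<in>{u..<j}. w i * \<delta> i)" if "u \<le> j" "j \<le> v" for j
    using that
  proof (induction j rule: dec_induct)
    case base
    then show ?case by simp
  next
    case (step j)
    have "w (Suc j) * (\<Sum>i\<in>{u..<Suc j}. \<delta> i) \<le> w j * (\<Sum>i\<in>{u..<Suc j}. \<delta> i)"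
      using assms(1) assms(4)[of "Suc j"] step by (intro mult_right_mono) (auto simp: antimono_def)
    then show ?case using step by (simp add: algebra_simps)
  qed
  from this[of v] show ?thesis using assms(2-4) by (smt (verit) mult_nonneg_nonneg order_refl)
qed

text \<open>
  Extending by zero beyond the length of the list has the same effect as \<^const>\<open>zero_pad\<close> for lists
  of nonnegative numbers, and makes lists of different lengths comparable.
\<close>

definition top_entry :: "real list \<Rightarrow> nat \<Rightarrow> real" where
  "top_entry x i = (if i < length x then decreasing x ! i else 0)"

lemma length_decreasing [simp]: "length (decreasing x) = length x"
  and mset_decreasing [simp]: "mset (decreasing x) = mset x"
  and set_decreasing [simp]: "set (decreasing x) = set x"
  by (simp_all add: decreasing_def)

lemma decreasing_cong_mset: "mset x = mset y \<Longrightarrow> decreasing x = decreasing y"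
  unfolding decreasing_def by (metis properties_for_sort mset_sort sorted_sort)

lemma top_entry_nonneg: "(\<And>u. u \<in> set x \<Longrightarrow> 0 \<le> u) \<Longrightarrow> 0 \<le> top_entry x i"
  unfolding top_entry_def using nth_mem[of i "decreasing x"] by auto

lemma antimono_top_entry:
  assumes "\<And>u. u \<in> set x \<Longrightarrow> 0 \<le> u"
  shows "antimono (top_entry x)"
proof (rule antimonoI)
  fix i j :: nat assume ij: "i \<le> j"
  show "top_entry x j \<le> top_entry x i"
  proof (cases "j < length x")
    case True
    have "sort x ! (length x - Suc j) \<le> sort x ! (length x - Suc i)"
      using True ij by (intro sorted_nth_mono) auto
    then show ?thesis using True ij by (simp add: top_entry_def decreasing_def rev_nth)
  next
    case False
    then show ?thesis using top_entry_nonneg[of x i] assms by (simp add: top_entry_def)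
  qed
qed

lemma sum_fun_top_entry:
  assumes "length x \<le> N" "f 0 = 0"
  shows "sum_fun f x = (\<Sum>i<N. f (top_entry x i))"
proof -
  have "sum_fun f x = sum_fun f (decreasing x)" by (rule sum_fun_cong_mset) simp
  also have "\<dots> = (\<Sum>i<length x. f (top_entry x i))" by (simp add: sum_fun_nth top_entry_def)
  also have "\<dots> = (\<Sum>i<N. f (top_entry x i))"
    using assms by (intro sum.mono_neutral_left) (auto simp: top_entry_def)
  finally show ?thesis .
qed

lemma sum_list_top_entry: "length x \<le> N \<Longrightarrow> sum_list x = (\<Sum>i<N. top_entry x i)"
  using sum_fun_top_entry[of x N "\<lambda>u. u"] by (simp add: sum_fun_def)

lemma excess_top_entry:
  "length x \<le> N \<Longrightarrow> 0 \<le> t \<Longrightarrow> excess t x = (\<Sum>i<N. max 0 (top_entry x i - t))"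
  unfolding excess_def by (rule sum_fun_top_entry) auto

lemma sum_take_decreasing_zero_pad:
  assumes nn: "\<And>u. u \<in> set x \<Longrightarrow> 0 \<le> u" and "j \<le> m" "length x \<le> m"
  shows "sum_list (take j (decreasing (zero_pad m x))) = (\<Sum>i<j. top_entry x i)"
proof -
  have "sort (zero_pad m x) = replicate (m - length x) 0 @ sort x"
    by (rule properties_for_sort) (auto simp: zero_pad_def sorted_append nn)
  then have "decreasing (zero_pad m x) = decreasing x @ replicate (m - length x) 0"
    by (simp add: decreasing_def)
  then have "take j (decreasing (zero_pad m x)) = map (top_entry x) [0..<j]"
    using assms by (intro nth_equalityI) (auto simp: top_entry_def nth_append)
  then show ?thesis by (simp add: interv_sum_list_conv_sum_set_nat atLeast0LessThan)
qed

lemma sum_list_zero_pad [simp]: "sum_list (zero_pad m x) = sum_list x"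
  by (simp add: zero_pad_def sum_list_replicate)

lemma majorized_iff_top_entry:
  assumes nn: "\<And>u. u \<in> set x \<union> set y \<Longrightarrow> 0 \<le> u"
  shows "majorized x y \<longleftrightarrow> sum_list x = sum_list y \<and>
    (\<forall>j. (\<Sum>i<j. top_entry x i) \<le> (\<Sum>i<j. top_entry y i))"
proof -
  define m where "m = max (length x) (length y)"
  have *: "(\<forall>j\<le>m. (\<Sum>i<j. top_entry x i) \<le> (\<Sum>i<j. top_entry y i)) \<longleftrightarrow>
     (\<forall>j. (\<Sum>i<j. top_entry x i) \<le> (\<Sum>i<j. top_entry y i))" if "sum_list x = sum_list y"
  proof (intro iffI allI)
    fix j assume le: "\<forall>j\<le>m. (\<Sum>i<j. top_entry x i) \<le> (\<Sum>i<j. top_entry y i)"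
    show "(\<Sum>i<j. top_entry x i) \<le> (\<Sum>i<j. top_entry y i)"
    proof (cases "j \<le> m")
      case False
      then show ?thesis using sum_list_top_entry[of x j] sum_list_top_entry[of y j] that
        by (simp add: m_def)
    qed (use le in auto)
  qed auto
  have "majorized x y \<longleftrightarrow> (\<forall>j\<le>m. (\<Sum>i<j. top_entry x i) \<le> (\<Sum>i<j. top_entry y i)) \<and>
      sum_list x = sum_list y"
    unfolding majorized_def Let_def m_def[symmetric]
    using nn by (auto simp: sum_take_decreasing_zero_pad m_def)
  then show ?thesis using * by blast
qed

text \<open>
  From partial sums to excesses, weight the entries by the indicator of being above \<open>t\<close>.  In the
  other direction take for \<open>t\<close> the entry of \<open>y\<close> at position \<open>j\<close>: then the excess of \<open>y\<close> is the sum of its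
  first \<open>j\<close> entries minus \<open>j * t\<close>, while for \<open>x\<close> this difference is only a lower bound.
\<close>

lemma majorized_iff_excess:
  assumes nn: "\<And>u. u \<in> set x \<union> set y \<Longrightarrow> 0 \<le> u"
  shows "majorized x y \<longleftrightarrow> sum_list x = sum_list y \<and> (\<forall>t\<ge>0. excess t x \<le> excess t y)"
proof -
  have anti: "antimono (top_entry x)" "antimono (top_entry y)"
    using nn by (auto intro: antimono_top_entry)
  have "(\<forall>j. (\<Sum>i<j. top_entry x i) \<le> (\<Sum>i<j. top_entry y i)) \<longleftrightarrow>
      (\<forall>t\<ge>0. excess t x \<le> excess t y)"
  proof (intro iffI allI impI)
    fix t :: real assume le: "\<forall>j. (\<Sum>i<j. top_entry x i) \<le> (\<Sum>i<j. top_entry y i)" and t: "0 \<le> t"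
    define N where "N = max (length x) (length y)"
    define w :: "nat \<Rightarrow> real" where "w i = (if t < top_entry x i then 1 else 0)" for i
    have "antimono w" using anti(1) unfolding antimono_def w_def by (smt (verit))
    moreover have "0 \<le> w N" by (simp add: w_def)
    ultimately have "0 \<le> (\<Sum>i\<in>{0..<N}. w i * (top_entry y i - top_entry x i))"
      using le by (intro abel_weighted_sum_nonneg) (auto simp: sum_subtractf atLeast0LessThan)
    then have "(\<Sum>i<N. w i * (top_entry x i - t)) \<le> (\<Sum>i<N. w i * (top_entry y i - t))"
      by (simp add: algebra_simps sum_subtractf sum.distrib atLeast0LessThan)
    also have "\<dots> \<le> (\<Sum>i<N. max 0 (top_entry y i - t))"
      by (intro sum_mono) (auto simp: w_def)
    finally show "excess t x \<le> excess t y"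
      using t by (simp add: excess_top_entry[of _ N] N_def w_def if_distrib max_def cong: if_cong)
        (smt (verit, best) sum.cong)
  next
    fix j assume le: "\<forall>t\<ge>0. excess t x \<le> excess t y"
    define N where "N = max j (max (length x) (length y))"
    define t where "t = top_entry y j"
    have t: "0 \<le> t" unfolding t_def using nn by (intro top_entry_nonneg) auto
    have "(\<Sum>i<j. top_entry x i - t) \<le> (\<Sum>i<j. max 0 (top_entry x i - t))"
      by (intro sum_mono) auto
    also have "\<dots> \<le> (\<Sum>i<N. max 0 (top_entry x i - t))"
      by (intro sum_mono2) (auto simp: N_def)
    also have "\<dots> \<le> (\<Sum>i<N. max 0 (top_entry y i - t))"
      using le t by (simp add: excess_top_entry[of _ N] N_def)
    also have "\<dots> = (\<Sum>i<j. max 0 (top_entry y i - t))"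
      using anti(2) by (intro sum.mono_neutral_right) (auto simp: N_def t_def antimono_def)
    also have "\<dots> = (\<Sum>i<j. top_entry y i - t)"
      using anti(2) by (intro sum.cong) (auto simp: t_def antimono_def)
    finally show "(\<Sum>i<j. top_entry x i) \<le> (\<Sum>i<j. top_entry y i)" by (simp add: sum_subtractf)
  qed
  then show ?thesis using majorized_iff_top_entry[OF nn] by blast
qed

section \<open>Minimal sums under majorization constraints\<close>

text \<open>
  For \<open>b = top_entry a\<close> and \<open>k = length a\<close> these are the decreasing rearrangements of the elements of
  \<^const>\<open>Gamma_set\<close>.  Sequences on all of \<open>nat\<close> make the set a closed subset of a product space.
\<close>

definition feasible :: "nat \<Rightarrow> nat \<Rightarrow> (nat \<Rightarrow> real) \<Rightarrow> (nat \<Rightarrow> real) set" where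
  "feasible d k b = {m. antimono m \<and> (\<forall>x. 0 \<le> m x) \<and> (\<forall>x\<ge>d. m x = 0) \<and>
     (\<forall>x. (\<Sum>i<x. b i) \<le> (\<Sum>i<x. m i)) \<and> (\<Sum>i<d. m i) = (\<Sum>i<k. b i)}"

lemma feasibleD:
  assumes "m \<in> feasible d k b"
  shows "antimono m" "0 \<le> m x" "d \<le> x \<Longrightarrow> m x = 0" "(\<Sum>i<x. b i) \<le> (\<Sum>i<x. m i)"
    "(\<Sum>i<d. m i) = (\<Sum>i<k. b i)"
  using assms unfolding feasible_def by auto

text \<open>
  Every entry lies between \<open>0\<close> and the total sum, so the set sits in a product of compact intervals.
\<close>

lemma compact_feasible: "compact (feasible d k b)"
proof -
  define tot where "tot = (\<Sum>i<k. b i)"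
  define Box where "Box = PiE UNIV (\<lambda>_::nat. {0..tot})"
  have "compactin (product_topology (\<lambda>_. euclidean) UNIV) Box"
    unfolding Box_def by (subst compactin_PiE) auto
  then have cB: "compact Box" by (simp add: euclidean_product_topology)
  have coord: "continuous_on UNIV (\<lambda>m::nat \<Rightarrow> real. m x)" for x
    by (rule continuous_on_product_coordinates)
  have anti: "antimono m \<longleftrightarrow> (\<forall>x. m (Suc x) \<le> m x)" for m :: "nat \<Rightarrow> real"
    by (rule decseq_Suc_iff)
  have zero: "(\<forall>x\<ge>d. m x = 0) \<longleftrightarrow> (\<forall>x. m (d + x) = 0)" for m :: "nat \<Rightarrow> real"
    by (metis le_add1 le_add_diff_inverse)
  have cl: "closed (feasible d k b)"
    unfolding feasible_def anti zero
    by (intro closed_Collect_conj closed_Collect_all closed_Collect_le closed_Collect_eq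
        continuous_on_sum coord continuous_on_const)
  have "feasible d k b \<subseteq> Box"
  proof
    fix m assume m: "m \<in> feasible d k b"
    note D = feasibleD[OF m]
    have "m x \<le> tot" for x
    proof (cases "x < d")
      case True
      then show ?thesis unfolding tot_def D(5)[symmetric]
        using D(2) by (intro member_le_sum) auto
    next
      case False
      then have "m x = 0" using D(3) by simp
      moreover have "0 \<le> (\<Sum>i<d. m i)" using D(2) by (intro sum_nonneg)
      ultimately show ?thesis unfolding tot_def D(5)[symmetric] by simp
    qed
    then show "m \<in> Box" using D(2) by (auto simp: Box_def)
  qed
  then show ?thesis using compact_Int_closed[OF cB cl] by (simp add: inf.absorb2)
qed

lemma feasible_nonempty:
  assumes "\<And>x. 0 \<le> b x" "\<And>x. k \<le> x \<Longrightarrow> b x = 0" "1 \<le> d"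
  shows "feasible d k b \<noteq> {}"
proof -
  define m where "m x = (if x = 0 then \<Sum>i<k. b i else 0)" for x :: nat
  have sm: "(\<Sum>i<x. m i) = (if x = 0 then 0 else \<Sum>i<k. b i)" for x
    by (auto simp: m_def)
  have "(\<Sum>i<x. b i) \<le> (\<Sum>i<k. b i)" for x
  proof (cases "x \<le> k")
    case True
    then show ?thesis using assms(1) by (intro sum_mono2) auto
  next
    case False
    then have "(\<Sum>i<k. b i) = (\<Sum>i<x. b i)"
      using assms(2) by (intro sum.mono_neutral_left) auto
    then show ?thesis by simp
  qed
  then have "m \<in> feasible d k b"
    unfolding feasible_def using assms sm
    by (auto simp: antimono_def m_def sum_nonneg)
  then show ?thesis by auto
qed

text \<open>
  The square stands in for all convex functions: being continuous it has a minimiser, and that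
  minimiser turns out to be optimal for every convex function.
\<close>

definition square_minimal :: "nat \<Rightarrow> nat \<Rightarrow> (nat \<Rightarrow> real) \<Rightarrow> (nat \<Rightarrow> real) \<Rightarrow> (nat \<Rightarrow> real) \<Rightarrow> bool" where
  "square_minimal d k b l m \<longleftrightarrow> m \<in> feasible d k b \<and>
     (\<forall>g\<in>feasible d k b. (\<Sum>x<d. (l x + m x)\<^sup>2) \<le> (\<Sum>x<d. (l x + g x)\<^sup>2))"

lemma square_minimal_exists:
  assumes "\<And>x. 0 \<le> b x" "\<And>x. k \<le> x \<Longrightarrow> b x = 0" "1 \<le> d"
  shows "\<exists>m. square_minimal d k b l m"
proof -
  have "continuous_on (feasible d k b) (\<lambda>m. \<Sum>x<d. (l x + m x)\<^sup>2)"
    by (intro continuous_intros continuous_on_subset[OF continuous_on_product_coordinates]) auto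
  then show ?thesis
    using continuous_attains_inf[OF compact_feasible feasible_nonempty, of b k d] assms
    unfolding square_minimal_def by blast
qed

definition transfer :: "nat \<Rightarrow> nat \<Rightarrow> real \<Rightarrow> (nat \<Rightarrow> real) \<Rightarrow> nat \<Rightarrow> real" where
  "transfer v u \<epsilon> m = m(u := m u + \<epsilon>, v := m v - \<epsilon>)"

lemma sum_transfer:
  assumes "u \<noteq> v"
  shows "(\<Sum>i<x. transfer v u \<epsilon> m i) =
    (\<Sum>i<x. m i) + (if u < x then \<epsilon> else 0) - (if v < x then \<epsilon> else 0)"
  using assms by (induction x) (auto simp: transfer_def)

text \<open>
  Only the partial sums that contain \<open>v\<close> but not \<open>u\<close> decrease, so only they need some slack.
\<close>

lemma feasible_transfer:
  assumes feas: "m \<in> feasible d k b" and uv: "u < d" "v < d" "u \<noteq> v" and \<epsilon>: "0 < \<epsilon>" "\<epsilon> \<le> m v"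
    and dec: "\<And>n. transfer v u \<epsilon> m (Suc n) \<le> transfer v u \<epsilon> m n"
    and slack: "\<And>x. v < x \<Longrightarrow> x \<le> u \<Longrightarrow> \<epsilon> \<le> (\<Sum>j<x. m j) - (\<Sum>j<x. b j)"
  shows "transfer v u \<epsilon> m \<in> feasible d k b"
  unfolding feasible_def mem_Collect_eq
proof (intro conjI allI impI)
  note D = feasibleD[OF feas]
  show "antimono (transfer v u \<epsilon> m)" unfolding decseq_Suc_iff using dec by blast
  show "0 \<le> transfer v u \<epsilon> m x" for x using D(2)[of x] \<epsilon> by (auto simp: transfer_def)
  show "transfer v u \<epsilon> m x = 0" if "d \<le> x" for x using D(3)[OF that] that uv by (auto simp: transfer_def)
  show "(\<Sum>j<x. b j) \<le> (\<Sum>j<x. transfer v u \<epsilon> m j)" for x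
    using D(4)[of x] slack[of x] uv(3) \<epsilon> by (auto simp: sum_transfer)
  show "(\<Sum>j<d. transfer v u \<epsilon> m j) = (\<Sum>j<k. b j)" using D(5) uv by (simp add: sum_transfer)
qed

text \<open>
  Writing \<open>h = l + m\<close>, the transfer changes the sum of squares by \<open>2 * \<epsilon> * (h u - h v + \<epsilon>)\<close>.
\<close>

lemma square_minimal_transfer:
  assumes min: "square_minimal d k b l m" and uv: "u < d" "v < d" "u \<noteq> v"
    and \<epsilon>: "0 < \<epsilon>" and feas: "transfer v u \<epsilon> m \<in> feasible d k b"
  shows "l v + m v \<le> l u + m u + \<epsilon>"
proof -
  define q where "q g x = (l x + g x)\<^sup>2" for g :: "nat \<Rightarrow> real" and x
  have split: "(\<Sum>x<d. q g x) = q g u + q g v + (\<Sum>x\<in>{..<d} - {u, v}. q g x)" for g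
    using uv by (intro sum_split_two) auto
  have "(\<Sum>x\<in>{..<d} - {u, v}. q (transfer v u \<epsilon> m) x) = (\<Sum>x\<in>{..<d} - {u, v}. q m x)"
    by (intro sum.cong) (auto simp: q_def transfer_def)
  moreover have "(\<Sum>x<d. q m x) \<le> (\<Sum>x<d. q (transfer v u \<epsilon> m) x)"
    using min feas unfolding square_minimal_def q_def by blast
  ultimately have "q m u + q m v \<le> q (transfer v u \<epsilon> m) u + q (transfer v u \<epsilon> m) v"
    unfolding split by simp
  then have "0 \<le> 2 * \<epsilon> * (l u + m u + \<epsilon> - (l v + m v))"
    using uv by (simp add: q_def transfer_def power2_eq_square algebra_simps)
  then show ?thesis using \<epsilon> by (simp add: zero_le_mult_iff)
qed

text \<open>
  The transfer from \<open>i\<close> to \<open>Suc i\<close> lowers only the partial sum of length \<open>Suc i\<close>.  If that constraint had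
  some slack, a small transfer would be feasible and would bring the two values of \<open>l + m\<close> closer
  together.
\<close>

lemma square_minimal_descent_tight:
  assumes min: "square_minimal d k b l m" and i: "Suc i < d"
    and l: "l i \<le> l (Suc i)" and gt: "l (Suc i) + m (Suc i) < l i + m i"
  shows "(\<Sum>j<Suc i. m j) = (\<Sum>j<Suc i. b j)"
proof (rule ccontr)
  assume ne: "(\<Sum>j<Suc i. m j) \<noteq> (\<Sum>j<Suc i. b j)"
  have feas: "m \<in> feasible d k b" using min by (simp add: square_minimal_def)
  note D = feasibleD[OF feas]
  define gap where "gap = (\<Sum>j<Suc i. m j) - (\<Sum>j<Suc i. b j)"
  have gap: "0 < gap" using ne D(4)[of "Suc i"] by (simp add: gap_def)
  define \<epsilon> where "\<epsilon> = min gap (min (m i - m (Suc i)) (l i + m i - (l (Suc i) + m (Suc i)))) / 2"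
  have \<epsilon>: "0 < \<epsilon>" "\<epsilon> \<le> gap" "2 * \<epsilon> \<le> m i - m (Suc i)"
    "2 * \<epsilon> \<le> l i + m i - (l (Suc i) + m (Suc i))"
    using gap gt l unfolding \<epsilon>_def by auto
  have dec: "m (Suc n) \<le> m n" for n using D(1) by (simp add: antimono_def)
  have "transfer i (Suc i) \<epsilon> m \<in> feasible d k b"
  proof (rule feasible_transfer[OF feas])
    show "\<epsilon> \<le> m i" using \<epsilon> D(2)[of "Suc i"] by linarith
    show "transfer i (Suc i) \<epsilon> m (Suc n) \<le> transfer i (Suc i) \<epsilon> m n" for n
      using dec[of n] \<epsilon> by (auto simp: transfer_def)
    show "\<epsilon> \<le> (\<Sum>j<x. m j) - (\<Sum>j<x. b j)" if "i < x" "x \<le> Suc i" for x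
    proof -
      have "x = Suc i" using that by simp
      then show ?thesis using \<epsilon>(2) by (simp only: gap_def)
    qed
  qed (use i \<epsilon> in auto)
  from square_minimal_transfer[OF min _ _ _ \<epsilon>(1) this] i
  have "l i + m i \<le> l (Suc i) + m (Suc i) + \<epsilon>" by simp
  then show False using \<epsilon> by linarith
qed

text \<open>
  Otherwise mass could be moved towards the front, which never violates a partial sum constraint.
  To keep the sequence decreasing the mass is taken from the last index of the plateau of \<open>m\<close> through
  \<open>Suc i\<close> and added at the first index of the plateau through \<open>i\<close>; as \<open>l\<close> increases, \<open>l + m\<close> differs there
  at least as much as at \<open>i\<close> and \<open>Suc i\<close>.
\<close>

lemma square_minimal_support_descending:
  assumes min: "square_minimal d k b l m" and i: "Suc i < d"
    and l: "\<And>x y. x \<le> y \<Longrightarrow> y < d \<Longrightarrow> l x \<le> l y" and pos: "0 < m (Suc i)"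
  shows "l (Suc i) + m (Suc i) \<le> l i + m i"
proof (rule ccontr)
  assume lt: "\<not> l (Suc i) + m (Suc i) \<le> l i + m i"
  have feas: "m \<in> feasible d k b" using min by (simp add: square_minimal_def)
  note D = feasibleD[OF feas]
  define u where "u = (LEAST u. m u = m i)"
  define v where "v = Max {v. v < d \<and> m v = m (Suc i)}"
  have u: "m u = m i" "u \<le> i" "\<And>n. n < u \<Longrightarrow> m n \<noteq> m i"
    unfolding u_def by (auto intro: LeastI Least_le dest: not_less_Least)
  have "v \<in> {v. v < d \<and> m v = m (Suc i)}"
    unfolding v_def by (rule Max_in) (use i in auto)
  then have v: "v < d" "m v = m (Suc i)" by auto
  have vmax: "n \<le> v" if "n < d" "m n = m (Suc i)" for n
    unfolding v_def by (rule Max_ge) (use that in auto)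
  have iv: "Suc i \<le> v" using vmax[of "Suc i"] i by simp
  have uv: "u < v" using u iv by simp
  have dec: "m (Suc n) \<le> m n" for n using D(1) by (simp add: antimono_def)
  have dropv: "m (Suc v) < m v"
  proof (cases "Suc v < d")
    case True
    then have "m (Suc v) \<noteq> m (Suc i)" using vmax[of "Suc v"] by auto
    then show ?thesis using dec[of v] v by simp
  next
    case False
    then show ?thesis using D(3)[of "Suc v"] v pos by simp
  qed
  have dropu: "m u < m (u - 1)" if "0 < u"
    using dec[of "u - 1"] u(3)[of "u - 1"] u(1) that by simp
  define e where "e = (if u = 0 then 1 else m (u - 1) - m u)"
  have e: "0 < e" using dropu by (simp add: e_def)
  have huv: "l u + m u < l v + m v" using lt l[of u i] l[of "Suc i" v] u v iv i by simp
  define \<epsilon> where "\<epsilon> = min e (min (m v - m (Suc v)) ((l v + m v - (l u + m u)) / 2))"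
  have \<epsilon>: "0 < \<epsilon>" "\<epsilon> \<le> e" "\<epsilon> \<le> m v - m (Suc v)" "2 * \<epsilon> \<le> l v + m v - (l u + m u)"
    using e dropv huv unfolding \<epsilon>_def by (auto simp: min_def)
  have "transfer v u \<epsilon> m \<in> feasible d k b"
  proof (rule feasible_transfer[OF feas])
    show "\<epsilon> \<le> m v" using \<epsilon> D(2)[of "Suc v"] by linarith
    show "transfer v u \<epsilon> m (Suc n) \<le> transfer v u \<epsilon> m n" for n
      using dec[of n] \<epsilon> uv by (auto simp: transfer_def e_def)
  qed (use uv v \<epsilon> in auto)
  from square_minimal_transfer[OF min _ _ _ \<epsilon>(1) this] uv v
  have "l v + m v \<le> l u + m u + \<epsilon>" by simp
  then show False using \<epsilon> by linarith
qed

definition support_size :: "(nat \<Rightarrow> real) \<Rightarrow> nat" where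
  "support_size m = (LEAST x. m x = 0)"

lemma support_size:
  assumes "m \<in> feasible d k b"
  shows "support_size m \<le> d" "x < support_size m \<Longrightarrow> 0 < m x" "support_size m \<le> x \<Longrightarrow> m x = 0"
proof -
  note D = feasibleD[OF assms]
  have z: "m (support_size m) = 0" unfolding support_size_def by (rule LeastI[of _ d]) (simp add: D)
  show "support_size m \<le> d" unfolding support_size_def by (rule Least_le) (simp add: D)
  show "0 < m x" if "x < support_size m"
    using that D(2)[of x] not_less_Least[of x "\<lambda>x. m x = 0"] unfolding support_size_def by fastforce
  show "m x = 0" if "support_size m \<le> x"
    using antimonoD[OF D(1) that] z D(2)[of x] by simp
qed

lemma square_minimal_antimono_on_support:
  assumes min: "square_minimal d k b l m"
    and l: "\<And>x y. x \<le> y \<Longrightarrow> y < d \<Longrightarrow> l x \<le> l y"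
    and xy: "x \<le> y" "y < support_size m"
  shows "l y + m y \<le> l x + m x"
  using xy
proof (induction y rule: dec_induct)
  case (step n)
  have feas: "m \<in> feasible d k b" using min by (simp add: square_minimal_def)
  have "l (Suc n) + m (Suc n) \<le> l n + m n"
    using support_size[OF feas] step
    by (intro square_minimal_support_descending[OF min _ l]) (auto intro: less_le_trans)
  then show ?case using step by simp
qed simp

text \<open>
  Let \<open>h = l + m\<close>.  Replacing \<open>(u - t)\<^sup>+\<close> by its tangent at \<open>h\<close>, it remains to see that the sum of
  \<open>g - m\<close> over the indices with \<open>h > t\<close> is nonnegative.  On the support of \<open>m\<close> these indices form an
  initial segment of some length \<open>q\<close>, and beyond the support \<open>m\<close> vanishes.  Let \<open>q > 0\<close>.  If \<open>h\<close> drops at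
  \<open>q\<close> then the constraint at \<open>q\<close> is tight for \<open>m\<close>; if not, then \<open>q\<close> is the size of the support, \<open>h > t\<close> everywhere, and
  both sequences have the same total.
\<close>

lemma square_minimal_convex_minimal:
  assumes min: "square_minimal d k b l m" and g: "g \<in> feasible d k b"
    and l: "\<And>x y. x \<le> y \<Longrightarrow> y < d \<Longrightarrow> l x \<le> l y"
  shows "(\<Sum>x<d. max 0 (l x + m x - t)) \<le> (\<Sum>x<d. max 0 (l x + g x - t))"
proof -
  have feas: "m \<in> feasible d k b" using min by (simp add: square_minimal_def)
  note M = feasibleD[OF feas] and G = feasibleD[OF g]
  define h where "h x = l x + m x" for x
  define s where "s = support_size m"
  have s: "s \<le> d" "\<And>x. s \<le> x \<Longrightarrow> m x = 0" using support_size[OF feas] by (auto simp: s_def)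
  have h_dec: "h y \<le> h x" if "x \<le> y" "y < s" for x y
    using square_minimal_antimono_on_support[OF min l] that unfolding h_def s_def by blast
  \<comment> \<open>The slope at \<open>h x\<close> of the function \<open>u \<mapsto> (u - t)\<^sup>+\<close>.\<close>
  define w :: "nat \<Rightarrow> real" where "w x = (if t < h x then 1 else 0)" for x
  have tight: "(\<Sum>i<Suc n. m i) \<le> (\<Sum>i<Suc n. g i)" if "h (Suc n) < h n" "Suc n < d" for n
    using square_minimal_descent_tight[OF min that(2)] l[of n "Suc n"] that G(4)[of "Suc n"]
    unfolding h_def by simp
  define q where "q = (LEAST q. s \<le> q \<or> h q \<le> t)"
  have q: "s \<le> q \<or> h q \<le> t" unfolding q_def by (rule LeastI[of _ s]) simp
  have qs: "q \<le> s" unfolding q_def by (rule Least_le) simp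
  have w1: "w x = 1" if "x < q" for x
    using not_less_Least[of x "\<lambda>q. s \<le> q \<or> h q \<le> t"] that unfolding q_def w_def by auto
  have w0: "w x = 0" if "q \<le> x" "x < s" for x
    using q h_dec[of q x] that unfolding w_def by auto
  have tail: "0 \<le> (\<Sum>x\<in>{s..<d}. w x * (g x - m x))"
    using s G(2) by (intro sum_nonneg) (auto simp: w_def)
  have split: "(\<Sum>x<d. w x * (g x - m x)) =
      (\<Sum>x<q. g x - m x) + (\<Sum>x\<in>{s..<d}. w x * (g x - m x))"
  proof -
    have "(\<Sum>x<d. w x * (g x - m x)) =
        (\<Sum>x<q. w x * (g x - m x)) + (\<Sum>x\<in>{q..<s}. w x * (g x - m x)) +
        (\<Sum>x\<in>{s..<d}. w x * (g x - m x))"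
      using sum.atLeastLessThan_concat[of 0 q s "\<lambda>x. w x * (g x - m x)"]
        sum.atLeastLessThan_concat[of 0 s d "\<lambda>x. w x * (g x - m x)"] qs s
      by (simp only: atLeast0LessThan)
    then show ?thesis using w1 w0 by simp
  qed
  have "0 \<le> (\<Sum>x<d. w x * (g x - m x))"
  proof (cases q)
    case 0
    then show ?thesis using split tail by simp
  next
    case (Suc n)
    have hn: "t < h n" using w1[of n] Suc by (simp add: w_def split: if_splits)
    consider "h q < h n" "q < d" | "q = d" | "q = s" "s < d" "h n \<le> h s"
    proof (cases "q = s")
      case True
      then show ?thesis using that s(1) by (cases "s = d"; cases "h n \<le> h s") auto
    next
      case False
      then show ?thesis using that(1) q qs s(1) hn by auto
    qed
    then show ?thesis
    proof cases
      case 1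
      then show ?thesis using split tail tight[of n] Suc by (simp add: sum_subtractf)
    next
      case 2
      then show ?thesis using split tail M(5) G(5) by (simp add: sum_subtractf)
    next
      case 3
      have "w x = 1" if "s \<le> x" "x < d" for x
        using l[OF that] s that 3 hn by (simp add: w_def h_def)
      then have "w x = 1" if "x < d" for x using w1[of x] 3 that by (cases "x < s") auto
      then have "(\<Sum>x<d. w x * (g x - m x)) = (\<Sum>x<d. g x - m x)" by simp
      then show ?thesis using M(5) G(5) by (simp add: sum_subtractf)
    qed
  qed
  then have "(\<Sum>x<d. w x * (h x - t)) \<le> (\<Sum>x<d. w x * (l x + g x - t))"
    unfolding h_def by (simp add: algebra_simps sum_subtractf sum.distrib)
  also have "\<dots> \<le> (\<Sum>x<d. max 0 (l x + g x - t))"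
    by (intro sum_mono) (auto simp: w_def)
  also have "(\<Sum>x<d. w x * (h x - t)) = (\<Sum>x<d. max 0 (l x + m x - t))"
    by (intro sum.cong) (auto simp: w_def h_def)
  finally show ?thesis .
qed


section \<open>The block structure of the minimiser\<close>

definition tight_points :: "(nat \<Rightarrow> real) \<Rightarrow> (nat \<Rightarrow> real) \<Rightarrow> nat \<Rightarrow> nat set" where
  "tight_points b m s = {x. 0 < x \<and> x < s \<and> (\<Sum>i<x. m i) = (\<Sum>i<x. b i)}"

text \<open>
  Cutting at the points of \<open>T\<close> numbers the resulting blocks from \<open>0\<close>; a point of \<open>T\<close> starts a new block.
\<close>

definition block_index :: "nat set \<Rightarrow> nat \<Rightarrow> nat" where
  "block_index T x = card {t \<in> T. t \<le> x}"

lemma finite_tight_points: "finite (tight_points b m s)"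
  by (rule finite_subset[of _ "{..<s}"]) (auto simp: tight_points_def)

lemma block_index_mono: "finite T \<Longrightarrow> x \<le> y \<Longrightarrow> block_index T x \<le> block_index T y"
  unfolding block_index_def by (intro card_mono) auto

lemma block_index_le_card: "finite T \<Longrightarrow> block_index T x \<le> card T"
  unfolding block_index_def by (intro card_mono) auto

lemma block_index_Suc:
  assumes "finite T"
  shows "block_index T (Suc x) = block_index T x + (if Suc x \<in> T then 1 else 0)"
proof -
  have "{t \<in> T. t \<le> Suc x} = {t \<in> T. t \<le> x} \<union> (if Suc x \<in> T then {Suc x} else {})"
    by (auto simp: le_Suc_eq)
  then show ?thesis unfolding block_index_def using assms by auto
qed

lemma block_index_0: "0 \<notin> T \<Longrightarrow> block_index T 0 = 0"
  by (auto simp: block_index_def card_eq_0_iff)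

text \<open>
  The block index starts at \<open>0\<close> and grows in steps of at most one.
\<close>

lemma block_index_attained:
  assumes T: "finite T" "0 \<notin> T" "T \<subseteq> {..<s}" and s: "1 \<le> s" and i: "i \<le> card T"
  shows "\<exists>x<s. block_index T x = i"
proof -
  have last: "block_index T (s - 1) = card T"
    unfolding block_index_def using T(3) s by (intro arg_cong[of _ _ card]) fastforce
  define x where "x = (LEAST x. i \<le> block_index T x)"
  have x: "i \<le> block_index T x" "x \<le> s - 1"
    unfolding x_def using last i by (auto intro: LeastI[of _ "s - 1"] Least_le)
  have "block_index T x = i"
  proof (cases x)
    case 0
    then show ?thesis using x block_index_0[OF T(2)] by simp
  next
    case (Suc y)
    then have "\<not> i \<le> block_index T y" unfolding x_def by (intro not_less_Least) simp
    then show ?thesis using block_index_Suc[OF T(1), of y] x Suc by (simp split: if_splits)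
  qed
  then show ?thesis using x s by (intro exI[of _ x]) auto
qed

lemma block_index_interval:
  assumes T: "finite T" and X: "X = {x. x < N \<and> block_index T x = i}" "X \<noteq> {}"
  obtains u v where "u \<le> v" "v \<le> N" "X = {u..<v}" "u = 0 \<or> u \<in> T" "v = N \<or> v \<in> T"
proof
  define u where "u = Min X"
  define M where "M = Max X"
  have fin: "finite X" using X by auto
  have u: "u \<in> X" "\<And>x. x \<in> X \<Longrightarrow> u \<le> x" using fin X(2) by (auto simp: u_def)
  have M: "M \<in> X" "\<And>x. x \<in> X \<Longrightarrow> x \<le> M" using fin X(2) by (auto simp: M_def)
  show "u \<le> Suc M" using u(2)[OF M(1)] by simp
  show "Suc M \<le> N" using M(1) X by auto
  show "X = {u..<Suc M}"
  proof
    show "X \<subseteq> {u..<Suc M}" using u M by (force simp: less_Suc_eq_le)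
    show "{u..<Suc M} \<subseteq> X"
    proof
      fix x assume "x \<in> {u..<Suc M}"
      then have "u \<le> x" "x \<le> M" by auto
      then show "x \<in> X" using block_index_mono[OF T, of u x] block_index_mono[OF T, of x M] u(1) M(1)
        unfolding X(1) by auto
    qed
  qed
  show "u = 0 \<or> u \<in> T"
  proof (cases u)
    case (Suc y)
    then have "y \<notin> X" using u(2)[of y] by auto
    then show ?thesis using u(1) block_index_Suc[OF T, of y] Suc unfolding X(1)
      by (auto split: if_splits)
  qed simp
  show "Suc M = N \<or> Suc M \<in> T"
  proof (cases "Suc M < N")
    case True
    have "Suc M \<notin> X" using M(2)[of "Suc M"] by auto
    then show ?thesis using M(1) True block_index_Suc[OF T, of M] unfolding X(1)
      by (auto split: if_splits)
  qed (use M(1) X in auto)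
qed

text \<open>
  The partial sums of \<open>m\<close> and \<open>b\<close> agree at both ends of a block, so the summation by parts
  can be done inside the block.  The last block has to be continued to \<open>max d k\<close>, because \<open>b\<close> may be
  longer than the support of \<open>m\<close>.
\<close>

lemma blocks_majorized:
  assumes feas: "m \<in> feasible d k b" and b: "antimono b" "\<And>x. k \<le> x \<Longrightarrow> b x = 0"
  defines "s \<equiv> support_size m"
  defines "\<gamma> \<equiv> block_index (tight_points b m s)"
  shows "(\<Sum>x | x < k \<and> \<gamma> x = i. b x) = (\<Sum>x | x < s \<and> \<gamma> x = i. m x)"
    and "0 \<le> t \<Longrightarrow> (\<Sum>x | x < k \<and> \<gamma> x = i. max 0 (b x - t)) \<le>
      (\<Sum>x | x < s \<and> \<gamma> x = i. max 0 (m x - t))"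
proof -
  note D = feasibleD[OF feas]
  define N where "N = max d k"
  define X where "X = {x. x < N \<and> \<gamma> x = i}"
  have fin: "finite (tight_points b m s)" by (rule finite_tight_points)
  have s: "s \<le> d" "\<And>x. s \<le> x \<Longrightarrow> m x = 0" using support_size[OF feas] by (auto simp: s_def)
  have sum_b: "(\<Sum>x | x < k \<and> \<gamma> x = i. F (b x)) = (\<Sum>x\<in>X. F (b x))" if "F 0 = 0" for F :: "real \<Rightarrow> real"
  proof (rule sum.mono_neutral_left)
    show "\<forall>x\<in>X - {x. x < k \<and> \<gamma> x = i}. F (b x) = 0"
    proof
      fix x assume "x \<in> X - {x. x < k \<and> \<gamma> x = i}"
      then have "k \<le> x" by (auto simp: X_def)
      then show "F (b x) = 0" using b(2) that by simp
    qed
  qed (auto simp: X_def N_def)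
  have sum_m: "(\<Sum>x | x < s \<and> \<gamma> x = i. F (m x)) = (\<Sum>x\<in>X. F (m x))" if "F 0 = 0" for F :: "real \<Rightarrow> real"
  proof (rule sum.mono_neutral_left)
    show "\<forall>x\<in>X - {x. x < s \<and> \<gamma> x = i}. F (m x) = 0"
    proof
      fix x assume "x \<in> X - {x. x < s \<and> \<gamma> x = i}"
      then have "s \<le> x" by (auto simp: X_def)
      then show "F (m x) = 0" using s(2) that by simp
    qed
  qed (use s(1) in \<open>auto simp: X_def N_def\<close>)
  have "(\<Sum>x\<in>X. b x) = (\<Sum>x\<in>X. m x) \<and>
      (\<forall>t\<ge>0. (\<Sum>x\<in>X. max 0 (b x - t)) \<le> (\<Sum>x\<in>X. max 0 (m x - t)))"
  proof (cases "X = {}")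
    case False
    obtain u v where uv: "u \<le> v" "v \<le> N" "X = {u..<v}" "u = 0 \<or> u \<in> tight_points b m s"
      "v = N \<or> v \<in> tight_points b m s"
      using block_index_interval[OF fin X_def[unfolded \<gamma>_def] False] by metis
    define \<Delta> where "\<Delta> x = (\<Sum>i<x. m i) - (\<Sum>i<x. b i)" for x
    have "(\<Sum>i<N. m i) = (\<Sum>i<d. m i)"
      by (rule sum.mono_neutral_right) (use D(3) in \<open>auto simp: N_def\<close>)
    moreover have "(\<Sum>i<N. b i) = (\<Sum>i<k. b i)"
      by (rule sum.mono_neutral_right) (use b in \<open>auto simp: N_def\<close>)
    ultimately have "\<Delta> N = 0" using D(5) by (simp add: \<Delta>_def)
    then have zero: "\<Delta> u = 0" "\<Delta> v = 0" using uv by (auto simp: \<Delta>_def tight_points_def)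
    have part: "(\<Sum>i\<in>{u..<j}. m i - b i) = \<Delta> j" if "u \<le> j" for j
      using sum.atLeastLessThan_concat[of 0 u j "\<lambda>i. m i - b i"] that zero
      by (simp add: atLeast0LessThan \<Delta>_def sum_subtractf)
    have "0 \<le> \<Delta> j" for j using D(4) by (simp add: \<Delta>_def)
    then have nn: "0 \<le> (\<Sum>i\<in>{u..<j}. m i - b i)" if "u \<le> j" for j using part[OF that] by simp
    have "(\<Sum>x\<in>X. max 0 (b x - t)) \<le> (\<Sum>x\<in>X. max 0 (m x - t))" for t
    proof -
      define w :: "nat \<Rightarrow> real" where "w x = (if t < b x then 1 else 0)" for x
      have "antimono w" using b(1) unfolding antimono_def w_def by (smt (verit))
      moreover have "0 \<le> w v" by (simp add: w_def)
      ultimately have "0 \<le> (\<Sum>x\<in>{u..<v}. w x * (m x - b x))"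
        using nn uv(1) by (intro abel_weighted_sum_nonneg) auto
      then have "(\<Sum>x\<in>X. w x * (b x - t)) \<le> (\<Sum>x\<in>X. w x * (m x - t))"
        unfolding uv(3) by (simp add: algebra_simps sum_subtractf sum.distrib)
      also have "\<dots> \<le> (\<Sum>x\<in>X. max 0 (m x - t))" by (intro sum_mono) (auto simp: w_def)
      also have "(\<Sum>x\<in>X. w x * (b x - t)) = (\<Sum>x\<in>X. max 0 (b x - t))"
        by (intro sum.cong) (auto simp: w_def)
      finally show ?thesis .
    qed
    moreover have "(\<Sum>x\<in>X. b x) = (\<Sum>x\<in>X. m x)"
      using part[OF uv(1)] zero uv(3) by (simp add: sum_subtractf)
    ultimately show ?thesis by blast
  qed simp
  then show "(\<Sum>x | x < k \<and> \<gamma> x = i. b x) = (\<Sum>x | x < s \<and> \<gamma> x = i. m x)"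
    and "0 \<le> t \<Longrightarrow> (\<Sum>x | x < k \<and> \<gamma> x = i. max 0 (b x - t)) \<le>
      (\<Sum>x | x < s \<and> \<gamma> x = i. max 0 (m x - t))"
    using sum_b[of "\<lambda>u. u"] sum_m[of "\<lambda>u. u"] sum_b[of "\<lambda>u. max 0 (u - t)"]
      sum_m[of "\<lambda>u. max 0 (u - t)"] by auto
qed

lemma support_size_bounds:
  assumes feas: "m \<in> feasible d k b" and b: "\<And>x. x < k \<Longrightarrow> 0 < b x" and k: "1 \<le> k"
  shows "1 \<le> support_size m" "support_size m \<le> k"
proof -
  note D = feasibleD[OF feas] and S = support_size[OF feas]
  have "0 < (\<Sum>i<k. b i)" using b k by (intro sum_pos) (auto simp: lessThan_empty_iff)
  then show "1 \<le> support_size m" using D(5) S(3)[of] by (cases "support_size m") auto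
  show "support_size m \<le> k"
  proof (rule ccontr)
    assume "\<not> support_size m \<le> k"
    then have k': "k < support_size m" "k < d" using S(1) by auto
    have "(\<Sum>i<k. m i) < (\<Sum>i<d. m i)"
      using k' D(2) S(2)[OF k'(1)] by (intro sum_strict_mono2[of "{..<d}" "{..<k}" k]) auto
    then show False using D(4)[of k] D(5) by simp
  qed
qed

text \<open>
  Inside a block \<open>l + m\<close> cannot increase, being on the support, nor decrease, as no constraint is tight.
\<close>

lemma square_minimal_constant_on_blocks:
  assumes min: "square_minimal d k b l m"
    and l: "\<And>x y. x \<le> y \<Longrightarrow> y < d \<Longrightarrow> l x \<le> l y"
  defines "s \<equiv> support_size m"
  defines "\<gamma> \<equiv> block_index (tight_points b m s)"
  assumes xy: "x < s" "y < s" "\<gamma> x = \<gamma> y"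
  shows "l x + m x = l y + m y"
proof -
  have feas: "m \<in> feasible d k b" using min by (simp add: square_minimal_def)
  have sd: "s \<le> d" using support_size(1)[OF feas] by (simp add: s_def)
  have *: "l x + m x = l y + m y" if "x \<le> y" "y < s" "\<gamma> x = \<gamma> y" for x y
    using that
  proof (induction y rule: dec_induct)
    case (step n)
    have "\<gamma> x \<le> \<gamma> n" "\<gamma> n \<le> \<gamma> (Suc n)"
      unfolding \<gamma>_def using step.hyps
      by (simp_all add: block_index_mono finite_tight_points)
    with step.prems(2) have eq: "\<gamma> x = \<gamma> n" and eq': "\<gamma> (Suc n) = \<gamma> n" by linarith+
    have "Suc n \<notin> tight_points b m s"
      using eq' block_index_Suc[OF finite_tight_points, of b m s n] unfolding \<gamma>_def
      by (simp split: if_splits)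
    then have "(\<Sum>j<Suc n. m j) \<noteq> (\<Sum>j<Suc n. b j)" using step by (auto simp: tight_points_def)
    then have "\<not> l (Suc n) + m (Suc n) < l n + m n"
      using square_minimal_descent_tight[OF min, of n] l[of n "Suc n"] step sd by auto
    moreover have "l (Suc n) + m (Suc n) \<le> l n + m n"
      using square_minimal_antimono_on_support[OF min l, of n "Suc n"] step by (simp add: s_def)
    ultimately have "l (Suc n) + m (Suc n) = l n + m n" by simp
    then show ?case using step.IH step.prems(1) eq by simp
  qed simp
  show ?thesis
  proof (cases "x \<le> y")
    case True
    then show ?thesis using xy(2,3) by (rule *)
  next
    case False
    then show ?thesis using *[OF _ xy(1) xy(3)[symmetric]] by simp
  qed
qed

section \<open>A matrix with prescribed row Gramian and column norms\<close>

text \<open>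
  The matrix \<open>diag(p, q)\<close> is the sum of \<open>g g\<^sup>T\<close> with \<open>g = (x, y)\<close> of squared norm \<open>\<alpha>\<close> and \<open>\<beta> u u\<^sup>T\<close> with the unit
  vector \<open>u = (c, s)\<close>.
\<close>

lemma rank_one_splitting_of_two_eigenvalues:
  fixes p q \<alpha> \<beta> :: real
  assumes q: "0 \<le> q" "q < \<alpha>" and p: "\<alpha> \<le> p" and \<beta>: "\<beta> = p + q - \<alpha>"
  obtains x y c s where "x\<^sup>2 + y\<^sup>2 = \<alpha>" "c\<^sup>2 + s\<^sup>2 = 1" "x\<^sup>2 + c\<^sup>2 * \<beta> = p" "y\<^sup>2 + s\<^sup>2 * \<beta> = q"
    "x * y + c * s * \<beta> = 0"
proof (cases "q = 0")
  case True
  then show ?thesis using that[of "sqrt \<alpha>" 0 1 0] assms by simp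
next
  case False
  define w where "w = p - q"
  have w: "0 < w" "0 < \<beta>" "0 < q" "0 < p" using assms False by (auto simp: w_def)
  have nz: "w \<noteq> 0" "\<beta> \<noteq> 0" using w by auto
  define x where "x = sqrt p * sqrt (\<alpha> - q) / sqrt w"
  define y where "y = - (sqrt q * sqrt (p - \<alpha>) / sqrt w)"
  define c where "c = sqrt p * sqrt (p - \<alpha>) / (sqrt \<beta> * sqrt w)"
  define s where "s = sqrt q * sqrt (\<alpha> - q) / (sqrt \<beta> * sqrt w)"
  have sq: "x\<^sup>2 = p * (\<alpha> - q) / w" "y\<^sup>2 = q * (p - \<alpha>) / w"
    "c\<^sup>2 = p * (p - \<alpha>) / (\<beta> * w)" "s\<^sup>2 = q * (\<alpha> - q) / (\<beta> * w)"
    using assms w by (simp_all add: x_def y_def c_def s_def power_mult_distrib power_divide)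
  show ?thesis
  proof (rule that)
    have "p * (\<alpha> - q) + q * (p - \<alpha>) = \<alpha> * w" by (simp add: w_def algebra_simps)
    then show "x\<^sup>2 + y\<^sup>2 = \<alpha>" unfolding sq using nz by (simp add: field_simps)
    have "p * (p - \<alpha>) + q * (\<alpha> - q) = \<beta> * w" by (simp add: w_def \<beta> algebra_simps)
    then show "c\<^sup>2 + s\<^sup>2 = 1" unfolding sq using nz by (simp add: add_divide_distrib[symmetric])
    have "p * (\<alpha> - q) + p * (p - \<alpha>) = p * w" by (simp add: w_def algebra_simps)
    then show "x\<^sup>2 + c\<^sup>2 * \<beta> = p" unfolding sq using nz by (simp add: field_simps)
    have "q * (p - \<alpha>) + q * (\<alpha> - q) = q * w" by (simp add: w_def algebra_simps)
    then show "y\<^sup>2 + s\<^sup>2 * \<beta> = q" unfolding sq using nz by (simp add: field_simps)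
    have "sqrt \<beta> * sqrt \<beta> = \<beta>" "sqrt w * sqrt w = w" using w by auto
    then have "c * s * \<beta> = sqrt p * sqrt (p - \<alpha>) * (sqrt q * sqrt (\<alpha> - q)) / w"
      unfolding c_def s_def using nz by (simp add: field_simps)
    moreover have "x * y = - (sqrt p * sqrt (\<alpha> - q) * (sqrt q * sqrt (p - \<alpha>)) / w)"
      unfolding x_def y_def using w by (simp add: field_simps)
    ultimately show "x * y + c * s * \<beta> = 0" by simp
  qed
qed

lemma obtain_minimal:
  fixes f :: "'b \<Rightarrow> real"
  assumes "finite S" "S \<noteq> {}"
  obtains x where "x \<in> S" "\<And>y. y \<in> S \<Longrightarrow> f x \<le> f y"
  using assms by (metis arg_min_if_finite(1) arg_min_least)

lemma obtain_maximal:
  fixes f :: "'b \<Rightarrow> real"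
  assumes "finite S" "S \<noteq> {}"
  obtains x where "x \<in> S" "\<And>y. y \<in> S \<Longrightarrow> f y \<le> f x"
  using obtain_minimal[OF assms, of "\<lambda>x. - f x"] by auto

text \<open>
  Outside the gap between \<open>\<mu> Q\<close> and \<open>\<mu> P\<close> both sides lose the same amount.  Inside the gap, let \<open>S\<close> be the set
  of remaining \<open>a j\<close> above \<open>t\<close> and \<open>B\<close> the set of remaining \<open>\<mu> x\<close> above the gap.  If \<open>S\<close> is not larger than \<open>B\<close>, the
  bound holds term by term, because \<open>a i0\<close> is maximal.  If it is larger, then
  it has at least one more element, and the hypothesis at \<open>t = \<mu> Q\<close>, where the excess of \<open>a\<close> contains at
  least \<open>card B + 2\<close> terms, is strong enough.
\<close>

lemma excess_after_splitting:
  fixes a :: "'i \<Rightarrow> real" and \<mu> :: "nat \<Rightarrow> real"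
  assumes fin: "finite J" "finite I" and i0: "i0 \<in> J" "\<And>j. j \<in> J \<Longrightarrow> a j \<le> a i0"
    and PQ: "P \<in> I" "Q \<in> I" "a i0 \<le> \<mu> P" "\<mu> Q < a i0" "0 \<le> \<mu> Q"
    and gap: "\<And>x. x \<in> I \<Longrightarrow> \<mu> P \<le> \<mu> x \<or> \<mu> x \<le> \<mu> Q"
    and le: "\<And>t. 0 \<le> t \<Longrightarrow> (\<Sum>j\<in>J. max 0 (a j - t)) \<le> (\<Sum>x\<in>I. max 0 (\<mu> x - t))"
    and t: "0 \<le> t"
  shows "(\<Sum>j\<in>J - {i0}. max 0 (a j - t)) \<le>
    (\<Sum>x\<in>I. max 0 ((\<mu>(P := \<mu> P + \<mu> Q - a i0, Q := 0)) x - t))"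
proof -
  define \<alpha> where "\<alpha> = a i0"
  define p where "p = \<mu> P"
  define q where "q = \<mu> Q"
  define \<beta> where "\<beta> = p + q - \<alpha>"
  have pq: "0 \<le> q" "q < \<alpha>" "\<alpha> \<le> p" "q \<le> \<beta>" "\<beta> \<le> p"
    using PQ by (auto simp: \<alpha>_def p_def q_def \<beta>_def)
  have ne: "P \<noteq> Q" using PQ by auto
  define R where "R = I - {P, Q}"
  have finR: "finite R" using fin by (simp add: R_def)
  have split: "(\<Sum>x\<in>I. F x) = F P + F Q + (\<Sum>x\<in>R. F x)" for F :: "nat \<Rightarrow> real"
    unfolding R_def by (rule sum_split_two[OF fin(2) PQ(1,2) ne])
  have new: "(\<Sum>x\<in>I. max 0 ((\<mu>(P := \<mu> P + \<mu> Q - a i0, Q := 0)) x - t)) =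
      max 0 (\<beta> - t) + (\<Sum>x\<in>R. max 0 (\<mu> x - t))"
  proof -
    have "(\<Sum>x\<in>R. max 0 ((\<mu>(P := \<mu> P + \<mu> Q - a i0, Q := 0)) x - t)) = (\<Sum>x\<in>R. max 0 (\<mu> x - t))"
      by (intro sum.cong) (auto simp: R_def)
    then show ?thesis unfolding split using ne t by (simp add: \<beta>_def p_def q_def \<alpha>_def)
  qed
  have old: "(\<Sum>x\<in>I. max 0 (\<mu> x - s)) = max 0 (p - s) + max 0 (q - s) + (\<Sum>x\<in>R. max 0 (\<mu> x - s))" for s
    unfolding split by (simp add: p_def q_def)
  have J': "(\<Sum>j\<in>J. max 0 (a j - s)) = max 0 (\<alpha> - s) + (\<Sum>j\<in>J - {i0}. max 0 (a j - s))" for s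
    using sum.remove[OF fin(1) i0(1), of "\<lambda>j. max 0 (a j - s)"] by (simp add: \<alpha>_def)
  consider "t \<le> q \<or> p \<le> t" | "\<alpha> \<le> t" | "q < t" "t < \<alpha>" by linarith
  then show ?thesis
  proof cases
    case 1
    then have "max 0 (p - t) + max 0 (q - t) = max 0 (\<alpha> - t) + max 0 (\<beta> - t)"
      using pq by (auto simp: \<beta>_def max_def)
    then show ?thesis using le[OF t] J'[of t] old[of t] new by simp
  next
    case 2
    have "(\<Sum>j\<in>J - {i0}. max 0 (a j - t)) = 0"
    proof (intro sum.neutral ballI)
      fix j assume "j \<in> J - {i0}"
      then have "a j \<le> t" using i0(2)[of j] 2 by (simp add: \<alpha>_def)
      then show "max 0 (a j - t) = 0" by simp
    qed
    then show ?thesis by (simp add: sum_nonneg)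
  next
    case 3
    define B where "B = {x \<in> R. \<alpha> \<le> \<mu> x}"
    have finB: "finite B" using finR by (simp add: B_def)
    have R_B: "(\<Sum>x\<in>R. max 0 (\<mu> x - s)) = (\<Sum>x\<in>B. \<mu> x - s)" if "q \<le> s" "s < \<alpha>" for s
    proof -
      have "(\<Sum>x\<in>R. max 0 (\<mu> x - s)) = (\<Sum>x\<in>B. max 0 (\<mu> x - s))"
      proof (rule sum.mono_neutral_right[OF finR])
        show "\<forall>x\<in>R - B. max 0 (\<mu> x - s) = 0"
        proof
          fix x assume "x \<in> R - B"
          then have "x \<in> I" "\<mu> x < \<alpha>" by (auto simp: R_def B_def)
          then have "\<mu> x \<le> q" using gap[of x] pq by (auto simp: p_def q_def)
          then show "max 0 (\<mu> x - s) = 0" using that by simp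
        qed
      qed (auto simp: B_def)
      also have "\<dots> = (\<Sum>x\<in>B. \<mu> x - s)" using that by (intro sum.cong) (auto simp: B_def)
      finally show ?thesis .
    qed
    define S where "S = {j \<in> J - {i0}. t < a j}"
    have finS: "finite S" using fin by (simp add: S_def)
    have J_S: "(\<Sum>j\<in>J - {i0}. max 0 (a j - t)) = (\<Sum>j\<in>S. a j - t)"
    proof -
      have "(\<Sum>j\<in>J - {i0}. max 0 (a j - t)) = (\<Sum>j\<in>S. max 0 (a j - t))"
        using fin by (intro sum.mono_neutral_right) (auto simp: S_def)
      also have "\<dots> = (\<Sum>j\<in>S. a j - t)" by (intro sum.cong) (auto simp: S_def)
      finally show ?thesis .
    qed
    have "(\<Sum>j\<in>S. a j - t) \<le> (\<Sum>x\<in>B. \<mu> x - t) + max 0 (\<beta> - t)"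
    proof (cases "card S \<le> card B")
      case True
      have "(\<Sum>j\<in>S. a j - t) \<le> (\<Sum>j\<in>S. \<alpha> - t)"
        using i0 by (intro sum_mono) (auto simp: S_def \<alpha>_def)
      also have "\<dots> = card S * (\<alpha> - t)" by simp
      also have "\<dots> \<le> card B * (\<alpha> - t)" using True 3 by (intro mult_right_mono) auto
      also have "\<dots> = (\<Sum>x\<in>B. \<alpha> - t)" by simp
      also have "\<dots> \<le> (\<Sum>x\<in>B. \<mu> x - t)" by (intro sum_mono) (auto simp: B_def)
      finally show ?thesis by simp
    next
      case False
      \<comment> \<open>The hypothesis is used at the lower end \<open>q\<close> of the gap and carried up to \<open>t\<close>.\<close>
      have "(\<Sum>j\<in>S. a j - q) \<le> (\<Sum>j\<in>J - {i0}. max 0 (a j - q))"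
      proof -
        have "(\<Sum>j\<in>S. a j - q) \<le> (\<Sum>j\<in>S. max 0 (a j - q))" by (intro sum_mono) simp
        also have "\<dots> \<le> (\<Sum>j\<in>J - {i0}. max 0 (a j - q))"
          using fin by (intro sum_mono2) (auto simp: S_def)
        finally show ?thesis .
      qed
      moreover have "(\<Sum>j\<in>J. max 0 (a j - q)) \<le> p - q + (\<Sum>x\<in>B. \<mu> x - q)"
        using le[OF pq(1)] old[of q] R_B[of q] pq by simp
      ultimately have "(\<Sum>j\<in>S. a j - q) + (\<alpha> - q) \<le> p - q + (\<Sum>x\<in>B. \<mu> x - q)"
        using J'[of q] pq by simp
      moreover have "(\<Sum>j\<in>S. a j - q) = (\<Sum>j\<in>S. a j - t) + card S * (t - q)"
        by (simp add: sum_subtractf algebra_simps)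
      moreover have "(\<Sum>x\<in>B. \<mu> x - q) = (\<Sum>x\<in>B. \<mu> x - t) + card B * (t - q)"
        by (simp add: sum_subtractf algebra_simps)
      moreover have "(card B + 1) * (t - q) \<le> card S * (t - q)"
        using False 3 by (intro mult_right_mono) auto
      ultimately show ?thesis by (simp add: \<beta>_def algebra_simps)
    qed
    then show ?thesis unfolding new J_S R_B[OF less_imp_le[OF 3(1)] 3(2)] by simp
  qed
qed

text \<open>
  The constructive half of the Schur-Horn theorem.  The column of a largest norm \<open>\<alpha>\<close> is placed in the
  plane of two coordinates \<open>P\<close>, \<open>Q\<close> whose \<open>\<mu>\<close>-values are adjacent and enclose \<open>\<alpha>\<close>.  What remains of \<open>diag(\<mu> P, \<mu> Q)\<close>
  has rank one, so after a rotation in that plane the problem is the same with \<open>\<alpha>\<close> removed, \<open>\<mu> P\<close>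
  replaced by \<open>\<mu> P + \<mu> Q - \<alpha>\<close> and \<open>\<mu> Q\<close> by \<open>0\<close>.  The index \<open>z\<close> with \<open>\<mu> z = 0\<close> guarantees a value below \<open>\<alpha>\<close>.
\<close>

lemma prescribed_rows_and_columns:
  fixes a :: "'i \<Rightarrow> real" and \<mu> :: "nat \<Rightarrow> real"
  assumes "finite J" "finite I" "\<And>j. j \<in> J \<Longrightarrow> 0 < a j" "\<And>x. x \<in> I \<Longrightarrow> 0 \<le> \<mu> x"
    and "z \<in> I" "\<mu> z = 0" "(\<Sum>j\<in>J. a j) = (\<Sum>x\<in>I. \<mu> x)"
    and "\<And>t. 0 \<le> t \<Longrightarrow> (\<Sum>j\<in>J. max 0 (a j - t)) \<le> (\<Sum>x\<in>I. max 0 (\<mu> x - t))"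
  shows "\<exists>T. (\<forall>x\<in>I. \<forall>y\<in>I. (\<Sum>j\<in>J. T x j * T y j) = (if x = y then \<mu> x else 0)) \<and>
    (\<forall>j\<in>J. (\<Sum>x\<in>I. (T x j)\<^sup>2) = a j)"
  using assms
proof (induction "card J" arbitrary: J \<mu> z)
  case 0
  then have "J = {}" by simp
  then have "\<forall>x\<in>I. \<mu> x = 0" using 0 by (subst sum_nonneg_eq_0_iff[symmetric]) auto
  then show ?case using \<open>J = {}\<close> by simp
next
  case (Suc n)
  note fin = Suc.prems(1,2) and apos = Suc.prems(3) and \<mu>nn = Suc.prems(4) and z = Suc.prems(5,6)
    and tot = Suc.prems(7) and le = Suc.prems(8)
  have "J \<noteq> {}" using Suc.hyps(2) by auto
  then obtain i0 where i0: "i0 \<in> J" "\<And>j. j \<in> J \<Longrightarrow> a j \<le> a i0"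
    using obtain_maximal[OF fin(1)] by metis
  define \<alpha> where "\<alpha> = a i0"
  have "{x \<in> I. \<alpha> \<le> \<mu> x} \<noteq> {}"
  proof
    assume em: "{x \<in> I. \<alpha> \<le> \<mu> x} = {}"
    obtain y where y: "y \<in> I" "\<And>x. x \<in> I \<Longrightarrow> \<mu> x \<le> \<mu> y"
      using obtain_maximal[OF fin(2)] z by (metis empty_iff)
    have "\<mu> y < \<alpha>" using em y by fastforce
    then have "0 < max 0 (a i0 - \<mu> y)" by (simp add: \<alpha>_def)
    also have "\<dots> \<le> (\<Sum>j\<in>J. max 0 (a j - \<mu> y))" using fin i0 by (intro member_le_sum) auto
    also have "\<dots> \<le> (\<Sum>x\<in>I. max 0 (\<mu> x - \<mu> y))" by (rule le) (rule \<mu>nn[OF y(1)])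
    also have "\<dots> = 0" using y by (intro sum.neutral) auto
    finally show False by simp
  qed
  then obtain P where P: "P \<in> {x \<in> I. \<alpha> \<le> \<mu> x}" "\<And>x. x \<in> {x \<in> I. \<alpha> \<le> \<mu> x} \<Longrightarrow> \<mu> P \<le> \<mu> x"
    using obtain_minimal[of "{x \<in> I. \<alpha> \<le> \<mu> x}" \<mu>] fin(2) by auto
  have "z \<in> {x \<in> I. \<mu> x < \<alpha>}" using z apos[OF i0(1)] by (simp add: \<alpha>_def)
  then have "{x \<in> I. \<mu> x < \<alpha>} \<noteq> {}" by blast
  then obtain Q where Q: "Q \<in> {x \<in> I. \<mu> x < \<alpha>}" "\<And>x. x \<in> {x \<in> I. \<mu> x < \<alpha>} \<Longrightarrow> \<mu> x \<le> \<mu> Q"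
    using obtain_maximal[of "{x \<in> I. \<mu> x < \<alpha>}" \<mu>] fin(2) by auto
  have PQ: "P \<in> I" "Q \<in> I" "\<alpha> \<le> \<mu> P" "\<mu> Q < \<alpha>" "0 \<le> \<mu> Q" using P Q \<mu>nn by auto
  have ne: "P \<noteq> Q" using PQ by auto
  have gap: "\<mu> P \<le> \<mu> x \<or> \<mu> x \<le> \<mu> Q" if "x \<in> I" for x
    using P(2)[of x] Q(2)[of x] that by fastforce
  define \<beta> where "\<beta> = \<mu> P + \<mu> Q - \<alpha>"
  define \<mu>' where "\<mu>' = \<mu>(P := \<beta>, Q := 0)"
  define J' where "J' = J - {i0}"
  define R where "R = I - {P, Q}"
  have finR: "finite R" using fin by (simp add: R_def)
  have split: "(\<Sum>x\<in>I. F x) = F P + F Q + (\<Sum>x\<in>R. F x)" for F :: "nat \<Rightarrow> real"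
    unfolding R_def by (rule sum_split_two[OF fin(2) PQ(1,2) ne])
  have splitJ: "(\<Sum>j\<in>J. F j) = F i0 + (\<Sum>j\<in>J'. F j)" for F :: "'i \<Rightarrow> real"
    unfolding J'_def by (rule sum.remove[OF fin(1) i0(1)])
  have \<mu>'R: "(\<Sum>x\<in>R. \<mu>' x) = (\<Sum>x\<in>R. \<mu> x)" by (intro sum.cong) (auto simp: R_def \<mu>'_def)
  have "\<exists>T. (\<forall>x\<in>I. \<forall>y\<in>I. (\<Sum>j\<in>J'. T x j * T y j) = (if x = y then \<mu>' x else 0)) \<and>
      (\<forall>j\<in>J'. (\<Sum>x\<in>I. (T x j)\<^sup>2) = a j)"
  proof (rule Suc.hyps(1))
    show "n = card J'" using Suc.hyps(2) fin i0 by (simp add: J'_def)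
    show "\<mu>' Q = 0" by (simp add: \<mu>'_def)
    show "0 \<le> \<mu>' x" if "x \<in> I" for x using \<mu>nn[OF that] PQ by (auto simp: \<mu>'_def \<beta>_def)
    show "(\<Sum>j\<in>J'. a j) = (\<Sum>x\<in>I. \<mu>' x)"
      using tot ne unfolding split splitJ \<mu>'R by (simp add: \<mu>'_def \<beta>_def \<alpha>_def)
    show "(\<Sum>j\<in>J'. max 0 (a j - t)) \<le> (\<Sum>x\<in>I. max 0 (\<mu>' x - t))" if "0 \<le> t" for t
      unfolding J'_def \<mu>'_def \<beta>_def \<alpha>_def
      by (rule excess_after_splitting) (use fin i0 PQ gap le that in \<open>auto simp: \<alpha>_def\<close>)
  qed (use fin apos PQ in \<open>auto simp: J'_def\<close>)
  then obtain T where T: "\<And>x y. x \<in> I \<Longrightarrow> y \<in> I \<Longrightarrow> (\<Sum>j\<in>J'. T x j * T y j) = (if x = y then \<mu>' x else 0)"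
    and Tc: "\<And>j. j \<in> J' \<Longrightarrow> (\<Sum>x\<in>I. (T x j)\<^sup>2) = a j" by blast
  have TQ: "T Q j = 0" if "j \<in> J'" for j
  proof -
    have "(\<Sum>j\<in>J'. T Q j * T Q j) = 0" using T[of Q Q] PQ by (simp add: \<mu>'_def)
    then show ?thesis using that fin by (subst (asm) sum_nonneg_eq_0_iff) (auto simp: J'_def)
  qed
  obtain x0 y0 c s where v: "x0\<^sup>2 + y0\<^sup>2 = \<alpha>" "c\<^sup>2 + s\<^sup>2 = 1" "x0\<^sup>2 + c\<^sup>2 * \<beta> = \<mu> P"
      "y0\<^sup>2 + s\<^sup>2 * \<beta> = \<mu> Q" "x0 * y0 + c * s * \<beta> = 0"
    using rank_one_splitting_of_two_eigenvalues[OF PQ(5,4,3) \<beta>_def] by metis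
  define U where "U x j = (if j = i0 then (if x = P then x0 else if x = Q then y0 else 0)
    else if x = P then c * T P j else if x = Q then s * T P j else T x j)" for x j
  have U_J': "(\<Sum>j\<in>J'. U x j * U y j) = (\<Sum>j\<in>J'.
      (if x = P then c * T P j else if x = Q then s * T P j else T x j) *
      (if y = P then c * T P j else if y = Q then s * T P j else T y j))" for x y
    by (intro sum.cong) (auto simp: U_def J'_def)
  have sc: "(\<Sum>j\<in>J'. (e * f j) * (e' * g j)) = e * e' * (\<Sum>j\<in>J'. f j * g j)"
    "(\<Sum>j\<in>J'. (e * f j) * g j) = e * (\<Sum>j\<in>J'. f j * g j)"
    "(\<Sum>j\<in>J'. e * (f j * g j)) = e * (\<Sum>j\<in>J'. f j * g j)"
    "(\<Sum>j\<in>J'. f j * (e * g j)) = e * (\<Sum>j\<in>J'. f j * g j)" for e e' :: real and f g :: "'i \<Rightarrow> real"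
    by (simp_all add: sum_distrib_left mult.assoc mult.left_commute)
  have TPP: "(\<Sum>j\<in>J'. T P j * T P j) = \<beta>" using T[of P P] PQ ne by (simp add: \<mu>'_def)
  have rows: "(\<Sum>j\<in>J. U x j * U y j) = (if x = y then \<mu> x else 0)" if xy: "x \<in> I" "y \<in> I" for x y
  proof -
    consider "x = P" "y = P" | "x = P" "y = Q" | "x = Q" "y = P" | "x = Q" "y = Q"
      | "x \<in> {P, Q}" "y \<notin> {P, Q}" | "x \<notin> {P, Q}" "y \<in> {P, Q}" | "x \<notin> {P, Q}" "y \<notin> {P, Q}" by blast
    then show ?thesis
    proof cases
      case 5
      then have "(\<Sum>j\<in>J'. T P j * T y j) = 0" using T[of P y] PQ xy by auto
      then show ?thesis using 5 unfolding splitJ U_J' by (auto simp: U_def sc ne ne[symmetric])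
    next
      case 6
      then have "(\<Sum>j\<in>J'. T x j * T P j) = 0" using T[of x P] PQ xy by auto
      then show ?thesis using 6 unfolding splitJ U_J' by (auto simp: U_def sc ne ne[symmetric])
    next
      case 7
      then show ?thesis using T[OF xy] unfolding splitJ U_J' by (auto simp: U_def \<mu>'_def ne)
    qed (use v TPP in \<open>unfold splitJ U_J', auto simp: U_def sc ne ne[symmetric] power2_eq_square algebra_simps\<close>)
  qed
  have cols: "(\<Sum>x\<in>I. (U x j)\<^sup>2) = a j" if "j \<in> J" for j
  proof (cases "j = i0")
    case True
    have "(\<Sum>x\<in>R. (U x j)\<^sup>2) = 0" using True by (intro sum.neutral) (auto simp: U_def R_def)
    then show ?thesis using v ne True unfolding split by (simp add: U_def \<alpha>_def)
  next
    case False
    then have j: "j \<in> J'" using that by (simp add: J'_def)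
    have "(\<Sum>x\<in>R. (U x j)\<^sup>2) = (\<Sum>x\<in>R. (T x j)\<^sup>2)"
      using False by (intro sum.cong) (auto simp: U_def R_def)
    moreover have "(U P j)\<^sup>2 + (U Q j)\<^sup>2 = (c\<^sup>2 + s\<^sup>2) * (T P j)\<^sup>2"
      using False ne by (simp add: U_def power_mult_distrib algebra_simps)
    ultimately show ?thesis using Tc[OF j] TQ[OF j] v(2) unfolding split by simp
  qed
  show ?case using rows cols by (intro exI[of _ U]) blast
qed

section \<open>Unitary diagonalization of Hermitian matrices\<close>

lemma dim_mat_adjoint [simp]:
  "dim_row (mat_adjoint A) = dim_col A" "dim_col (mat_adjoint A) = dim_row A"
  unfolding mat_adjoint_def by auto

lemma mat_adjoint_carrier: "A \<in> carrier_mat n m \<Longrightarrow> mat_adjoint A \<in> carrier_mat m n"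
  by (intro carrier_matI) auto

lemma conjugation_carrier:
  "U \<in> carrier_mat n n \<Longrightarrow> X \<in> carrier_mat n n \<Longrightarrow> U * X * mat_adjoint U \<in> carrier_mat n n"
  by (intro mult_carrier_mat mat_adjoint_carrier)

lemma mat_adjoint_index:
  fixes A :: "complex mat"
  assumes "A \<in> carrier_mat n m" "i < m" "j < n"
  shows "mat_adjoint A $$ (i, j) = cnj (A $$ (j, i))"
  using assms unfolding mat_adjoint_def by (auto simp: mat_of_rows_index)

lemma mult_index:
  assumes "A \<in> carrier_mat n m" "B \<in> carrier_mat m k" "i < n" "j < k"
  shows "(A * B) $$ (i, j) = (\<Sum>l<m. A $$ (i, l) * B $$ (l, j))"
  using assms by (auto simp: scalar_prod_def atLeast0LessThan)

lemma mat_adjoint_mult: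
  fixes A B :: "complex mat"
  assumes A: "A \<in> carrier_mat n m" and B: "B \<in> carrier_mat m k"
  shows "mat_adjoint (A * B) = mat_adjoint B * mat_adjoint A"
proof (rule eq_matI)
  have AB: "A * B \<in> carrier_mat n k" using A B by simp
  fix i j assume "i < dim_row (mat_adjoint B * mat_adjoint A)" "j < dim_col (mat_adjoint B * mat_adjoint A)"
  then have ij: "i < k" "j < n" using A B by auto
  have "mat_adjoint (A * B) $$ (i, j) = (\<Sum>l<m. cnj (A $$ (j, l)) * cnj (B $$ (l, i)))"
    using mat_adjoint_index[OF AB ij] mult_index[OF A B ij(2,1)] by simp
  also have "\<dots> = (\<Sum>l<m. mat_adjoint B $$ (i, l) * mat_adjoint A $$ (l, j))"
    using ij by (intro sum.cong) (auto simp: mat_adjoint_index[OF A] mat_adjoint_index[OF B])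
  also have "\<dots> = (mat_adjoint B * mat_adjoint A) $$ (i, j)"
    using mult_index[OF mat_adjoint_carrier[OF B] mat_adjoint_carrier[OF A] ij] by simp
  finally show "mat_adjoint (A * B) $$ (i, j) = (mat_adjoint B * mat_adjoint A) $$ (i, j)" .
qed (use assms in auto)

lemma mat_adjoint_adjoint:
  fixes A :: "complex mat"
  assumes A: "A \<in> carrier_mat n m"
  shows "mat_adjoint (mat_adjoint A) = A"
  by (rule eq_matI)
    (use A in \<open>auto simp: mat_adjoint_index[OF A] mat_adjoint_index[OF mat_adjoint_carrier[OF A]]\<close>)

definition unitary_mat :: "nat \<Rightarrow> complex mat \<Rightarrow> bool" where
  "unitary_mat n U \<longleftrightarrow> U \<in> carrier_mat n n \<and> mat_adjoint U * U = 1\<^sub>m n"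

lemma unitary_matD:
  assumes "unitary_mat n U"
  shows "U \<in> carrier_mat n n" "mat_adjoint U \<in> carrier_mat n n"
    "mat_adjoint U * U = 1\<^sub>m n" "U * mat_adjoint U = 1\<^sub>m n"
proof -
  show *: "U \<in> carrier_mat n n" "mat_adjoint U * U = 1\<^sub>m n"
    using assms by (auto simp: unitary_mat_def)
  then show "mat_adjoint U \<in> carrier_mat n n" by (simp add: mat_adjoint_carrier)
  then show "U * mat_adjoint U = 1\<^sub>m n" using mat_mult_left_right_inverse * by blast
qed

lemma unitary_mat_cancel:
  assumes U: "unitary_mat n U" and X: "X \<in> carrier_mat n n"
  shows "mat_adjoint U * (U * X) = X" "U * (mat_adjoint U * X) = X"
proof -
  note u = unitary_matD[OF U]
  show "mat_adjoint U * (U * X) = X"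
    using assoc_mult_mat[OF u(2,1) X] u(3) X by simp
  show "U * (mat_adjoint U * X) = X"
    using assoc_mult_mat[OF u(1,2) X] u(4) X by simp
qed

lemma unitary_mat_mult:
  assumes U: "unitary_mat n U" and V: "unitary_mat n V"
  shows "unitary_mat n (U * V)"
proof -
  note u = unitary_matD[OF U] and v = unitary_matD[OF V]
  show ?thesis
    using u(1) v(1,3) assoc_mult_mat[OF v(2) u(2) mult_carrier_mat[OF u(1) v(1)]]
    by (simp add: unitary_mat_def mat_adjoint_mult[OF u(1) v(1)] unitary_mat_cancel(1)[OF U v(1)])
qed

lemma diagonalization_index:
  assumes U: "U \<in> carrier_mat n n" and ij: "i < n" "j < n"
  shows "(U * mat_diag n d * mat_adjoint U) $$ (i, j) = (\<Sum>l<n. d l * U $$ (i, l) * cnj (U $$ (j, l)))"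
proof -
  have UD: "U * mat_diag n d \<in> carrier_mat n n" using U by simp
  show ?thesis
    unfolding mult_index[OF UD mat_adjoint_carrier[OF U] ij]
    using U ij by (intro sum.cong) (auto simp: mat_adjoint_index[OF U] mat_diag_mult_right[OF U])
qed

text \<open>
  Complete an eigenvector to a basis, orthogonalise it by the Gram-Schmidt process, which keeps the
  first vector, and normalise the result.
\<close>

lemma unitary_mat_with_eigenvector:
  assumes A: "A \<in> carrier_mat n n" and n: "0 < n"
  obtains W k where "unitary_mat n W" "\<And>i. i < n \<Longrightarrow> (mat_adjoint W * (A * W)) $$ (i, 0) = (if i = 0 then k else 0)"
proof -
  have "degree (char_poly A) = n" using degree_monic_char_poly[OF A] by simp
  then have "\<not> constant (poly (char_poly A))" using n by (simp add: constant_degree)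
  then obtain k where "poly (char_poly A) k = 0" using fundamental_theorem_of_algebra by blast
  then obtain v where ev: "eigenvector A v k"
    using eigenvalue_root_char_poly[OF A] by (auto simp: eigenvalue_def)
  then have v: "v \<in> carrier_vec n" and v0: "v \<noteq> 0\<^sub>v n" and Av: "A *\<^sub>v v = k \<cdot>\<^sub>v v"
    using A by (auto simp: eigenvector_def)
  interpret cof_vec_space n "TYPE(complex)" .
  define b where "b = basis_completion v"
  define ws where "ws = gram_schmidt n b"
  from basis_completion[OF v v0, folded b_def]
  have dist_b: "distinct b" and indep: "\<not> lin_dep (set b)" and b: "set b \<subseteq> carrier_vec n"
    and hdb: "hd b = v" and len_b: "length b = n" by auto
  from hdb len_b n obtain vs where bv: "b = v # vs" by (cases b) auto
  from gram_schmidt_result[OF b dist_b indep refl, folded ws_def]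
  have ws: "set ws \<subseteq> carrier_vec n" "corthogonal ws" "length ws = n" by (auto simp: len_b)
  from gram_schmidt_hd[OF v, of vs, folded bv] have "hd ws = v" unfolding ws_def .
  then have ws0: "ws ! 0 = v" using ws(3) n by (metis hd_conv_nth length_0_conv less_numeral_extra(3))
  have wsc: "ws ! j \<in> carrier_vec n" if "j < n" for j using ws that by auto
  define r where "r j = (\<Sum>i<n. (cmod (ws ! j $ i))\<^sup>2)" for j
  define s where "s j = complex_of_real (sqrt (r j))" for j
  have inner: "ws ! j \<bullet>c ws ! i = (\<Sum>l<n. ws ! j $ l * cnj (ws ! i $ l))" if "i < n" "j < n" for i j
    using wsc[OF that(1)] wsc[OF that(2)] by (auto simp: scalar_prod_def atLeast0LessThan)
  have orth: "(\<Sum>l<n. cnj (ws ! i $ l) * ws ! j $ l) = 0" if "i < n" "j < n" "i \<noteq> j" for i j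
    using corthogonalD[OF ws(2), of j i] inner[of i j] that ws(3) by (simp add: mult.commute)
  have self: "(\<Sum>l<n. cnj (ws ! j $ l) * ws ! j $ l) = complex_of_real (r j)" for j
    unfolding r_def of_real_sum
    by (intro sum.cong refl) (metis complex_norm_square mult.commute)
  have r: "0 < r j" if "j < n" for j
  proof -
    have "complex_of_real (r j) \<noteq> 0"
      using corthogonalD[OF ws(2), of j j] inner[of j j] that ws(3) self[of j] by (simp add: mult.commute)
    moreover have "0 \<le> r j" unfolding r_def by (intro sum_nonneg) auto
    ultimately show ?thesis by simp
  qed
  have ss: "s j * s j = complex_of_real (r j)" "s j \<noteq> 0" "cnj (s j) = s j" if "j < n" for j
    using r[OF that] by (auto simp: s_def of_real_mult[symmetric] simp del: of_real_mult)
  define W where "W = mat n n (\<lambda>(i, j). ws ! j $ i / s j)"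
  have W: "W \<in> carrier_mat n n" by (simp add: W_def)
  have W_idx: "W $$ (i, j) = ws ! j $ i / s j" if "i < n" "j < n" for i j using that by (simp add: W_def)
  have WW: "mat_adjoint W * W = 1\<^sub>m n"
  proof (rule eq_matI)
    fix i j assume "i < dim_row (1\<^sub>m n :: complex mat)" "j < dim_col (1\<^sub>m n :: complex mat)"
    then have ij: "i < n" "j < n" by auto
    have "(mat_adjoint W * W) $$ (i, j) = (\<Sum>l<n. mat_adjoint W $$ (i, l) * W $$ (l, j))"
      by (rule mult_index[OF mat_adjoint_carrier[OF W] W ij])
    also have "\<dots> = (\<Sum>l<n. cnj (ws ! i $ l) * ws ! j $ l / (s i * s j))"
      using ij ss(3)[OF ij(1)] by (intro sum.cong) (auto simp: mat_adjoint_index[OF W] W_idx)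
    also have "\<dots> = (\<Sum>l<n. cnj (ws ! i $ l) * ws ! j $ l) / (s i * s j)"
      by (simp add: sum_divide_distrib)
    also have "\<dots> = (if i = j then 1 else 0)"
      using orth[OF ij] self[of i] ss[OF ij(1)] r[OF ij(1)] by auto
    finally show "(mat_adjoint W * W) $$ (i, j) = 1\<^sub>m n $$ (i, j)" using ij by simp
  qed (use W in auto)
  have AW: "(A * W) $$ (i, 0) = k * W $$ (i, 0)" if i: "i < n" for i
  proof -
    have "(A * W) $$ (i, 0) = (\<Sum>l<n. A $$ (i, l) * W $$ (l, 0))" by (rule mult_index[OF A W i n])
    also have "\<dots> = (\<Sum>l<n. A $$ (i, l) * v $ l) / s 0"
      using n by (simp add: W_def ws0 sum_divide_distrib)
    also have "(\<Sum>l<n. A $$ (i, l) * v $ l) = (A *\<^sub>v v) $ i"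
      using A v i by (auto simp: scalar_prod_def atLeast0LessThan)
    also have "\<dots> = k * v $ i" using Av v i by simp
    finally show ?thesis using i n by (simp add: W_def ws0)
  qed
  have AWc: "A * W \<in> carrier_mat n n" using A W by simp
  have "(mat_adjoint W * (A * W)) $$ (i, 0) = (if i = 0 then k else 0)" if i: "i < n" for i
  proof -
    have "(mat_adjoint W * (A * W)) $$ (i, 0) = (\<Sum>l<n. mat_adjoint W $$ (i, l) * (A * W) $$ (l, 0))"
      by (rule mult_index[OF mat_adjoint_carrier[OF W] AWc i n])
    also have "\<dots> = k * (\<Sum>l<n. mat_adjoint W $$ (i, l) * W $$ (l, 0))"
      by (simp add: AW sum_distrib_left mult.left_commute)
    also have "(\<Sum>l<n. mat_adjoint W $$ (i, l) * W $$ (l, 0)) = (mat_adjoint W * W) $$ (i, 0)"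
      by (rule mult_index[OF mat_adjoint_carrier[OF W] W i n, symmetric])
    finally show ?thesis using WW i n by simp
  qed
  moreover have "unitary_mat n W" using W WW by (simp add: unitary_mat_def)
  ultimately show thesis using that by blast
qed

lemma conjugate_back:
  assumes W: "unitary_mat n W" and A: "A \<in> carrier_mat n n"
  shows "W * (mat_adjoint W * (A * W)) * mat_adjoint W = A"
proof -
  note w = unitary_matD[OF W]
  have "A * W * mat_adjoint W = A" using assoc_mult_mat[OF A w(1,2)] w(4) A by simp
  then show ?thesis by (simp add: unitary_mat_cancel(2)[OF W mult_carrier_mat[OF A w(1)]])
qed

lemma conjugate_diagonalization:
  assumes W: "unitary_mat n W" and C: "unitary_mat n C" and D: "D \<in> carrier_mat n n"
  shows "W * (C * D * mat_adjoint C) * mat_adjoint W = (W * C) * D * mat_adjoint (W * C)"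
proof -
  note w = unitary_matD(1,2)[OF W] and c = unitary_matD(1,2)[OF C]
  note carr = w c D mult_carrier_mat[of _ n n _ n]
  show ?thesis
    by (simp add: carr mat_adjoint_mult[OF w(1) c(1)] assoc_mult_mat[of _ n n _ n _ n])
qed

text \<open>
  In an orthonormal basis that starts with an eigenvector the first column of the matrix vanishes off
  the diagonal; as the matrix is Hermitian so does the first row, and the induction hypothesis
  applies to the remaining block.
\<close>

lemma hermitian_diagonalizable:
  fixes A :: "complex mat"
  assumes "A \<in> carrier_mat n n" "mat_adjoint A = A"
  shows "\<exists>U e. unitary_mat n U \<and> A = U * mat_diag n (\<lambda>i. complex_of_real (e i)) * mat_adjoint U"
  using assms
proof (induction n arbitrary: A)
  case 0
  have "unitary_mat 0 (1\<^sub>m 0)" by (auto simp: unitary_mat_def)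
  moreover have "A = 1\<^sub>m 0 * mat_diag 0 (\<lambda>i. complex_of_real 0) * mat_adjoint (1\<^sub>m 0)"
    using 0 by (intro eq_matI) auto
  ultimately show ?case by (intro exI[of _ "1\<^sub>m 0"] exI[of _ "\<lambda>_. 0"] conjI)
next
  case (Suc n)
  let ?N = "Suc n"
  note A = Suc.prems(1) and herm = Suc.prems(2)
  obtain W k where W: "unitary_mat ?N W"
    and col: "\<And>i. i < ?N \<Longrightarrow> (mat_adjoint W * (A * W)) $$ (i, 0) = (if i = 0 then k else 0)"
    using unitary_mat_with_eigenvector[OF A] by auto
  note w = unitary_matD[OF W]
  define B where "B = mat_adjoint W * (A * W)"
  have B: "B \<in> carrier_mat ?N ?N" using w A by (simp add: B_def)
  have AW: "A * W \<in> carrier_mat ?N ?N" using w A by simp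
  have "mat_adjoint B = mat_adjoint (A * W) * mat_adjoint (mat_adjoint W)"
    unfolding B_def by (rule mat_adjoint_mult[OF w(2) AW])
  also have "\<dots> = mat_adjoint W * A * W"
    by (simp add: mat_adjoint_mult[OF A w(1)] herm mat_adjoint_adjoint[OF w(1)])
  also have "\<dots> = B" unfolding B_def using w A by (intro assoc_mult_mat[of _ "Suc n" "Suc n" _ "Suc n" _ "Suc n"]) auto
  finally have Bh: "mat_adjoint B = B" .
  have sym: "B $$ (i, j) = cnj (B $$ (j, i))" if "i < ?N" "j < ?N" for i j
    using mat_adjoint_index[OF B that] by (simp add: Bh)
  have B0: "B $$ (i, 0) = (if i = 0 then k else 0)" if "i < ?N" for i
    using col[OF that] by (simp add: B_def)
  have B0': "B $$ (0, i) = (if i = 0 then k else 0)" if "i < ?N" for i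
    using sym[of 0 i] B0[OF that] sym[of 0 0] B0[of 0] that by (auto split: if_splits)
  have kr: "complex_of_real (Re k) = k"
    using sym[of 0 0] B0[of 0] by (metis Reals_cnj_iff complex_is_Real_iff of_real_Re zero_less_Suc)
  define A' where "A' = mat n n (\<lambda>(i, j). B $$ (Suc i, Suc j))"
  have A': "A' \<in> carrier_mat n n" by (simp add: A'_def)
  have "mat_adjoint A' = A'"
  proof (rule eq_matI)
    fix i j assume "i < dim_row A'" "j < dim_col A'"
    then have ij: "i < n" "j < n" by (auto simp: A'_def)
    then show "mat_adjoint A' $$ (i, j) = A' $$ (i, j)"
      using sym[of "Suc i" "Suc j"] by (simp add: mat_adjoint_index[OF A']) (simp add: A'_def)
  qed (use A' in auto)
  then obtain U' e' where U': "unitary_mat n U'"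
    and A'e: "A' = U' * mat_diag n (\<lambda>i. complex_of_real (e' i)) * mat_adjoint U'"
    using Suc.IH[OF A'] by blast
  note u = unitary_matD[OF U']
  define C where "C = mat ?N ?N (\<lambda>(i, j). case i of 0 \<Rightarrow> (case j of 0 \<Rightarrow> 1 | Suc _ \<Rightarrow> 0)
      | Suc i' \<Rightarrow> (case j of 0 \<Rightarrow> 0 | Suc j' \<Rightarrow> U' $$ (i', j')))"
  have C: "C \<in> carrier_mat ?N ?N" by (simp add: C_def)
  have C00: "C $$ (0, 0) = 1" and C0S: "\<And>j. j < n \<Longrightarrow> C $$ (0, Suc j) = 0"
    and CS0: "\<And>i. i < n \<Longrightarrow> C $$ (Suc i, 0) = 0"
    and CSS: "\<And>i j. i < n \<Longrightarrow> j < n \<Longrightarrow> C $$ (Suc i, Suc j) = U' $$ (i, j)"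
    by (auto simp: C_def)
  note Cs = C00 C0S CS0 CSS
  have UU: "(\<Sum>l<n. cnj (U' $$ (l, i)) * U' $$ (l, j)) = (if i = j then 1 else 0)" if "i < n" "j < n" for i j
  proof -
    have "(mat_adjoint U' * U') $$ (i, j) = (\<Sum>l<n. mat_adjoint U' $$ (i, l) * U' $$ (l, j))"
      by (rule mult_index[OF u(2,1) that])
    also have "\<dots> = (\<Sum>l<n. cnj (U' $$ (l, i)) * U' $$ (l, j))"
      using that by (intro sum.cong) (auto simp: mat_adjoint_index[OF u(1)])
    finally show ?thesis using u(3) that by simp
  qed
  have "mat_adjoint C * C = 1\<^sub>m ?N"
  proof (rule eq_matI)
    fix i j assume "i < dim_row (1\<^sub>m ?N :: complex mat)" "j < dim_col (1\<^sub>m ?N :: complex mat)"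
    then have ij: "i < ?N" "j < ?N" by auto
    have "(mat_adjoint C * C) $$ (i, j) = (\<Sum>l<?N. mat_adjoint C $$ (i, l) * C $$ (l, j))"
      by (rule mult_index[OF mat_adjoint_carrier[OF C] C ij])
    also have "\<dots> = (\<Sum>l<?N. cnj (C $$ (l, i)) * C $$ (l, j))"
      using ij by (intro sum.cong) (auto simp: mat_adjoint_index[OF C])
    also have "\<dots> = cnj (C $$ (0, i)) * C $$ (0, j) + (\<Sum>l<n. cnj (C $$ (Suc l, i)) * C $$ (Suc l, j))"
      by (rule sum.lessThan_Suc_shift)
    also have "\<dots> = (if i = j then 1 else 0)"
      using ij by (cases i; cases j) (auto simp: Cs UU)
    finally show "(mat_adjoint C * C) $$ (i, j) = 1\<^sub>m ?N $$ (i, j)" using ij by simp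
  qed (use C in auto)
  then have Cu: "unitary_mat ?N C" using C by (simp add: unitary_mat_def)
  define e where "e = case_nat (Re k) e'"
  let ?D = "mat_diag ?N (\<lambda>i. complex_of_real (e i))"
  have "B = C * ?D * mat_adjoint C"
  proof (rule eq_matI)
    fix i j assume "i < dim_row (C * ?D * mat_adjoint C)" "j < dim_col (C * ?D * mat_adjoint C)"
    then have ij: "i < ?N" "j < ?N" using C by auto
    have eq: "(C * ?D * mat_adjoint C) $$ (i, j) = e 0 * C $$ (i, 0) * cnj (C $$ (j, 0)) +
        (\<Sum>l<n. e (Suc l) * C $$ (i, Suc l) * cnj (C $$ (j, Suc l)))"
      unfolding diagonalization_index[OF C ij] by (rule sum.lessThan_Suc_shift)
    have A'_idx: "(\<Sum>l<n. complex_of_real (e' l) * U' $$ (a, l) * cnj (U' $$ (b, l))) = B $$ (Suc a, Suc b)"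
      if "a < n" "b < n" for a b
    proof -
      have "A' $$ (a, b) = (\<Sum>l<n. complex_of_real (e' l) * U' $$ (a, l) * cnj (U' $$ (b, l)))"
        unfolding A'e by (rule diagonalization_index[OF u(1) that])
      then show ?thesis using that by (simp add: A'_def)
    qed
    show "B $$ (i, j) = (C * ?D * mat_adjoint C) $$ (i, j)"
      unfolding eq using ij by (cases i; cases j) (auto simp: Cs e_def kr B0 B0' A'_idx)
  qed (use C B in auto)
  then have "A = W * (C * ?D * mat_adjoint C) * mat_adjoint W"
    using conjugate_back[OF W A] by (simp add: B_def)
  also have "\<dots> = (W * C) * ?D * mat_adjoint (W * C)"
    by (rule conjugate_diagonalization[OF W Cu]) simp
  finally show ?case using unitary_mat_mult[OF W Cu] by blast
qed

lemma unitary_diagonalization_spec_inc: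
  assumes U: "unitary_mat n U" and S: "S = U * mat_diag n (\<lambda>i. complex_of_real (e i)) * mat_adjoint U"
  shows "spec_inc S = sort (map e [0..<n])"
proof -
  note u = unitary_matD[OF U]
  let ?D = "mat_diag n (\<lambda>i. complex_of_real (e i))"
  have Sc: "S \<in> carrier_mat n n" unfolding S by (rule conjugation_carrier) (use u in simp_all)
  have "similar_mat S ?D"
    by (rule similar_matI[of _ _ U "mat_adjoint U"]) (use u Sc S in auto)
  then have "char_poly S = char_poly ?D" by (rule char_poly_similar)
  also have "\<dots> = (\<Prod>a\<leftarrow>diag_mat ?D. [:- a, 1:])"
    by (rule char_poly_upper_triangular[of _ n]) (auto simp: mat_diag_def)
  also have "diag_mat ?D = map (\<lambda>i. complex_of_real (e i)) [0..<n]"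
    by (auto simp: diag_mat_def mat_diag_def intro: map_cong)
  finally have cp: "char_poly S = (\<Prod>a\<leftarrow>map (\<lambda>i. complex_of_real (e i)) [0..<n]. [:- a, 1:])" .
  have pr: "proots (\<Prod>a\<leftarrow>as. [:- a, 1:]) = mset as" for as :: "complex list"
  proof (induction as)
    case (Cons a as)
    have "(\<Prod>a\<leftarrow>as. [:- a, 1:]) \<noteq> 0" by (auto simp: prod_list_zero_iff)
    then show ?case using Cons by (simp add: proots_mult del: mult_pCons_left)
  qed simp
  have "image_mset Re (proots (char_poly S)) = mset (map e [0..<n])"
    unfolding cp pr mset_map by (simp add: multiset.map_comp o_def)
  then show ?thesis by (simp only: spec_inc_def sorted_list_of_multiset_mset)
qed

text \<open>
  For a second diagonalization \<open>S = V diag(g) V\<^sup>*\<close> the matrix \<open>W = V\<^sup>* U\<close> satisfies \<open>g\<^sub>i W\<^sub>i\<^sub>j = W\<^sub>i\<^sub>j e\<^sub>j\<close>, hence also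
  \<open>f(g\<^sub>i) W\<^sub>i\<^sub>j = W\<^sub>i\<^sub>j f(e\<^sub>j)\<close>.  This is the uniqueness behind the definite description in \<^const>\<open>mat_fun\<close>.
\<close>

lemma unitary_diagonalization_mat_fun:
  assumes U: "unitary_mat n U" and S: "S = U * mat_diag n (\<lambda>i. complex_of_real (e i)) * mat_adjoint U"
  shows "mat_fun f S = U * mat_diag n (\<lambda>i. complex_of_real (f (e i))) * mat_adjoint U"
proof -
  note u = unitary_matD[OF U]
  have Sc: "S \<in> carrier_mat n n" unfolding S by (rule conjugation_carrier) (use u in simp_all)
  then have dim: "dim_row S = n" by simp
  let ?D = "\<lambda>d. mat_diag n (\<lambda>i. complex_of_real (d i))"
  show ?thesis
    unfolding mat_fun_def Let_def dim
  proof (rule the_equality)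
    show "\<exists>V g. V \<in> carrier_mat n n \<and> mat_adjoint V * V = 1\<^sub>m n \<and> S = V * ?D g * mat_adjoint V \<and>
        U * ?D (\<lambda>i. f (e i)) * mat_adjoint U = V * ?D (\<lambda>i. f (g i)) * mat_adjoint V"
      using u S by (intro exI[of _ U] exI[of _ e]) simp
    fix T
    assume "\<exists>V g. V \<in> carrier_mat n n \<and> mat_adjoint V * V = 1\<^sub>m n \<and> S = V * ?D g * mat_adjoint V \<and>
        T = V * ?D (\<lambda>i. f (g i)) * mat_adjoint V"
    then obtain V g where V: "unitary_mat n V" and SV: "S = V * ?D g * mat_adjoint V"
      and T: "T = V * ?D (\<lambda>i. f (g i)) * mat_adjoint V" unfolding unitary_mat_def by blast
    note v = unitary_matD[OF V]
    define W where "W = mat_adjoint V * U"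
    have W: "W \<in> carrier_mat n n" using u v by (simp add: W_def)
    have D: "?D d \<in> carrier_mat n n" for d by simp
    note nest = assoc_mult_mat[of _ n n _ n _ n] mult_carrier_mat[of _ n n _ n] u(1,2) v(1,2)
    have left: "mat_adjoint V * (V * X * mat_adjoint V) * U = X * W" if X: "X \<in> carrier_mat n n" for X
      by (simp add: W_def nest X unitary_mat_cancel[OF V])
    have right: "mat_adjoint V * (U * X * mat_adjoint U) * U = W * X" if X: "X \<in> carrier_mat n n" for X
      using u(3) X by (simp add: W_def nest)
    have "?D g * W = W * ?D e" using left[OF D[of g]] right[OF D[of e]] S SV by simp
    then have ent: "complex_of_real (g i) * W $$ (i, j) = W $$ (i, j) * complex_of_real (e j)"
      if "i < n" "j < n" for i j
      using that unfolding mat_diag_mult_left[OF W] mat_diag_mult_right[OF W]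
      by (metis (no_types, lifting) case_prod_conv index_mat(1))
    have "?D (\<lambda>i. f (g i)) * W = W * ?D (\<lambda>i. f (e i))"
      unfolding mat_diag_mult_left[OF W] mat_diag_mult_right[OF W]
    proof (rule cong_mat, goal_cases)
      case (3 i j)
      then show ?case using ent[of i j] by (cases "W $$ (i, j) = 0") auto
    qed auto
    then have eq: "mat_adjoint V * T * U = mat_adjoint V * (U * ?D (\<lambda>i. f (e i)) * mat_adjoint U) * U"
      unfolding T using left[OF D[of "\<lambda>i. f (g i)"]] right[OF D[of "\<lambda>i. f (e i)"]] by simp
    have cancel: "V * (mat_adjoint V * X * U) * mat_adjoint U = X" if X: "X \<in> carrier_mat n n" for X
      using u(4) X by (simp add: nest unitary_mat_cancel[OF V])
    have Tc: "T \<in> carrier_mat n n" unfolding T by (rule conjugation_carrier) (use v in simp_all)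
    have "U * ?D (\<lambda>i. f (e i)) * mat_adjoint U \<in> carrier_mat n n"
      by (rule conjugation_carrier) (use u in simp_all)
    from cancel[OF this] cancel[OF Tc] eq
    show "T = U * ?D (\<lambda>i. f (e i)) * mat_adjoint U" by simp
  qed
qed

lemma unitary_diagonalization_trace:
  assumes U: "unitary_mat n U"
  shows "mat_trace (U * mat_diag n d * mat_adjoint U) = (\<Sum>i<n. d i)"
proof -
  note u = unitary_matD[OF U]
  let ?X = "U * mat_diag n d * mat_adjoint U"
  have X: "?X \<in> carrier_mat n n" by (rule conjugation_carrier) (use u in simp_all)
  have "mat_trace ?X = (\<Sum>i<n. ?X $$ (i, i))"
    unfolding mat_trace_def diag_mat_def carrier_matD(1)[OF X]
    by (simp only: interv_sum_list_conv_sum_set_nat set_upt atLeast0LessThan)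
  also have "\<dots> = (\<Sum>i<n. \<Sum>l<n. d l * U $$ (i, l) * cnj (U $$ (i, l)))"
    by (intro sum.cong refl diagonalization_index[OF u(1)]) auto
  also have "\<dots> = (\<Sum>l<n. d l * (\<Sum>i<n. cnj (U $$ (i, l)) * U $$ (i, l)))"
    by (subst sum.swap) (simp add: sum_distrib_left mult.commute mult.left_commute)
  also have "\<dots> = (\<Sum>l<n. d l * (mat_adjoint U * U) $$ (l, l))"
    by (intro sum.cong refl) (auto simp: mult_index[OF u(2,1)] mat_adjoint_index[OF u(1)])
  also have "\<dots> = (\<Sum>l<n. d l)" using u(3) by simp
  finally show ?thesis .
qed

section \<open>Quadratic forms in an orthonormal basis\<close>

definition orthonormal_family :: "nat \<Rightarrow> (nat \<Rightarrow> nat \<Rightarrow> complex) \<Rightarrow> bool" where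
  "orthonormal_family n u \<longleftrightarrow>
     (\<forall>j<n. \<forall>k<n. (\<Sum>i<n. cnj (u j i) * u k i) = (if j = k then 1 else 0))"

definition coefficient :: "nat \<Rightarrow> (nat \<Rightarrow> nat \<Rightarrow> complex) \<Rightarrow> (nat \<Rightarrow> complex) \<Rightarrow> nat \<Rightarrow> complex" where
  "coefficient n u v l = (\<Sum>i<n. cnj (u l i) * v i)"

text \<open>
  The form \<open>v \<mapsto> \<langle>A v, v\<rangle>\<close> of the matrix with eigenvectors \<open>u l\<close> and eigenvalues \<open>e l\<close>; sums and
  comparisons of Hermitian matrices become pointwise statements about real-valued functions.
\<close>

definition quadratic_form :: "nat \<Rightarrow> (nat \<Rightarrow> nat \<Rightarrow> complex) \<Rightarrow> (nat \<Rightarrow> real) \<Rightarrow> (nat \<Rightarrow> complex) \<Rightarrow> real" where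
  "quadratic_form n u e v = (\<Sum>l<n. e l * (cmod (coefficient n u v l))\<^sup>2)"

definition eigen_decomposition :: "nat \<Rightarrow> complex mat \<Rightarrow> (nat \<Rightarrow> nat \<Rightarrow> complex) \<Rightarrow> (nat \<Rightarrow> real) \<Rightarrow> bool" where
  "eigen_decomposition n A u e \<longleftrightarrow> A \<in> carrier_mat n n \<and> orthonormal_family n u \<and>
     (\<forall>i<n. \<forall>k<n. A $$ (i, k) = (\<Sum>l<n. complex_of_real (e l) * u l i * cnj (u l k)))"

lemma orthonormal_family_unitary_mat:
  "orthonormal_family n u \<longleftrightarrow> unitary_mat n (mat n n (\<lambda>(i, l). u l i))"
proof -
  let ?U = "mat n n (\<lambda>(i, l). u l i)"
  have U: "?U \<in> carrier_mat n n" by simp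
  have idx: "(mat_adjoint ?U * ?U) $$ (j, k) = (\<Sum>i<n. cnj (u j i) * u k i)" if "j < n" "k < n" for j k
    unfolding mult_index[OF mat_adjoint_carrier[OF U] U that]
    using that by (intro sum.cong) (auto simp: mat_adjoint_index[OF U])
  show ?thesis
  proof
    assume on: "orthonormal_family n u"
    have "mat_adjoint ?U * ?U = 1\<^sub>m n"
    proof (rule eq_matI)
      fix j k assume "j < dim_row (1\<^sub>m n :: complex mat)" "k < dim_col (1\<^sub>m n :: complex mat)"
      then show "(mat_adjoint ?U * ?U) $$ (j, k) = 1\<^sub>m n $$ (j, k)"
        using on unfolding orthonormal_family_def by (simp add: idx del: index_mult_mat)
    qed auto
    then show "unitary_mat n ?U" by (simp add: unitary_mat_def)
  next
    assume "unitary_mat n ?U"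
    then have "mat_adjoint ?U * ?U = 1\<^sub>m n" by (simp add: unitary_mat_def)
    then show "orthonormal_family n u"
      unfolding orthonormal_family_def by (auto simp: idx[symmetric] simp del: index_mult_mat)
  qed
qed

lemma orthonormal_family_complete:
  assumes "orthonormal_family n u" "i < n" "k < n"
  shows "(\<Sum>l<n. u l i * cnj (u l k)) = (if i = k then 1 else 0)"
proof -
  let ?U = "mat n n (\<lambda>(i, l). u l i)"
  have U: "?U \<in> carrier_mat n n" by simp
  have "(?U * mat_adjoint ?U) $$ (i, k) = (\<Sum>l<n. u l i * cnj (u l k))"
    unfolding mult_index[OF U mat_adjoint_carrier[OF U] assms(2,3)]
    using assms by (intro sum.cong) (auto simp: mat_adjoint_index[OF U])
  moreover have "?U * mat_adjoint ?U = 1\<^sub>m n"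
    using assms(1) by (intro unitary_matD(4)) (simp add: orthonormal_family_unitary_mat)
  ultimately show ?thesis using assms by (simp del: index_mult_mat)
qed

lemma eigen_decomposition_unitary_mat:
  assumes "eigen_decomposition n A u e"
  defines "U \<equiv> mat n n (\<lambda>(i, l). u l i)"
  shows "unitary_mat n U" "A = U * mat_diag n (\<lambda>i. complex_of_real (e i)) * mat_adjoint U"
proof -
  show U: "unitary_mat n U"
    using assms by (simp add: eigen_decomposition_def orthonormal_family_unitary_mat)
  note u = unitary_matD[OF U]
  let ?X = "U * mat_diag n (\<lambda>i. complex_of_real (e i)) * mat_adjoint U"
  have X: "?X \<in> carrier_mat n n" by (rule conjugation_carrier) (use u in simp_all)
  show "A = ?X"
  proof (rule eq_matI)
    fix i k assume "i < dim_row ?X" "k < dim_col ?X"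
    then have ik: "i < n" "k < n" using X by (metis carrier_matD)+
    show "A $$ (i, k) = ?X $$ (i, k)"
      using assms(1) ik unfolding diagonalization_index[OF u(1) ik] eigen_decomposition_def
      by (simp add: U_def)
  qed (use assms X in \<open>auto simp: eigen_decomposition_def\<close>)
qed

lemma eigen_decomposition_spec_inc:
  assumes "eigen_decomposition n A u e"
  shows "spec_inc A = sort (map e [0..<n])"
  by (rule unitary_diagonalization_spec_inc[OF eigen_decomposition_unitary_mat[OF assms]])

lemma eigen_decomposition_trace_mat_fun:
  assumes "eigen_decomposition n A u e"
  shows "Re (mat_trace (mat_fun f A)) = (\<Sum>l<n. f (e l))"
  using unitary_diagonalization_mat_fun[OF eigen_decomposition_unitary_mat[OF assms], of f]
    unitary_diagonalization_trace[OF eigen_decomposition_unitary_mat(1)[OF assms],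
      of "\<lambda>i. complex_of_real (f (e i))"]
  by (simp only: Re_sum Re_complex_of_real)

lemma sorting_permutation:
  fixes e :: "nat \<Rightarrow> real"
  obtains p where "p permutes {..<n}" "\<And>i j. i \<le> j \<Longrightarrow> j < n \<Longrightarrow> e (p j) \<le> e (p i)"
proof -
  have "mset (decreasing (map e [0..<n])) = mset (map e [0..<n])" by simp
  then obtain p where p: "p permutes {..<length (map e [0..<n])}"
    and eq: "permute_list p (map e [0..<n]) = decreasing (map e [0..<n])"
    by (rule mset_eq_permutation)
  have p': "p permutes {..<n}" using p by simp
  have e: "e (p i) = rev (sort (map e [0..<n])) ! i" if "i < n" for i
  proof -
    have "p i < n" using permutes_in_image[OF p', of i] that by simp
    then show ?thesis
      using permute_list_nth[OF p, of i] that eq by (simp add: decreasing_def)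
  qed
  show thesis
  proof (rule that[OF p'])
    fix i j assume ij: "i \<le> j" "j < n"
    have "sort (map e [0..<n]) ! (n - Suc j) \<le> sort (map e [0..<n]) ! (n - Suc i)"
      using ij by (intro sorted_nth_mono) auto
    then show "e (p j) \<le> e (p i)" using ij by (simp add: e rev_nth)
  qed
qed

lemma orthonormal_family_permute:
  assumes "orthonormal_family n u" "p permutes {..<n}"
  shows "orthonormal_family n (\<lambda>l. u (p l))"
proof -
  have "p j < n \<longleftrightarrow> j < n" for j using permutes_in_image[OF assms(2), of j] by simp
  moreover have "p j = p k \<longleftrightarrow> j = k" for j k
    using permutes_inj[OF assms(2)] by (auto dest: injD)
  ultimately show ?thesis using assms(1) unfolding orthonormal_family_def by simp
qed

lemma quadratic_form_permute:
  assumes "p permutes {..<n}"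
  shows "quadratic_form n (\<lambda>l. u (p l)) (\<lambda>l. e (p l)) v = quadratic_form n u e v"
  unfolding quadratic_form_def coefficient_def
  using sum.permute[OF assms, of "\<lambda>l. e l * (cmod (\<Sum>i<n. cnj (u l i) * v i))\<^sup>2"]
  by (simp only: o_def)

lemma hermitian_eigen_decomposition:
  fixes A :: "complex mat"
  assumes A: "A \<in> carrier_mat n n" and herm: "\<And>i k. i < n \<Longrightarrow> k < n \<Longrightarrow> A $$ (i, k) = cnj (A $$ (k, i))"
  obtains u e where "eigen_decomposition n A u e" "\<And>i j. i \<le> j \<Longrightarrow> j < n \<Longrightarrow> e j \<le> e i"
proof -
  have "mat_adjoint A = A"
    by (rule eq_matI) (use A in \<open>auto simp: mat_adjoint_index[OF A] herm[symmetric]\<close>)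
  then obtain U e where U: "unitary_mat n U"
    and Ae: "A = U * mat_diag n (\<lambda>i. complex_of_real (e i)) * mat_adjoint U"
    using hermitian_diagonalizable[OF A] by blast
  note Uc = unitary_matD(1)[OF U]
  have eq: "mat n n (\<lambda>(i, l). U $$ (i, l)) = U" by (rule eq_matI) (use Uc in auto)
  obtain p where p: "p permutes {..<n}" "\<And>i j. i \<le> j \<Longrightarrow> j < n \<Longrightarrow> e (p j) \<le> e (p i)"
    using sorting_permutation[of n e] by blast
  have on: "orthonormal_family n (\<lambda>l i. U $$ (i, l))"
    by (simp only: orthonormal_family_unitary_mat eq U)
  have "A $$ (i, k) = (\<Sum>l<n. complex_of_real (e (p l)) * U $$ (i, p l) * cnj (U $$ (k, p l)))"
    if "i < n" "k < n" for i k
  proof -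
    have "A $$ (i, k) = (\<Sum>l<n. complex_of_real (e l) * U $$ (i, l) * cnj (U $$ (k, l)))"
      unfolding Ae by (rule diagonalization_index[OF Uc that])
    also have "\<dots> = (\<Sum>l<n. complex_of_real (e (p l)) * U $$ (i, p l) * cnj (U $$ (k, p l)))"
      using sum.permute[OF p(1), of "\<lambda>l. complex_of_real (e l) * U $$ (i, l) * cnj (U $$ (k, l))"]
      by (simp only: o_def)
    finally show ?thesis .
  qed
  then have "eigen_decomposition n A (\<lambda>l i. U $$ (i, p l)) (\<lambda>l. e (p l))"
    using A orthonormal_family_permute[OF on p(1)] by (simp add: eigen_decomposition_def)
  then show thesis using that p(2) by blast
qed

text \<open>
  This serves for spectral decompositions, where the \<open>c l\<close> are the eigenvalues, and for frame
  operators, where they are \<open>1\<close> and the \<open>g l\<close> are the frame vectors.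
\<close>

lemma sesquilinear_form_sum:
  assumes "\<And>i k. i < n \<Longrightarrow> k < n \<Longrightarrow> A $$ (i, k) = (\<Sum>l<m. c l * g l i * cnj (g l k))"
  shows "(\<Sum>i<n. \<Sum>k<n. cnj (x i) * A $$ (i, k) * y k) =
    (\<Sum>l<m. c l * cnj (coefficient n g x l) * coefficient n g y l)"
proof -
  let ?t = "\<lambda>i k l. c l * (cnj (x i) * g l i) * (cnj (g l k) * y k)"
  have "(\<Sum>i<n. \<Sum>k<n. cnj (x i) * A $$ (i, k) * y k) = (\<Sum>i<n. \<Sum>k<n. \<Sum>l<m. ?t i k l)"
    by (intro sum.cong refl) (simp add: assms sum_distrib_left sum_distrib_right mult_ac)
  also have "\<dots> = (\<Sum>i<n. \<Sum>l<m. \<Sum>k<n. ?t i k l)" by (intro sum.cong refl sum.swap)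
  also have "\<dots> = (\<Sum>l<m. \<Sum>i<n. \<Sum>k<n. ?t i k l)" by (rule sum.swap)
  also have "\<dots> = (\<Sum>l<m. c l * cnj (coefficient n g x l) * coefficient n g y l)"
    by (intro sum.cong refl)
      (simp add: coefficient_def cnj_sum sum_product sum_distrib_left mult_ac)
  finally show ?thesis .
qed

lemma of_real_square_cmod: "complex_of_real (r * (cmod z)\<^sup>2) = complex_of_real r * cnj z * z"
  unfolding of_real_mult complex_norm_square by (simp only: mult_ac)

lemma eigen_decomposition_quadratic_form:
  assumes "eigen_decomposition n A u e"
  shows "complex_of_real (quadratic_form n u e v) = (\<Sum>i<n. \<Sum>k<n. cnj (v i) * A $$ (i, k) * v k)"
  unfolding quadratic_form_def of_real_sum of_real_square_cmod
  by (rule sesquilinear_form_sum[symmetric]) (use assms in \<open>auto simp: eigen_decomposition_def\<close>)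

lemma parseval:
  assumes "orthonormal_family n u"
  shows "(\<Sum>l<n. (cmod (coefficient n u v l))\<^sup>2) = (\<Sum>i<n. (cmod (v i))\<^sup>2)"
proof -
  have "eigen_decomposition n (1\<^sub>m n) u (\<lambda>_. 1)"
    using assms orthonormal_family_complete[OF assms] by (simp add: eigen_decomposition_def)
  from eigen_decomposition_quadratic_form[OF this, of v]
  have "complex_of_real (\<Sum>l<n. (cmod (coefficient n u v l))\<^sup>2) =
      (\<Sum>i<n. \<Sum>k<n. cnj (v i) * 1\<^sub>m n $$ (i, k) * v k)"
    unfolding quadratic_form_def by (simp only: mult_1)
  also have "\<dots> = (\<Sum>i<n. \<Sum>k<n. if k = i then cnj (v i) * v i else 0)"
    by (intro sum.cong refl) auto
  also have "\<dots> = (\<Sum>i<n. cnj (v i) * v i)" by simp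
  also have "\<dots> = complex_of_real (\<Sum>i<n. (cmod (v i))\<^sup>2)"
    by (simp add: complex_norm_square mult.commute del: of_real_power)
  finally show ?thesis by (simp only: of_real_eq_iff)
qed

lemma coefficient_basis_vector:
  "orthonormal_family n u \<Longrightarrow> k < n \<Longrightarrow> l < n \<Longrightarrow> coefficient n u (u l) k = (if k = l then 1 else 0)"
  by (simp add: coefficient_def orthonormal_family_def)

lemma quadratic_form_basis_vector:
  assumes "orthonormal_family n u" "l < n"
  shows "quadratic_form n u e (u l) = e l"
proof -
  have "quadratic_form n u e (u l) = (\<Sum>k<n. if k = l then e k else 0)"
    unfolding quadratic_form_def by (intro sum.cong) (auto simp: coefficient_basis_vector assms)
  then show ?thesis using assms by simp
qed

text \<open>
  The trace is the sum of the diagonal entries, which are the values at the standard basis vectors.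
\<close>

lemma sum_eigenvalues:
  assumes "orthonormal_family n u"
  shows "(\<Sum>i<n. quadratic_form n u e (\<lambda>k. if k = i then 1 else 0)) = (\<Sum>l<n. e l)"
proof -
  have c: "coefficient n u (\<lambda>k. if k = i then 1 else 0) l = cnj (u l i)" if "i < n" for i l
    using that unfolding coefficient_def by (simp add: if_distrib cong: if_cong)
  have nrm: "(\<Sum>i<n. (cmod (u l i))\<^sup>2) = 1" if "l < n" for l
  proof -
    have "complex_of_real (\<Sum>i<n. (cmod (u l i))\<^sup>2) = (\<Sum>i<n. cnj (u l i) * u l i)"
      by (simp add: complex_norm_square mult.commute del: of_real_power)
    also have "\<dots> = 1" using assms that by (simp add: orthonormal_family_def)
    finally show ?thesis by (simp only: of_real_eq_1_iff)
  qed
  have "(\<Sum>i<n. quadratic_form n u e (\<lambda>k. if k = i then 1 else 0)) =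
      (\<Sum>i<n. \<Sum>l<n. e l * (cmod (u l i))\<^sup>2)"
    unfolding quadratic_form_def by (intro sum.cong refl) (simp add: c)
  also have "\<dots> = (\<Sum>l<n. e l * (\<Sum>i<n. (cmod (u l i))\<^sup>2))"
    by (subst sum.swap) (simp add: sum_distrib_left)
  finally show ?thesis using nrm by simp
qed

lemma coefficient_combination:
  assumes u: "orthonormal_family n u" and k: "k < n"
  shows "coefficient n u (\<lambda>i. \<Sum>l<n. c l * u l i) k = c k"
proof -
  have "coefficient n u (\<lambda>i. \<Sum>l<n. c l * u l i) k = (\<Sum>i<n. \<Sum>l<n. cnj (u k i) * (c l * u l i))"
    unfolding coefficient_def by (simp add: sum_distrib_left)
  also have "\<dots> = (\<Sum>l<n. \<Sum>i<n. cnj (u k i) * (c l * u l i))" by (rule sum.swap)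
  also have "\<dots> = (\<Sum>l<n. c l * (\<Sum>i<n. cnj (u k i) * u l i))"
    by (simp add: sum_distrib_left mult_ac)
  also have "\<dots> = (\<Sum>l<n. if l = k then c l else 0)"
    using u k by (intro sum.cong refl) (auto simp: orthonormal_family_def)
  finally show ?thesis using k by simp
qed

section \<open>Eigenvalues of sums\<close>

text \<open>
  The conditions on \<open>c\<close> form a homogeneous linear system with fewer than \<open>n\<close> equations: \<open>j\<close> conditions on the
  coefficients with respect to \<open>w\<close>, and \<open>c l = 0\<close> for \<open>l > j\<close>.  Row \<open>j\<close> of the square matrix \<open>M\<close> is left zero.
\<close>

lemma vector_with_vanishing_coefficients:
  assumes u: "orthonormal_family n u" and j: "j < n"
  obtains c where "\<exists>l<n. c l \<noteq> 0" "\<And>l. j < l \<Longrightarrow> l < n \<Longrightarrow> c l = 0"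
    "\<And>m. m < j \<Longrightarrow> coefficient n w (\<lambda>i. \<Sum>l<n. c l * u l i) m = 0"
proof -
  define M where "M = mat n n (\<lambda>(r, l). if r < j then \<Sum>i<n. cnj (w r i) * u l i
    else if r = j then 0 else if r = l then 1 else 0 :: complex)"
  have M: "M \<in> carrier_mat n n" by (simp add: M_def)
  have "transpose_mat M *\<^sub>v unit_vec n j = 0\<^sub>v n"
    by (rule eq_vecI) (use j M in \<open>auto simp: scalar_prod_right_unit M_def\<close>)
  moreover have "unit_vec n j \<noteq> (0\<^sub>v n :: complex vec)" using j by simp
  ultimately have "Determinant.det (transpose_mat M) = 0"
    using det_0_iff_vec_prod_zero_field[of "transpose_mat M" n] M by (metis transpose_carrier_mat unit_vec_carrier)
  then have "Determinant.det M = 0" using det_transpose[OF M] by simp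
  then obtain v where v: "v \<in> carrier_vec n" "v \<noteq> 0\<^sub>v n" "M *\<^sub>v v = 0\<^sub>v n"
    using det_0_iff_vec_prod_zero_field[OF M] by blast
  have row: "(\<Sum>l<n. M $$ (r, l) * v $ l) = 0" if "r < n" for r
  proof -
    have "(M *\<^sub>v v) $ r = (\<Sum>l<n. M $$ (r, l) * v $ l)"
      using M v(1) that by (auto simp: scalar_prod_def atLeast0LessThan)
    then show ?thesis using v(3) that by simp
  qed
  show thesis
  proof (rule that)
    show "\<exists>l<n. v $ l \<noteq> 0"
    proof (rule ccontr)
      assume "\<not> ?thesis"
      then have "v = 0\<^sub>v n" using v(1) by (intro eq_vecI) auto
      then show False using v(2) by simp
    qed
    fix l assume l: "j < l" "l < n"
    have "(\<Sum>k<n. M $$ (l, k) * v $ k) = (\<Sum>k<n. if k = l then v $ k else 0)"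
      using l by (intro sum.cong) (auto simp: M_def)
    then show "v $ l = 0" using row[OF l(2)] l by simp
  next
    fix m assume m: "m < j"
    have "coefficient n w (\<lambda>i. \<Sum>l<n. v $ l * u l i) m = (\<Sum>i<n. \<Sum>l<n. cnj (w m i) * (v $ l * u l i))"
      unfolding coefficient_def by (simp add: sum_distrib_left)
    also have "\<dots> = (\<Sum>l<n. \<Sum>i<n. cnj (w m i) * (v $ l * u l i))" by (rule sum.swap)
    also have "\<dots> = (\<Sum>l<n. M $$ (m, l) * v $ l)"
      using m j by (intro sum.cong refl) (simp add: M_def sum_distrib_left sum_distrib_right mult_ac)
    also have "\<dots> = 0" using row m j by simp
    finally show "coefficient n w (\<lambda>i. \<Sum>l<n. v $ l * u l i) m = 0" .
  qed
qed

text \<open>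
  The argument of Courant and Fischer: in the span of \<open>u 0, \<dots>, u j\<close> there is a nonzero vector orthogonal
  to \<open>w 0, \<dots>, w (j - 1)\<close>.  Its first quadratic form is at least \<open>e j\<close> times and its second at most \<open>g j\<close> times
  its squared norm.
\<close>

lemma weyl_monotonicity:
  assumes u: "orthonormal_family n u" and w: "orthonormal_family n w"
    and e: "\<And>i j. i \<le> j \<Longrightarrow> j < n \<Longrightarrow> e j \<le> e i" and g: "\<And>i j. i \<le> j \<Longrightarrow> j < n \<Longrightarrow> g j \<le> g i"
    and le: "\<And>v. quadratic_form n u e v \<le> quadratic_form n w g v" and j: "j < n"
  shows "e j \<le> g j"
proof -
  obtain c where c: "\<exists>l<n. c l \<noteq> 0" "\<And>l. j < l \<Longrightarrow> l < n \<Longrightarrow> c l = 0"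
    "\<And>m. m < j \<Longrightarrow> coefficient n w (\<lambda>i. \<Sum>l<n. c l * u l i) m = 0"
    using vector_with_vanishing_coefficients[OF u j] by blast
  define v where "v i = (\<Sum>l<n. c l * u l i)" for i
  have cu: "coefficient n u v k = c k" if "k < n" for k
    unfolding v_def by (rule coefficient_combination[OF u that])
  define N where "N = (\<Sum>l<n. (cmod (c l))\<^sup>2)"
  have N: "N = (\<Sum>l<n. (cmod (coefficient n w v l))\<^sup>2)"
    using parseval[OF u, of v] parseval[OF w, of v] by (simp add: N_def cu)
  obtain l where "l < n" "c l \<noteq> 0" using c(1) by blast
  then have "0 < N" unfolding N_def by (intro sum_pos2[of _ l]) auto
  have "e j * N = (\<Sum>l<n. e j * (cmod (c l))\<^sup>2)" by (simp add: N_def sum_distrib_left)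
  also have "\<dots> \<le> (\<Sum>l<n. e l * (cmod (c l))\<^sup>2)"
  proof (rule sum_mono)
    fix l assume "l \<in> {..<n}"
    then show "e j * (cmod (c l))\<^sup>2 \<le> e l * (cmod (c l))\<^sup>2"
      using c(2)[of l] e[of l j] j by (cases "j < l") (auto intro: mult_right_mono)
  qed
  also have "\<dots> = quadratic_form n u e v" unfolding quadratic_form_def by (simp add: cu)
  also have "\<dots> \<le> quadratic_form n w g v" by (rule le)
  also have "\<dots> \<le> (\<Sum>l<n. g j * (cmod (coefficient n w v l))\<^sup>2)"
    unfolding quadratic_form_def
  proof (rule sum_mono)
    fix l assume "l \<in> {..<n}"
    then show "g l * (cmod (coefficient n w v l))\<^sup>2 \<le> g j * (cmod (coefficient n w v l))\<^sup>2"
      using c(3)[of l] g[of j l] unfolding v_def[symmetric, abs_def]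
      by (cases "l < j") (auto intro: mult_right_mono)
  qed
  also have "\<dots> = g j * N" by (simp add: N sum_distrib_left)
  finally show ?thesis using \<open>0 < N\<close> by simp
qed

lemma difference_of_quadratic_forms:
  assumes "orthonormal_family n u" "orthonormal_family n w"
  obtains y c where "orthonormal_family n y" "\<And>i j. i \<le> j \<Longrightarrow> j < n \<Longrightarrow> c j \<le> c i"
    "\<And>v. quadratic_form n y c v = quadratic_form n u e v - quadratic_form n w g v"
proof -
  define M where "M u e = mat n n (\<lambda>(i, k). \<Sum>l<n. complex_of_real (e l) * u l i * cnj (u l k))"
    for u :: "nat \<Rightarrow> nat \<Rightarrow> complex" and e :: "nat \<Rightarrow> real"
  have dec: "eigen_decomposition n (M u e) u e" if "orthonormal_family n u" for u e
    using that by (simp add: eigen_decomposition_def M_def)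
  define A where "A = mat n n (\<lambda>(i, k). M u e $$ (i, k) - M w g $$ (i, k))"
  have A: "A \<in> carrier_mat n n" by (simp add: A_def)
  have herm: "A $$ (i, k) = cnj (A $$ (k, i))" if "i < n" "k < n" for i k
    using that by (simp add: A_def M_def cnj_sum mult_ac)
  obtain y c where yc: "eigen_decomposition n A y c" "\<And>i j. i \<le> j \<Longrightarrow> j < n \<Longrightarrow> c j \<le> c i"
    using hermitian_eigen_decomposition[OF A herm] by blast
  have "quadratic_form n y c v = quadratic_form n u e v - quadratic_form n w g v" for v
  proof -
    have "complex_of_real (quadratic_form n y c v) =
        (\<Sum>i<n. \<Sum>k<n. cnj (v i) * M u e $$ (i, k) * v k - cnj (v i) * M w g $$ (i, k) * v k)"
      unfolding eigen_decomposition_quadratic_form[OF yc(1)]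
      by (intro sum.cong refl) (simp add: A_def algebra_simps)
    also have "\<dots> = complex_of_real (quadratic_form n u e v - quadratic_form n w g v)"
      using eigen_decomposition_quadratic_form[OF dec[OF assms(1)], of e v]
        eigen_decomposition_quadratic_form[OF dec[OF assms(2)], of g v]
      by (simp add: sum_subtractf)
    finally show ?thesis by (simp only: of_real_eq_iff)
  qed
  then show thesis using that yc unfolding eigen_decomposition_def by blast
qed

text \<open>
  With \<open>P = (S - t)\<^sup>+\<close> and \<open>S = A + B\<close> one has \<open>A = S - B \<le> t + (P - B)\<close>.  Let \<open>c\<close> be the eigenvalues of \<open>P - B\<close>.
  Monotonicity of eigenvalues gives \<open>a i \<le> t + c i\<close>, and \<open>P - B \<ge> - B\<close> gives \<open>c i \<ge> - b (n - Suc i)\<close>, the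
  eigenvalues of \<open>- B\<close> in decreasing order.  So \<open>c i + b (n - Suc i)\<close> is nonnegative and bounds
  \<open>a i + b (n - Suc i) - t\<close>, and the sum of these bounds is the trace of \<open>P\<close>, the right-hand side.
\<close>

lemma lidskii_excess:
  assumes u: "orthonormal_family n u" and w: "orthonormal_family n w" and x: "orthonormal_family n x"
    and a: "\<And>i j. i \<le> j \<Longrightarrow> j < n \<Longrightarrow> a j \<le> a i" and b: "\<And>i j. i \<le> j \<Longrightarrow> j < n \<Longrightarrow> b j \<le> b i"
    and sum: "\<And>v. quadratic_form n x s v = quadratic_form n u a v + quadratic_form n w b v"
  shows "(\<Sum>i<n. max 0 (a i + b (n - Suc i) - t)) \<le> (\<Sum>i<n. max 0 (s i - t))"
proof -
  define p where "p l = max 0 (s l - t)" for l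
  obtain y c where y: "orthonormal_family n y" and c: "\<And>i j. i \<le> j \<Longrightarrow> j < n \<Longrightarrow> c j \<le> c i"
    and yc: "\<And>v. quadratic_form n y c v = quadratic_form n x p v - quadratic_form n w b v"
    by (rule difference_of_quadratic_forms[OF x w, where e = p and g = b]) (use that in blast)
  have p_nn: "0 \<le> quadratic_form n x p v" for v
    unfolding quadratic_form_def by (intro sum_nonneg) (simp add: p_def)
  \<comment> \<open>Reversing the order turns \<open>- b\<close> into a decreasing sequence of eigenvalues.\<close>
  define \<rho> where "\<rho> i = (if i < n then n - Suc i else i)" for i
  have "\<rho> permutes {..<n}"
    by (rule bij_imp_permutes, rule bij_betwI[of _ _ _ \<rho>]) (auto simp: \<rho>_def)
  note rev = orthonormal_family_permute[OF w this] quadratic_form_permute[OF this]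
  have lower: "- b (n - Suc i) \<le> c i" if "i < n" for i
  proof -
    have "- b (\<rho> i) \<le> c i"
    proof (rule weyl_monotonicity[OF rev(1) y _ c _ that])
      show "- b (\<rho> j) \<le> - b (\<rho> i)" if "i \<le> j" "j < n" for i j
        using b[of "\<rho> j" "\<rho> i"] that by (simp add: \<rho>_def)
      have "quadratic_form n w (\<lambda>l. - b l) v = - quadratic_form n w b v" for v
        by (simp add: quadratic_form_def sum_negf)
      then show "quadratic_form n (\<lambda>l. w (\<rho> l)) (\<lambda>l. - b (\<rho> l)) v \<le> quadratic_form n y c v" for v
        using rev(2)[of w "\<lambda>l. - b l" v] yc[of v] p_nn[of v] by simp
    qed
    then show ?thesis using that by (simp add: \<rho>_def)
  qed
  have upper: "a i \<le> t + c i" if "i < n" for i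
  proof (rule weyl_monotonicity[OF u y a _ _ that])
    show "t + c j \<le> t + c i" if "i \<le> j" "j < n" for i j using c[OF that] by simp
    fix v
    have shift: "quadratic_form n z (\<lambda>l. t + h l) v = t * (\<Sum>i<n. (cmod (v i))\<^sup>2) + quadratic_form n z h v"
      if "orthonormal_family n z" for z h
      unfolding parseval[OF that, of v, symmetric]
      by (simp add: quadratic_form_def sum_distrib_left sum.distrib algebra_simps)
    have "quadratic_form n x s v \<le> quadratic_form n x (\<lambda>l. t + p l) v"
      unfolding quadratic_form_def by (intro sum_mono mult_right_mono) (auto simp: p_def)
    then show "quadratic_form n u a v \<le> quadratic_form n y (\<lambda>l. t + c l) v"
      using sum[of v] yc[of v] shift[OF x, of p] shift[OF y, of c] by simp
  qed
  have tr: "(\<Sum>l<n. c l) = (\<Sum>l<n. p l) - (\<Sum>l<n. b l)"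
    using sum_eigenvalues[OF y, of c] sum_eigenvalues[OF x, of p] sum_eigenvalues[OF w, of b]
    by (simp add: yc sum_subtractf)
  have "(\<Sum>i<n. max 0 (a i + b (n - Suc i) - t)) \<le> (\<Sum>i<n. c i + b (n - Suc i))"
    using lower upper by (intro sum_mono) (force simp: max_def)
  also have "\<dots> = (\<Sum>i<n. c i) + (\<Sum>i<n. b i)"
    using sum.nat_diff_reindex[of b n] by (simp add: sum.distrib)
  also have "\<dots> = (\<Sum>l<n. p l)" using tr by simp
  finally show ?thesis by (simp add: p_def)
qed

section \<open>Spectra of frame operators\<close>

lemma decreasing_map_upt:
  assumes "\<And>i j. i \<le> j \<Longrightarrow> j < n \<Longrightarrow> e j \<le> e i"
  shows "decreasing (map e [0..<n]) = map e [0..<n]"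
proof -
  have "sort (map e [0..<n]) = rev (map e [0..<n])"
    by (rule properties_for_sort)
      (auto simp: sorted_iff_nth_mono rev_nth intro!: assms)
  then show ?thesis by (simp add: decreasing_def)
qed

lemma frame_op_carrier: "set F \<subseteq> carrier_vec d \<Longrightarrow> frame_op d F \<in> carrier_mat d d"
proof (induction F)
  case (Cons g F)
  have "rank_one g g \<in> carrier_mat d d" using Cons.prems by (auto simp: rank_one_def)
  then show ?case using Cons by (simp add: frame_op_def)
qed (simp add: frame_op_def)

lemma frame_op_sum_list:
  assumes "set F \<subseteq> carrier_vec d" "i < d" "k < d"
  shows "frame_op d F $$ (i, k) = (\<Sum>g\<leftarrow>F. g $ i * cnj (g $ k))"
  using assms(1)
proof (induction F)
  case (Cons g F)
  have "dim_vec g = d" and F: "set F \<subseteq> carrier_vec d" using Cons.prems by auto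
  then show ?case
    using Cons.IH[OF F] frame_op_carrier[OF F] assms by (simp add: frame_op_def rank_one_def)
qed (use assms in \<open>simp add: frame_op_def\<close>)

lemma frame_op_append_index:
  assumes "set F \<subseteq> carrier_vec d" "set G \<subseteq> carrier_vec d" "i < d" "k < d"
  shows "frame_op d (F @ G) $$ (i, k) = frame_op d F $$ (i, k) + frame_op d G $$ (i, k)"
  using assms by (simp add: frame_op_sum_list)

lemma frame_op_index:
  assumes "set F \<subseteq> carrier_vec d" "i < d" "k < d"
  shows "frame_op d F $$ (i, k) = (\<Sum>j<length F. F ! j $ i * cnj (F ! j $ k))"
  by (simp add: frame_op_sum_list[OF assms] sum_list_sum_nth atLeast0LessThan)

lemma frame_op_sesquilinear_form:
  assumes F: "set F \<subseteq> carrier_vec d"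
  shows "(\<Sum>i<d. \<Sum>k<d. cnj (x i) * frame_op d F $$ (i, k) * y k) = (\<Sum>j<length F.
    cnj (coefficient d (\<lambda>j i. F ! j $ i) x j) * coefficient d (\<lambda>j i. F ! j $ i) y j)"
  using sesquilinear_form_sum[where c = "\<lambda>_. 1" and g = "\<lambda>j i. F ! j $ i" and m = "length F"
      and A = "frame_op d F" and n = d] by (simp add: frame_op_index[OF F])

lemma frame_op_eigenvalues_nonneg:
  assumes F: "set F \<subseteq> carrier_vec d" and ue: "eigen_decomposition d (frame_op d F) u e" and "l < d"
  shows "0 \<le> e l"
proof -
  let ?c = "coefficient d (\<lambda>j i. F ! j $ i) (u l)"
  have "complex_of_real (e l) = complex_of_real (quadratic_form d u e (u l))"
    using quadratic_form_basis_vector[of d u l e] ue assms(3) by (simp add: eigen_decomposition_def)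
  also have "\<dots> = (\<Sum>j<length F. cnj (?c j) * ?c j)"
    unfolding eigen_decomposition_quadratic_form[OF ue] by (rule frame_op_sesquilinear_form[OF F])
  also have "\<dots> = complex_of_real (\<Sum>j<length F. 1 * (cmod (?c j))\<^sup>2)"
    unfolding of_real_sum of_real_square_cmod by simp
  finally show ?thesis unfolding of_real_eq_iff by (simp add: sum_nonneg)
qed

lemma frame_op_eigen_decomposition:
  assumes F: "set F \<subseteq> carrier_vec d"
  obtains u e where "eigen_decomposition d (frame_op d F) u e" "\<And>i j. i \<le> j \<Longrightarrow> j < d \<Longrightarrow> e j \<le> e i"
    "\<And>l. l < d \<Longrightarrow> 0 \<le> e l" "spec_dec (frame_op d F) = map e [0..<d]"
proof -
  have herm: "frame_op d F $$ (i, k) = cnj (frame_op d F $$ (k, i))" if "i < d" "k < d" for i k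
    using that by (simp add: frame_op_index[OF F] mult.commute)
  obtain u e where ue: "eigen_decomposition d (frame_op d F) u e" and dec: "\<And>i j. i \<le> j \<Longrightarrow> j < d \<Longrightarrow> e j \<le> e i"
    using hermitian_eigen_decomposition[OF frame_op_carrier[OF F] herm] by blast
  have "spec_dec (frame_op d F) = map e [0..<d]"
    using decreasing_map_upt[of d e] dec
    by (simp add: spec_dec_def eigen_decomposition_spec_inc[OF ue] decreasing_def)
  then show thesis using that ue dec frame_op_eigenvalues_nonneg[OF F ue] by blast
qed

lemma spec_dec_decreasing: "decreasing (spec_dec S) = spec_dec S"
proof -
  have "decreasing (spec_dec S) = decreasing (spec_inc S)"
    by (rule decreasing_cong_mset) (simp add: spec_dec_def)
  then show ?thesis by (simp add: decreasing_def spec_dec_def spec_inc_def sorted_sort_id)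
qed

lemma spec_inc_increasing: "increasing (spec_inc S) = spec_inc S"
  by (simp add: spec_inc_def increasing_def sorted_sort_id)

lemma spec_inc_eq_rev: "spec_inc S = rev (spec_dec S)"
  by (simp add: spec_dec_def)

lemma frame_op_spec_dec:
  assumes F: "set F \<subseteq> carrier_vec d"
  shows "length (spec_dec (frame_op d F)) = d" "t \<in> set (spec_dec (frame_op d F)) \<Longrightarrow> 0 \<le> t"
proof -
  obtain u e where "eigen_decomposition d (frame_op d F) u e" "\<And>l. l < d \<Longrightarrow> 0 \<le> e l"
    "spec_dec (frame_op d F) = map e [0..<d]"
    by (rule frame_op_eigen_decomposition[OF F]) (use that in blast)
  then show "length (spec_dec (frame_op d F)) = d" "t \<in> set (spec_dec (frame_op d F)) \<Longrightarrow> 0 \<le> t"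
    by auto
qed

lemma potential_eq_sum_fun:
  assumes F: "set F \<subseteq> carrier_vec d"
  shows "potential f d F = sum_fun f (spec_dec (frame_op d F))"
proof -
  obtain u e where ue: "eigen_decomposition d (frame_op d F) u e"
    and s: "spec_dec (frame_op d F) = map e [0..<d]"
    by (rule frame_op_eigen_decomposition[OF F]) (use that in blast)
  show ?thesis unfolding potential_def eigen_decomposition_trace_mat_fun[OF ue] s sum_fun_map_upt ..
qed

lemma frame_op_append_convex_order:
  assumes F: "set F \<subseteq> carrier_vec d" and G: "set G \<subseteq> carrier_vec d"
  shows "convex_order (vadd (spec_dec (frame_op d F)) (spec_inc (frame_op d G)))
    (spec_dec (frame_op d (F @ G)))"
proof -
  have FG: "set (F @ G) \<subseteq> carrier_vec d" using F G by simp
  obtain u a where u: "eigen_decomposition d (frame_op d F) u a" "\<And>i j. i \<le> j \<Longrightarrow> j < d \<Longrightarrow> a j \<le> a i"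
    "spec_dec (frame_op d F) = map a [0..<d]"
    by (rule frame_op_eigen_decomposition[OF F]) (use that in blast)
  obtain w b where w: "eigen_decomposition d (frame_op d G) w b" "\<And>i j. i \<le> j \<Longrightarrow> j < d \<Longrightarrow> b j \<le> b i"
    "spec_dec (frame_op d G) = map b [0..<d]"
    by (rule frame_op_eigen_decomposition[OF G]) (use that in blast)
  obtain x s where x: "eigen_decomposition d (frame_op d (F @ G)) x s"
    "spec_dec (frame_op d (F @ G)) = map s [0..<d]"
    by (rule frame_op_eigen_decomposition[OF FG]) (use that in blast)
  have on: "orthonormal_family d u" "orthonormal_family d w" "orthonormal_family d x"
    using u(1) w(1) x(1) by (simp_all add: eigen_decomposition_def)
  have sum: "quadratic_form d x s v = quadratic_form d u a v + quadratic_form d w b v" for v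
  proof -
    have "complex_of_real (quadratic_form d x s v) =
        (\<Sum>i<d. \<Sum>k<d. cnj (v i) * frame_op d F $$ (i, k) * v k + cnj (v i) * frame_op d G $$ (i, k) * v k)"
      unfolding eigen_decomposition_quadratic_form[OF x(1)]
      by (intro sum.cong refl) (simp add: frame_op_append_index[OF F G] algebra_simps)
    also have "\<dots> = complex_of_real (quadratic_form d u a v + quadratic_form d w b v)"
      unfolding of_real_add eigen_decomposition_quadratic_form[OF u(1)]
        eigen_decomposition_quadratic_form[OF w(1)] by (simp add: sum.distrib)
    finally show ?thesis by (simp only: of_real_eq_iff)
  qed
  have v: "vadd (spec_dec (frame_op d F)) (spec_inc (frame_op d G)) = map (\<lambda>i. a i + b (d - Suc i)) [0..<d]"
    unfolding vadd_def spec_inc_eq_rev u(3) w(3)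
    by (rule nth_equalityI) (auto simp: rev_nth)
  have tot: "(\<Sum>i<d. a i + b (d - Suc i)) = (\<Sum>i<d. s i)"
    using sum_eigenvalues[OF on(1), of a] sum_eigenvalues[OF on(2), of b] sum_eigenvalues[OF on(3), of s]
      sum.nat_diff_reindex[of b d] by (simp add: sum sum.distrib)
  have "(\<Sum>i<d. max 0 (a i + b (d - Suc i) - t)) \<le> (\<Sum>i<d. max 0 (s i - t))" for t
    by (rule lidskii_excess[OF on u(2) w(2) sum])
  then show ?thesis
    unfolding convex_order_def v x(2) excess_def sum_fun_map_upt
    using tot by (simp add: interv_sum_list_conv_sum_set_nat atLeast0LessThan)
qed

section \<open>Norms of the added vectors and their frame operator\<close>

text \<open>
  The easy half of the Schur-Horn theorem.  Dividing the squared entries of row \<open>l\<close> by \<open>e l\<close> gives a matrix \<open>P\<close>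
  whose row and column sums are at most \<open>1\<close>, and the squared column norms are its weighted
  column sums with weights \<open>e l\<close>.
\<close>

lemma column_norms_excess:
  fixes T :: "nat \<Rightarrow> nat \<Rightarrow> complex" and e :: "nat \<Rightarrow> real"
  assumes rows: "\<And>l l'. l < d \<Longrightarrow> l' < d \<Longrightarrow>
      (\<Sum>j<k. T l j * cnj (T l' j)) = (if l = l' then complex_of_real (e l) else 0)"
    and e: "\<And>l. l < d \<Longrightarrow> 0 \<le> e l"
  shows "(\<Sum>j<k. \<Sum>l<d. (cmod (T l j))\<^sup>2) = (\<Sum>l<d. e l)"
    and "0 \<le> t \<Longrightarrow> (\<Sum>j<k. max 0 ((\<Sum>l<d. (cmod (T l j))\<^sup>2) - t)) \<le> (\<Sum>l<d. max 0 (e l - t))"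
proof -
  have row: "(\<Sum>j<k. (cmod (T l j))\<^sup>2) = e l" if "l < d" for l
  proof -
    have "complex_of_real (\<Sum>j<k. (cmod (T l j))\<^sup>2) = complex_of_real (e l)"
      using rows[OF that that] by (simp only: complex_norm_square of_real_sum) simp
    then show ?thesis by (simp only: of_real_eq_iff)
  qed
  then show "(\<Sum>j<k. \<Sum>l<d. (cmod (T l j))\<^sup>2) = (\<Sum>l<d. e l)"
    by (subst sum.swap) simp
  have zero: "T l j = 0" if "l < d" "j < k" "e l = 0" for l j
  proof -
    have "(\<Sum>j<k. (cmod (T l j))\<^sup>2) = 0" using row that by simp
    then have "\<forall>j\<in>{..<k}. (cmod (T l j))\<^sup>2 = 0" by (subst (asm) sum_nonneg_eq_0_iff) auto
    then show ?thesis using that by simp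
  qed
  \<comment> \<open>If \<open>e l = 0\<close> the whole row vanishes, and division by zero gives the right value \<open>0\<close>.\<close>
  define P where "P l j = (cmod (T l j))\<^sup>2 / e l" for l j
  have P_nn: "0 \<le> P l j" if "l < d" for l j using e[OF that] by (simp add: P_def)
  have P_row: "(\<Sum>j<k. P l j) \<le> 1" if "l < d" for l
    using row[OF that] unfolding P_def by (simp add: sum_divide_distrib[symmetric])
  have P_col: "(\<Sum>l<d. P l j) \<le> 1" if j: "j < k" for j
  proof -
    \<comment> \<open>Bessel: \<open>z\<close> has squared norm \<open>\<beta> = (\<Sum>l<d. P l j)\<close>, and its entry at \<open>j\<close> is \<open>\<beta>\<close>, so \<open>\<beta>\<^sup>2 \<le> \<beta>\<close>.\<close>
    define c where "c l = T l j / complex_of_real (e l)" for l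
    define z where "z i = (\<Sum>l<d. cnj (T l i) * c l)" for i
    let ?t = "\<lambda>i l l'. c l * cnj (c l') * (T l' i * cnj (T l i))"
    have "complex_of_real (\<Sum>i<k. (cmod (z i))\<^sup>2) = (\<Sum>i<k. \<Sum>l<d. \<Sum>l'<d. ?t i l l')"
      unfolding z_def of_real_sum complex_norm_square cnj_sum sum_product
      by (intro sum.cong refl) (simp add: mult_ac)
    also have "\<dots> = (\<Sum>l<d. \<Sum>i<k. \<Sum>l'<d. ?t i l l')" by (rule sum.swap)
    also have "\<dots> = (\<Sum>l<d. \<Sum>l'<d. \<Sum>i<k. ?t i l l')" by (intro sum.cong refl sum.swap)
    also have "\<dots> = (\<Sum>l<d. \<Sum>l'<d. c l * cnj (c l') * (\<Sum>i<k. T l' i * cnj (T l i)))"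
      by (simp add: sum_distrib_left)
    also have "\<dots> = (\<Sum>l<d. \<Sum>l'<d. if l' = l then c l * cnj (c l) * complex_of_real (e l) else 0)"
      by (intro sum.cong refl) (auto simp: rows)
    also have "\<dots> = (\<Sum>l<d. c l * cnj (c l) * complex_of_real (e l))" by simp
    also have "\<dots> = (\<Sum>l<d. complex_of_real (P l j))"
    proof (intro sum.cong refl)
      fix l
      have "complex_of_real (P l j) = T l j * cnj (T l j) / complex_of_real (e l)"
        unfolding P_def of_real_divide complex_norm_square ..
      then show "c l * cnj (c l) * complex_of_real (e l) = complex_of_real (P l j)"
        by (cases "e l = 0") (simp_all add: c_def)
    qed
    also have "\<dots> = complex_of_real (\<Sum>l<d. P l j)" by (rule of_real_sum[symmetric])
    finally have sq: "(\<Sum>i<k. (cmod (z i))\<^sup>2) = (\<Sum>l<d. P l j)" by (simp only: of_real_eq_iff)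
    have "z j = (\<Sum>l<d. complex_of_real (P l j))"
      unfolding z_def
    proof (intro sum.cong refl)
      fix l
      show "cnj (T l j) * c l = complex_of_real (P l j)"
        unfolding P_def of_real_divide complex_norm_square c_def by (simp add: mult.commute)
    qed
    then have "z j = complex_of_real (\<Sum>l<d. P l j)" by (simp only: of_real_sum)
    then have "(cmod (z j))\<^sup>2 = (\<Sum>l<d. P l j)\<^sup>2"
      by (simp only: norm_of_real power2_abs)
    moreover have "(cmod (z j))\<^sup>2 \<le> (\<Sum>i<k. (cmod (z i))\<^sup>2)"
      using j by (intro member_le_sum) auto
    ultimately have "(\<Sum>l<d. P l j)\<^sup>2 \<le> (\<Sum>l<d. P l j)" using sq by simp
    then have "(\<Sum>l<d. P l j) * (\<Sum>l<d. P l j) \<le> (\<Sum>l<d. P l j) * 1"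
      by (simp only: power2_eq_square mult_1_right)
    then show ?thesis by (rule contrapos_pp) (simp only: not_le, rule mult_strict_left_mono, auto)
  qed
  have col: "(\<Sum>l<d. (cmod (T l j))\<^sup>2) = (\<Sum>l<d. e l * P l j)" if "j < k" for j
  proof (intro sum.cong refl)
    fix l assume "l \<in> {..<d}"
    then show "(cmod (T l j))\<^sup>2 = e l * P l j"
      using zero[of l j] that by (cases "e l = 0") (auto simp: P_def)
  qed
  assume t: "0 \<le> t"
  define I where "I = {j \<in> {..<k}. t < (\<Sum>l<d. (cmod (T l j))\<^sup>2)}"
  have "(\<Sum>j<k. max 0 ((\<Sum>l<d. (cmod (T l j))\<^sup>2) - t)) = (\<Sum>j\<in>I. max 0 ((\<Sum>l<d. (cmod (T l j))\<^sup>2) - t))"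
    by (intro sum.mono_neutral_right) (auto simp: I_def)
  also have "\<dots> = (\<Sum>j\<in>I. (\<Sum>l<d. e l * P l j) - t)"
    by (intro sum.cong refl) (auto simp: I_def col)
  also have "\<dots> \<le> (\<Sum>j\<in>I. \<Sum>l<d. (e l - t) * P l j)"
  proof (intro sum_mono)
    fix j assume "j \<in> I"
    then have "t * (\<Sum>l<d. P l j) \<le> t * 1" using P_col t by (intro mult_left_mono) (auto simp: I_def)
    then show "(\<Sum>l<d. e l * P l j) - t \<le> (\<Sum>l<d. (e l - t) * P l j)"
      by (simp add: algebra_simps sum_subtractf sum_distrib_left)
  qed
  also have "\<dots> \<le> (\<Sum>j\<in>I. \<Sum>l<d. max 0 (e l - t) * P l j)"
    using P_nn by (intro sum_mono mult_right_mono) auto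
  also have "\<dots> = (\<Sum>l<d. max 0 (e l - t) * (\<Sum>j\<in>I. P l j))"
    by (subst sum.swap) (simp add: sum_distrib_left)
  also have "\<dots> \<le> (\<Sum>l<d. max 0 (e l - t) * 1)"
  proof (intro sum_mono mult_left_mono)
    fix l assume "l \<in> {..<d}"
    then have l: "l < d" by simp
    have "(\<Sum>j\<in>I. P l j) \<le> (\<Sum>j<k. P l j)"
      using P_nn[OF l] by (intro sum_mono2) (auto simp: I_def)
    also have "\<dots> \<le> 1" by (rule P_row[OF l])
    finally show "(\<Sum>j\<in>I. P l j) \<le> 1" .
  qed auto
  finally show "(\<Sum>j<k. max 0 ((\<Sum>l<d. (cmod (T l j))\<^sup>2) - t)) \<le> (\<Sum>l<d. max 0 (e l - t))" by simp
qed

lemma inner_self_norm: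
  assumes "v \<in> carrier_vec d"
  shows "v \<bullet>c v = complex_of_real (\<Sum>i<d. (cmod (v $ i))\<^sup>2)"
  unfolding of_real_sum complex_norm_square
  using assms by (auto simp: scalar_prod_def atLeast0LessThan)

lemma frame_op_coefficients_orthogonal:
  assumes G: "set G \<subseteq> carrier_vec d" and ue: "eigen_decomposition d (frame_op d G) u e"
    and l: "l < d" "l' < d"
  defines "T \<equiv> \<lambda>l j. coefficient d u (\<lambda>i. G ! j $ i) l"
  shows "(\<Sum>j<length G. T l j * cnj (T l' j)) = (if l = l' then complex_of_real (e l) else 0)"
proof -
  have on: "orthonormal_family d u" using ue by (simp add: eigen_decomposition_def)
  let ?g = "coefficient d (\<lambda>j i. G ! j $ i)"
  have T: "T l j = cnj (?g (u l) j)" for l j by (simp add: T_def coefficient_def cnj_sum mult.commute)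
  have "(\<Sum>j<length G. T l j * cnj (T l' j)) =
      (\<Sum>i<d. \<Sum>k<d. cnj (u l i) * frame_op d G $$ (i, k) * u l' k)"
    unfolding frame_op_sesquilinear_form[OF G] T by simp
  also have "\<dots> = (\<Sum>p<d. complex_of_real (e p) * cnj (coefficient d u (u l) p) * coefficient d u (u l') p)"
    by (rule sesquilinear_form_sum) (use ue in \<open>auto simp: eigen_decomposition_def\<close>)
  also have "\<dots> = (\<Sum>p<d. if p = l then (if l = l' then complex_of_real (e l) else 0) else 0)"
    using l by (intro sum.cong refl) (auto simp: coefficient_basis_vector[OF on])
  finally show ?thesis using l by simp
qed

lemma frame_op_spec_in_Gamma_set:
  assumes G: "set G \<subseteq> carrier_vec d" "length G = length a"
    and norms: "\<And>i. i < length a \<Longrightarrow> G ! i \<bullet>c G ! i = complex_of_real (a ! i)"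
    and a: "\<forall>\<alpha>\<in>set a. 0 < \<alpha>"
  shows "spec_inc (frame_op d G) \<in> Gamma_set d a"
proof -
  obtain u e where ue: "eigen_decomposition d (frame_op d G) u e" and e: "\<And>l. l < d \<Longrightarrow> 0 \<le> e l"
    and sp: "spec_dec (frame_op d G) = map e [0..<d]"
    by (rule frame_op_eigen_decomposition[OF G(1)]) (use that in blast)
  have on: "orthonormal_family d u" using ue by (simp add: eigen_decomposition_def)
  let ?\<mu> = "spec_inc (frame_op d G)"
  have \<mu>: "?\<mu> = rev (map e [0..<d])" by (simp add: spec_inc_eq_rev sp)
  have sum\<mu>: "sum_fun h ?\<mu> = (\<Sum>l<d. h (e l))" for h
    using sum_fun_cong_mset[of ?\<mu> "map e [0..<d]" h] by (simp add: \<mu> sum_fun_map_upt)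
  have col: "(\<Sum>l<d. (cmod (coefficient d u (\<lambda>i. G ! j $ i) l))\<^sup>2) = a ! j" if j: "j < length a" for j
  proof -
    have "G ! j \<in> carrier_vec d" using G j by auto
    then have "complex_of_real (a ! j) = complex_of_real (\<Sum>i<d. (cmod (G ! j $ i))\<^sup>2)"
      using norms[OF j] inner_self_norm by metis
    then show ?thesis unfolding parseval[OF on] by (simp only: of_real_eq_iff)
  qed
  have sums: "(\<Sum>j<length G. \<Sum>l<d. (cmod (coefficient d u (\<lambda>i. G ! j $ i) l))\<^sup>2) = (\<Sum>l<d. e l)"
    by (rule column_norms_excess(1)[OF frame_op_coefficients_orthogonal[OF G(1) ue] e])
  have exc: "(\<Sum>j<length G. max 0 ((\<Sum>l<d. (cmod (coefficient d u (\<lambda>i. G ! j $ i) l))\<^sup>2) - t)) \<le>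
      (\<Sum>l<d. max 0 (e l - t))" if "0 \<le> t" for t
    by (rule column_norms_excess(2)[OF frame_op_coefficients_orthogonal[OF G(1) ue] e that])
  have tot: "sum_list a = sum_list ?\<mu>"
  proof -
    have "sum_list a = (\<Sum>j<length G. a ! j)" by (simp add: G(2) sum_list_sum_nth atLeast0LessThan)
    also have "\<dots> = (\<Sum>l<d. e l)" using sums G(2) by (simp add: col)
    also have "\<dots> = sum_list ?\<mu>" using sum\<mu>[of "\<lambda>u. u"] by (simp add: sum_fun_def)
    finally show ?thesis .
  qed
  have "excess t a \<le> excess t ?\<mu>" if "0 \<le> t" for t
    using exc[OF that] G(2) by (simp add: excess_def sum\<mu> sum_fun_nth[of _ a] col)
  moreover have "0 \<le> x" if "x \<in> set a \<union> set ?\<mu>" for x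
    using that a e by (force simp: \<mu> less_imp_le)
  ultimately have "majorized a ?\<mu>" using tot by (subst majorized_iff_excess) auto
  moreover have "length ?\<mu> = d" "\<forall>t\<in>set ?\<mu>. 0 \<le> t" using e by (auto simp: \<mu>)
  ultimately show ?thesis by (simp add: Gamma_set_def spec_inc_increasing)
qed

text \<open>
  Take a real matrix \<open>T\<close> with orthogonal rows of squared norms \<open>\<mu> l\<close> and columns of squared norms \<open>a j\<close>, and use
  its columns as coordinates with respect to an eigenbasis of the frame operator of \<open>F\<close>.  That
  basis then diagonalises all three frame operators.
\<close>

lemma aligned_completion:
  assumes F: "set F \<subseteq> carrier_vec d" and \<mu>: "\<mu> \<in> Gamma_set d a" and a: "\<forall>\<alpha>\<in>set a. 0 < \<alpha>"
  obtains G where "length G = length a" "set G \<subseteq> carrier_vec d"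
    "\<And>i. i < length a \<Longrightarrow> G ! i \<bullet>c G ! i = complex_of_real (a ! i)"
    "spec_inc (frame_op d G) = \<mu>"
    "spec_dec (frame_op d (F @ G)) = decreasing (vadd (spec_dec (frame_op d F)) \<mu>)"
proof -
  let ?k = "length a"
  have len: "length \<mu> = d" and nn: "\<And>t. t \<in> set \<mu> \<Longrightarrow> 0 \<le> t" and inc: "increasing \<mu> = \<mu>"
    and maj: "majorized a \<mu>" using \<mu> by (auto simp: Gamma_set_def)
  have ann: "0 \<le> x" if "x \<in> set a \<union> set \<mu>" for x using that nn a less_imp_le by blast
  \<comment> \<open>An additional coordinate with value \<open>0\<close>, from which the construction starts; its row vanishes and is dropped.\<close>
  define m where "m x = (if x < d then \<mu> ! x else 0)" for x
  have sum_m: "(\<Sum>x<Suc d. h (m x)) = sum_fun h \<mu>" if "h 0 = 0" for h :: "real \<Rightarrow> real"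
    using that len by (simp add: m_def sum_fun_nth)
  have ex: "excess t a \<le> excess t \<mu>" if "0 \<le> t" for t
    using maj majorized_iff_excess[of a \<mu>] ann that by blast
  have tot: "sum_list a = sum_list \<mu>"
    using maj majorized_iff_excess[of a \<mu>] ann by blast
  have "\<exists>T. (\<forall>x\<in>{..<Suc d}. \<forall>y\<in>{..<Suc d}. (\<Sum>j<?k. T x j * T y j) = (if x = y then m x else 0)) \<and>
      (\<forall>j\<in>{..<?k}. (\<Sum>x<Suc d. (T x j)\<^sup>2) = a ! j)"
  proof (rule prescribed_rows_and_columns)
    show "d \<in> {..<Suc d}" "m d = 0" by (simp_all add: m_def)
    show "0 \<le> m x" if "x \<in> {..<Suc d}" for x using nn len by (simp add: m_def)
    show "(\<Sum>j<?k. a ! j) = (\<Sum>x<Suc d. m x)"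
      using tot sum_m[of "\<lambda>u. u"] by (simp add: sum_fun_def sum_list_sum_nth[of a] atLeast0LessThan)
    show "(\<Sum>j<?k. max 0 (a ! j - t)) \<le> (\<Sum>x<Suc d. max 0 (m x - t))" if "0 \<le> t" for t
      using ex[OF that] sum_m[of "\<lambda>u. max 0 (u - t)"] that by (simp add: excess_def sum_fun_nth[of _ a])
  qed (use a in auto)
  then obtain T where rows: "\<And>x y. x < Suc d \<Longrightarrow> y < Suc d \<Longrightarrow> (\<Sum>j<?k. T x j * T y j) = (if x = y then m x else 0)"
    and cols: "\<And>j. j < ?k \<Longrightarrow> (\<Sum>x<Suc d. (T x j)\<^sup>2) = a ! j" by blast
  have "T d j = 0" if "j < ?k" for j
  proof -
    have "(\<Sum>j<?k. T d j * T d j) = 0" using rows[of d d] by (simp add: m_def)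
    then show ?thesis using that by (subst (asm) sum_nonneg_eq_0_iff) auto
  qed
  then have cols': "(\<Sum>x<d. (T x j)\<^sup>2) = a ! j" if "j < ?k" for j using cols[OF that] that by simp
  have rows': "(\<Sum>j<?k. T x j * T y j) = (if x = y then \<mu> ! x else 0)" if "x < d" "y < d" for x y
    using rows[of x y] that by (simp add: m_def)
  obtain u e where ue: "eigen_decomposition d (frame_op d F) u e"
    and sp: "spec_dec (frame_op d F) = map e [0..<d]"
    by (rule frame_op_eigen_decomposition[OF F]) (use that in blast)
  have on: "orthonormal_family d u" using ue by (simp add: eigen_decomposition_def)
  define g where "g j i = (\<Sum>l<d. complex_of_real (T l j) * u l i)" for j i
  define G where "G = map (\<lambda>j. vec d (g j)) [0..<?k]"
  have G: "set G \<subseteq> carrier_vec d" "length G = ?k" by (auto simp: G_def)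
  have FG: "set (F @ G) \<subseteq> carrier_vec d" using F G by simp
  have Gj: "G ! j $ i = g j i" if "j < ?k" "i < d" for i j using that by (simp add: G_def)
  have SG: "frame_op d G $$ (i, k) = (\<Sum>l<d. complex_of_real (\<mu> ! l) * u l i * cnj (u l k))"
    if ik: "i < d" "k < d" for i k
  proof -
    let ?t = "\<lambda>j l l'. (complex_of_real (T l j) * u l i) * cnj (complex_of_real (T l' j) * u l' k)"
    have "frame_op d G $$ (i, k) = (\<Sum>j<?k. \<Sum>l<d. \<Sum>l'<d. ?t j l l')"
      unfolding frame_op_index[OF G(1) ik] G(2)
      by (intro sum.cong refl) (simp only: lessThan_iff Gj ik g_def cnj_sum sum_product)
    also have "\<dots> = (\<Sum>l<d. \<Sum>j<?k. \<Sum>l'<d. ?t j l l')" by (rule sum.swap)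
    also have "\<dots> = (\<Sum>l<d. \<Sum>l'<d. \<Sum>j<?k. ?t j l l')" by (intro sum.cong refl sum.swap)
    also have "\<dots> = (\<Sum>l<d. \<Sum>l'<d. complex_of_real (\<Sum>j<?k. T l j * T l' j) * u l i * cnj (u l' k))"
      by (intro sum.cong refl) (simp add: sum_distrib_left sum_distrib_right mult_ac)
    also have "\<dots> = (\<Sum>l<d. \<Sum>l'<d. if l' = l then complex_of_real (\<mu> ! l) * u l i * cnj (u l k) else 0)"
      by (intro sum.cong refl) (auto simp: rows')
    finally show ?thesis by simp
  qed
  have dG: "eigen_decomposition d (frame_op d G) u (\<lambda>l. \<mu> ! l)"
    using frame_op_carrier[OF G(1)] on SG by (simp add: eigen_decomposition_def)
  have dFG: "eigen_decomposition d (frame_op d (F @ G)) u (\<lambda>l. e l + \<mu> ! l)"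
    unfolding eigen_decomposition_def
  proof (intro conjI allI impI)
    show "frame_op d (F @ G) \<in> carrier_mat d d" by (rule frame_op_carrier[OF FG])
    show "orthonormal_family d u" by (rule on)
    fix i k assume ik: "i < d" "k < d"
    show "frame_op d (F @ G) $$ (i, k) = (\<Sum>l<d. complex_of_real (e l + \<mu> ! l) * u l i * cnj (u l k))"
      unfolding frame_op_append_index[OF F G(1) ik]
      using ue dG ik unfolding eigen_decomposition_def by (simp add: sum.distrib algebra_simps)
  qed
  show thesis
  proof (rule that[OF G(2,1)])
    fix j assume j: "j < ?k"
    then have "G ! j \<in> carrier_vec d" using G by auto
    then have "G ! j \<bullet>c G ! j = complex_of_real (\<Sum>i<d. (cmod (G ! j $ i))\<^sup>2)" by (rule inner_self_norm)
    also have "(\<Sum>i<d. (cmod (G ! j $ i))\<^sup>2) = (\<Sum>i<d. (cmod (g j i))\<^sup>2)"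
      by (intro sum.cong refl) (simp add: Gj j)
    also have "\<dots> = (\<Sum>l<d. (cmod (coefficient d u (g j) l))\<^sup>2)"
      by (rule parseval[OF on, symmetric])
    also have "\<dots> = (\<Sum>l<d. (T l j)\<^sup>2)"
      by (intro sum.cong refl) (simp add: g_def[abs_def] coefficient_combination[OF on])
    finally show "G ! j \<bullet>c G ! j = complex_of_real (a ! j)" using cols'[OF j] by simp
  next
    have "map (\<lambda>l. \<mu> ! l) [0..<d] = \<mu>" using len by (metis map_nth)
    then show "spec_inc (frame_op d G) = \<mu>"
      using inc by (simp only: eigen_decomposition_spec_inc[OF dG] increasing_def)
    have "vadd (spec_dec (frame_op d F)) \<mu> = map (\<lambda>l. e l + \<mu> ! l) [0..<d]"
      unfolding vadd_def sp using len by (intro nth_equalityI) auto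
    then show "spec_dec (frame_op d (F @ G)) = decreasing (vadd (spec_dec (frame_op d F)) \<mu>)"
      by (simp only: spec_dec_def eigen_decomposition_spec_inc[OF dFG] decreasing_def)
  qed
qed

section \<open>The feasible set and the candidate set\<close>

lemma sum_fun_nths: "sum_fun g (nths xs A) = (\<Sum>j\<in>A \<inter> {..<length xs}. g (xs ! j))"
proof (induction xs rule: rev_induct)
  case Nil
  then show ?case by (simp add: sum_fun_def)
next
  case (snoc x xs)
  have "A \<inter> {..<length (xs @ [x])} = A \<inter> {..<length xs} \<union> (if length xs \<in> A then {length xs} else {})"
    by (auto simp: less_Suc_eq)
  then have "(\<Sum>j\<in>A \<inter> {..<length (xs @ [x])}. g ((xs @ [x]) ! j)) =
      (\<Sum>j\<in>A \<inter> {..<length xs}. g ((xs @ [x]) ! j)) + (if length xs \<in> A then g x else 0)"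
    by (auto simp: sum.union_disjoint)
  also have "(\<Sum>j\<in>A \<inter> {..<length xs}. g ((xs @ [x]) ! j)) = (\<Sum>j\<in>A \<inter> {..<length xs}. g (xs ! j))"
    by (intro sum.cong) (auto simp: nth_append)
  finally show ?case using snoc by (simp add: nths_append sum_fun_def)
qed

lemma sum_fun_map: "sum_fun g (map h xs) = sum_fun (\<lambda>t. g (h t)) xs"
  by (simp add: sum_fun_def o_def)

lemma sum_indexed_partition:
  assumes "indexed_partition p K A" "finite A"
  shows "(\<Sum>j\<in>A. F j) = (\<Sum>i<p. \<Sum>j\<in>K i. F j)"
proof -
  have A: "A = (\<Union>i<p. K i)" and disj: "disjoint_family_on K {..<p}"
    using assms by (auto simp: indexed_partition_def)
  have "finite (K i)" if "i < p" for i
    using assms(2) A that by (auto intro: finite_subset)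
  then show ?thesis unfolding A
    using disj by (intro sum.UNION_disjoint) (auto simp: disjoint_family_on_def)
qed

lemma top_entry_rev_map:
  assumes "antimono m" "\<And>x. d \<le> x \<Longrightarrow> m x = 0"
  shows "top_entry (rev (map m [0..<d])) = m"
proof -
  have "decreasing (rev (map m [0..<d])) = decreasing (map m [0..<d])"
    by (rule decreasing_cong_mset) simp
  also have "\<dots> = map m [0..<d]" using assms(1) by (intro decreasing_map_upt) (auto simp: antimono_def)
  finally show ?thesis using assms(2) by (auto simp: top_entry_def fun_eq_iff)
qed

lemma Gamma_set_top_entry:
  assumes a: "\<forall>\<alpha>\<in>set a. 0 < \<alpha>" and \<gamma>: "\<gamma> \<in> Gamma_set d a"
  shows "top_entry \<gamma> \<in> feasible d (length a) (top_entry a)"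
    and "rev (map (top_entry \<gamma>) [0..<d]) = \<gamma>"
proof -
  have len: "length \<gamma> = d" and nn: "\<And>t. t \<in> set \<gamma> \<Longrightarrow> 0 \<le> t" and inc: "increasing \<gamma> = \<gamma>"
    and maj: "majorized a \<gamma>" using \<gamma> by (auto simp: Gamma_set_def)
  have "0 \<le> x" if "x \<in> set a \<union> set \<gamma>" for x using that nn a less_imp_le by blast
  then have M: "sum_list a = sum_list \<gamma>"
    "\<And>j. (\<Sum>i<j. top_entry a i) \<le> (\<Sum>i<j. top_entry \<gamma> i)"
    using maj majorized_iff_top_entry[of a \<gamma>] by blast+
  show "top_entry \<gamma> \<in> feasible d (length a) (top_entry a)"
    unfolding feasible_def using antimono_top_entry[of \<gamma>] top_entry_nonneg[of \<gamma>] nn M len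
      sum_list_top_entry[of a "length a"] sum_list_top_entry[of \<gamma> d]
    by (auto simp: top_entry_def[of \<gamma>])
  have "map (top_entry \<gamma>) [0..<d] = decreasing \<gamma>"
    using len by (intro nth_equalityI) (auto simp: top_entry_def)
  also have "\<dots> = rev \<gamma>" using inc by (simp add: decreasing_def increasing_def)
  finally show "rev (map (top_entry \<gamma>) [0..<d]) = \<gamma>" by simp
qed

lemma rev_map_in_Gamma_set:
  assumes a: "\<forall>\<alpha>\<in>set a. 0 < \<alpha>" and m: "m \<in> feasible d (length a) (top_entry a)"
  shows "rev (map m [0..<d]) \<in> Gamma_set d a"
proof -
  note D = feasibleD[OF m]
  let ?\<mu> = "rev (map m [0..<d])"
  have top: "top_entry ?\<mu> = m" using D by (intro top_entry_rev_map)
  have nn: "0 \<le> t" if "t \<in> set ?\<mu>" for t using that D(2) by auto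
  have "decreasing (map m [0..<d]) = map m [0..<d]"
    using D(1) by (intro decreasing_map_upt) (auto simp: antimono_def)
  then have "sort ?\<mu> = ?\<mu>"
    unfolding decreasing_def by (metis mset_rev properties_for_sort rev_rev_ident sorted_sort mset_sort)
  moreover have "majorized a ?\<mu>"
  proof (subst majorized_iff_top_entry)
    show "0 \<le> u" if "u \<in> set a \<union> set ?\<mu>" for u using that nn a less_imp_le by blast
    have "sum_list ?\<mu> = (\<Sum>i<d. m i)" using sum_list_top_entry[of ?\<mu> d] top by simp
    moreover have "sum_list a = (\<Sum>i<length a. top_entry a i)" by (rule sum_list_top_entry) simp
    ultimately show "sum_list a = sum_list ?\<mu> \<and>
        (\<forall>j. (\<Sum>i<j. top_entry a i) \<le> (\<Sum>i<j. top_entry ?\<mu> i))"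
      unfolding top using D(4,5) by simp
  qed
  ultimately show ?thesis using nn by (auto simp: Gamma_set_def increasing_def)
qed

lemma vadd_nonneg:
  assumes "\<And>t. t \<in> set x \<Longrightarrow> 0 \<le> t" "\<And>t. t \<in> set y \<Longrightarrow> 0 \<le> t" "t \<in> set (vadd x y)"
  shows "0 \<le> t"
proof -
  obtain b c where "(b, c) \<in> set (zip x y)" "t = b + c" using assms(3) by (auto simp: vadd_def)
  then show ?thesis using assms(1)[of b] assms(2)[of c] set_zip_leftD set_zip_rightD
    by (metis add_nonneg_nonneg)
qed

lemma sum_fun_vadd_rev_map:
  assumes "length lam = d"
  shows "sum_fun h (vadd lam (rev (map m [0..<d]))) = (\<Sum>x<d. h (lam ! (d - Suc x) + m x))"
proof -
  have "sum_fun h (vadd lam (rev (map m [0..<d]))) = (\<Sum>j<d. h (lam ! j + m (d - Suc j)))"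
    using assms by (simp add: sum_fun_nth vadd_def rev_nth)
  also have "\<dots> = (\<Sum>x<d. h (lam ! (d - Suc x) + m (d - Suc (d - Suc x))))"
    by (rule sum.nat_diff_reindex[symmetric])
  also have "\<dots> = (\<Sum>x<d. h (lam ! (d - Suc x) + m x))"
    by (intro sum.cong) auto
  finally show ?thesis .
qed

text \<open>
  Sums and excesses are additive over the blocks, and the zero entries do not contribute to either.
\<close>

lemma E_set_subset_Gamma_set:
  assumes F: "set F0 \<subseteq> carrier_vec d" and a: "\<forall>\<alpha>\<in>set a. 0 < \<alpha>"
  shows "E_set d F0 a \<subseteq> Gamma_set d a"
proof
  fix \<nu> assume "\<nu> \<in> E_set d F0 a"
  define lam where "lam = spec_dec (frame_op d F0)"
  have len_lam: "length lam = d" unfolding lam_def by (rule frame_op_spec_dec[OF F])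
  from \<open>\<nu> \<in> E_set d F0 a\<close> obtain r p K J where len: "length \<nu> = d" and r: "r < d"
    and K: "indexed_partition p K {r..<d}" and J: "indexed_partition p J {0..<length a}"
    and z: "\<forall>j<r. \<nu> ! j = 0"
    and lev: "\<forall>i<p. \<forall>j\<in>K i. \<nu> ! j = block_level lam a (K i) (J i) - lam ! j"
    and maj: "\<forall>i<p. (\<forall>t\<in>set (map (\<lambda>t. block_level lam a (K i) (J i) - t) (nths lam (K i))). 0 \<le> t) \<and>
      majorized (nths a (J i)) (map (\<lambda>t. block_level lam a (K i) (J i) - t) (nths lam (K i)))"
    and inc: "\<nu> = increasing \<nu>" and nn: "\<forall>t\<in>set \<nu>. 0 \<le> t"
    unfolding E_set_def Let_def mem_Collect_eq lam_def[symmetric] by (elim conjE exE) (rule that)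
  define \<Gamma> where "\<Gamma> i = map (\<lambda>t. block_level lam a (K i) (J i) - t) (nths lam (K i))" for i
  have \<Gamma>nn: "0 \<le> t" if "i < p" "t \<in> set (\<Gamma> i)" for i t
    using maj that unfolding \<Gamma>_def by blast
  have \<Gamma>maj: "majorized (nths a (J i)) (\<Gamma> i)" if "i < p" for i
    using maj that unfolding \<Gamma>_def by blast
  have ann: "0 \<le> t" if "i < p" "t \<in> set (nths a (J i)) \<union> set (\<Gamma> i)" for i t
    using that \<Gamma>nn set_nths_subset[of a "J i"] a less_imp_le by blast
  have K_sub: "K i \<subseteq> {..<d}" if "i < p" for i using K that by (auto simp: indexed_partition_def)
  have J_sub: "J i \<subseteq> {..<length a}" if "i < p" for i using J that by (auto simp: indexed_partition_def)
  have sum\<nu>: "sum_fun g \<nu> = (\<Sum>i<p. sum_fun g (\<Gamma> i))" if "g 0 = 0" for g :: "real \<Rightarrow> real"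
  proof -
    have "sum_fun g \<nu> = (\<Sum>j\<in>{r..<d}. g (\<nu> ! j))"
      unfolding sum_fun_nth len by (rule sum.mono_neutral_right) (use z that in auto)
    also have "\<dots> = (\<Sum>i<p. \<Sum>j\<in>K i. g (\<nu> ! j))" by (rule sum_indexed_partition[OF K]) simp
    also have "\<dots> = (\<Sum>i<p. sum_fun g (\<Gamma> i))"
    proof (intro sum.cong refl)
      fix i assume "i \<in> {..<p}"
      then have i: "i < p" by simp
      then have "K i \<inter> {..<length lam} = K i" using K_sub len_lam by auto
      then show "(\<Sum>j\<in>K i. g (\<nu> ! j)) = sum_fun g (\<Gamma> i)"
        using lev i by (simp add: \<Gamma>_def sum_fun_map sum_fun_nths)
    qed
    finally show ?thesis .
  qed
  have suma: "sum_fun g a = (\<Sum>i<p. sum_fun g (nths a (J i)))" for g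
  proof -
    have "sum_fun g a = (\<Sum>j\<in>{0..<length a}. g (a ! j))" by (simp add: sum_fun_nth atLeast0LessThan)
    also have "\<dots> = (\<Sum>i<p. \<Sum>j\<in>J i. g (a ! j))" by (rule sum_indexed_partition[OF J]) simp
    also have "\<dots> = (\<Sum>i<p. sum_fun g (nths a (J i)))"
      using J_sub by (intro sum.cong refl) (simp add: sum_fun_nths Int_absorb2)
    finally show ?thesis .
  qed
  have blk: "sum_fun (\<lambda>u. u) (nths a (J i)) = sum_fun (\<lambda>u. u) (\<Gamma> i)"
    "0 \<le> t \<Longrightarrow> excess t (nths a (J i)) \<le> excess t (\<Gamma> i)" if "i < p" for i t
    using \<Gamma>maj[OF that] majorized_iff_excess[of "nths a (J i)" "\<Gamma> i"] ann[OF that]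
    by (auto simp: sum_fun_def)
  have "sum_list a = sum_list \<nu>"
    using suma[of "\<lambda>u. u"] sum\<nu>[of "\<lambda>u. u"] blk(1) by (simp add: sum_fun_def)
  moreover have "excess t a \<le> excess t \<nu>" if "0 \<le> t" for t
    using suma[of "\<lambda>u. max 0 (u - t)"] sum\<nu>[of "\<lambda>u. max 0 (u - t)"] that
      sum_mono[of "{..<p}" "\<lambda>i. excess t (nths a (J i))" "\<lambda>i. excess t (\<Gamma> i)"] blk(2)
    by (simp add: excess_def)
  moreover have "0 \<le> t" if "t \<in> set a \<union> set \<nu>" for t using that nn a less_imp_le by blast
  ultimately have "majorized a \<nu>" by (subst majorized_iff_excess) auto
  then show "\<nu> \<in> Gamma_set d a" using len inc nn by (simp add: Gamma_set_def)
qed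

text \<open>
  The sequence \<open>m\<close> runs from the largest entry of \<open>\<mu>\<close> downwards, so position \<open>x\<close> belongs to the coordinate
  \<open>d - Suc x\<close>, and the support of \<open>\<mu>\<close> starts at \<open>r = d - support_size m\<close>.  The sets \<open>K i\<close> and \<open>J i\<close> are the blocks
  between tight points, the latter transported by a permutation that sorts \<open>a\<close>.
\<close>

lemma square_minimal_in_E_set:
  assumes F: "set F0 \<subseteq> carrier_vec d" and a: "\<forall>\<alpha>\<in>set a. 0 < \<alpha>" and k: "1 \<le> length a"
  defines "lam \<equiv> spec_dec (frame_op d F0)"
  assumes l: "\<And>x y. x \<le> y \<Longrightarrow> y < d \<Longrightarrow> lam ! (d - Suc x) \<le> lam ! (d - Suc y)"
    and min: "square_minimal d (length a) (top_entry a) (\<lambda>x. lam ! (d - Suc x)) m"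
  shows "rev (map m [0..<d]) \<in> E_set d F0 a"
proof -
  let ?\<mu> = "rev (map m [0..<d])" and ?b = "top_entry a" and ?k = "length a"
  have len_lam: "length lam = d" unfolding lam_def by (rule frame_op_spec_dec[OF F])
  have feas: "m \<in> feasible d ?k ?b" using min by (simp add: square_minimal_def)
  note D = feasibleD[OF feas] and S = support_size[OF feas]
  have b: "antimono ?b" "\<And>x. ?k \<le> x \<Longrightarrow> ?b x = 0"
    using a less_imp_le by (auto intro!: antimono_top_entry simp: top_entry_def)
  have bpos: "0 < ?b x" if "x < ?k" for x
    using a that nth_mem[of x "decreasing a"] by (simp add: top_entry_def)
  define s where "s = support_size m"
  have s: "1 \<le> s" "s \<le> ?k" "s \<le> d"
    using support_size_bounds[OF feas bpos k] S(1) by (simp_all add: s_def)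
  define T where "T = tight_points ?b m s"
  have T: "finite T" "0 \<notin> T" "T \<subseteq> {..<s}" unfolding T_def
    by (auto simp: finite_tight_points) (auto simp: tight_points_def)
  define \<gamma> where "\<gamma> = block_index T"
  define p where "p = Suc (card T)"
  define r where "r = d - s"
  have \<gamma>p: "\<gamma> x < p" for x using block_index_le_card[OF T(1), of x] by (simp add: \<gamma>_def p_def less_Suc_eq_le)
  have att: "\<exists>x<s. \<gamma> x = i" if "i < p" for i
    using block_index_attained[OF T s(1), of i] that by (simp add: \<gamma>_def p_def)
  obtain \<pi> where \<pi>: "\<pi> permutes {..<?k}" and perm: "permute_list \<pi> a = decreasing a"
    using mset_eq_permutation[OF mset_decreasing[of a]] by metis
  have b_\<pi>: "?b x = a ! \<pi> x" if "x < ?k" for x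
    using permute_list_nth[OF \<pi> that] perm that by (simp add: top_entry_def)
  have \<pi>_less: "\<pi> x < ?k \<longleftrightarrow> x < ?k" for x using permutes_in_image[OF \<pi>, of x] by simp
  have \<pi>_inj: "\<pi> x = \<pi> y \<longleftrightarrow> x = y" for x y using permutes_inj[OF \<pi>] by (auto dest: injD)
  define K where "K i = {j \<in> {r..<d}. \<gamma> (d - Suc j) = i}" for i
  define J where "J i = \<pi> ` {x. x < ?k \<and> \<gamma> x = i}" for i
  have sumK: "(\<Sum>j\<in>K i. G (d - Suc j)) = (\<Sum>x | x < s \<and> \<gamma> x = i. G x)" for i and G :: "nat \<Rightarrow> real"
    by (rule sum.reindex_bij_witness[of _ "\<lambda>x. d - Suc x" "\<lambda>j. d - Suc j"])
      (use s in \<open>auto simp: K_def r_def\<close>)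
  have sumJ: "(\<Sum>j\<in>J i. G (a ! j)) = (\<Sum>x | x < ?k \<and> \<gamma> x = i. G (?b x))" for i and G :: "real \<Rightarrow> real"
  proof -
    have "(\<Sum>j\<in>J i. G (a ! j)) = (\<Sum>x | x < ?k \<and> \<gamma> x = i. G (a ! \<pi> x))"
      unfolding J_def by (subst sum.reindex) (auto simp: inj_on_def \<pi>_inj)
    also have "\<dots> = (\<Sum>x | x < ?k \<and> \<gamma> x = i. G (?b x))" by (intro sum.cong) (auto simp: b_\<pi>)
    finally show ?thesis .
  qed
  have \<mu>j: "?\<mu> ! j = m (d - Suc j)" if "j < d" for j using that by (simp add: rev_nth)
  have Kd: "j < d" "d - Suc j < s" if "j \<in> K i" for i j using that s by (auto simp: K_def r_def)
  have level: "block_level lam a (K i) (J i) = lam ! j + ?\<mu> ! j" if j: "j \<in> K i" for i j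
  proof -
    have const: "lam ! j' + ?\<mu> ! j' = lam ! j + ?\<mu> ! j" if j': "j' \<in> K i" for j'
    proof -
      have "lam ! (d - Suc (d - Suc j')) + m (d - Suc j') = lam ! (d - Suc (d - Suc j)) + m (d - Suc j)"
        using Kd[OF j] Kd[OF j'] j j'
        by (intro square_minimal_constant_on_blocks[OF min l, folded s_def, folded T_def, folded \<gamma>_def])
          (auto simp: K_def)
      then show ?thesis using Kd[OF j] Kd[OF j'] by (simp add: \<mu>j)
    qed
    have "(\<Sum>j\<in>J i. a ! j) = (\<Sum>x | x < s \<and> \<gamma> x = i. m x)"
      using sumJ[of "\<lambda>u. u" i] blocks_majorized(1)[OF feas b, of i, folded s_def, folded T_def, folded \<gamma>_def]
      by simp
    also have "\<dots> = (\<Sum>j\<in>K i. m (d - Suc j))" by (rule sumK[symmetric])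
    also have "\<dots> = (\<Sum>j\<in>K i. ?\<mu> ! j)" using Kd by (intro sum.cong refl) (simp add: \<mu>j)
    finally have "(\<Sum>j\<in>K i. lam ! j) + (\<Sum>j\<in>J i. a ! j) = (\<Sum>j\<in>K i. lam ! j + ?\<mu> ! j)"
      by (simp add: sum.distrib)
    also have "\<dots> = (\<Sum>j'\<in>K i. lam ! j + ?\<mu> ! j)" by (intro sum.cong refl const)
    also have "\<dots> = real (card (K i)) * (lam ! j + ?\<mu> ! j)" by simp
    finally have "(\<Sum>j\<in>K i. lam ! j) + (\<Sum>j\<in>J i. a ! j) = real (card (K i)) * (lam ! j + ?\<mu> ! j)" .
    moreover have "card (K i) \<noteq> 0" using j by (auto simp: K_def)
    ultimately show ?thesis by (simp add: block_level_def)
  qed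
  have partK: "indexed_partition p K {r..<d}"
    unfolding indexed_partition_def
  proof (intro conjI allI impI)
    show "disjoint_family_on K {..<p}" by (auto simp: disjoint_family_on_def K_def)
    show "(\<Union>i<p. K i) = {r..<d}" using \<gamma>p by (auto simp: K_def)
    fix i assume "i < p"
    then obtain x where x: "x < s" "\<gamma> x = i" using att by blast
    then have "d - Suc x \<in> K i" using s by (auto simp: K_def r_def)
    then show "K i \<noteq> {}" by blast
  qed
  have partJ: "indexed_partition p J {0..<?k}"
    unfolding indexed_partition_def
  proof (intro conjI allI impI)
    show "disjoint_family_on J {..<p}" by (auto simp: disjoint_family_on_def J_def \<pi>_inj)
    show "(\<Union>i<p. J i) = {0..<?k}"
    proof
      show "(\<Union>i<p. J i) \<subseteq> {0..<?k}" by (auto simp: J_def \<pi>_less)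
      show "{0..<?k} \<subseteq> (\<Union>i<p. J i)"
      proof
        fix j assume "j \<in> {0..<?k}"
        then have "j \<in> \<pi> ` {..<?k}" using permutes_image[OF \<pi>] by auto
        then show "j \<in> (\<Union>i<p. J i)" using \<gamma>p by (auto simp: J_def)
      qed
    qed
    fix i assume "i < p"
    then obtain x where x: "x < s" "\<gamma> x = i" using att by blast
    then have "\<pi> x \<in> J i" using s by (auto simp: J_def)
    then show "J i \<noteq> {}" by blast
  qed
  have card_T: "p \<le> d - r"
  proof -
    have "T \<subseteq> {1..<s}" using T by (metis atLeastLessThan_iff lessThan_iff less_one not_le subsetD subsetI)
    then have "card T \<le> s - 1" using card_mono[of "{1..<s}" T] by simp
    then show ?thesis using s by (simp add: p_def r_def)
  qed
  have blocks: "(\<forall>t\<in>set \<Gamma>. 0 \<le> t) \<and> majorized (nths a (J i)) \<Gamma>"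
    if i: "i < p" and \<Gamma>: "\<Gamma> = map (\<lambda>t. block_level lam a (K i) (J i) - t) (nths lam (K i))" for i \<Gamma>
  proof -
    have sub: "K i \<inter> {..<length lam} = K i" "J i \<inter> {..<?k} = J i"
      by (auto simp: K_def J_def \<pi>_less len_lam)
    have sum\<Gamma>: "sum_fun g \<Gamma> = (\<Sum>x | x < s \<and> \<gamma> x = i. g (m x))" for g :: "real \<Rightarrow> real"
    proof -
      have "sum_fun g \<Gamma> = (\<Sum>j\<in>K i. g (block_level lam a (K i) (J i) - lam ! j))"
        by (simp add: \<Gamma> sum_fun_map sum_fun_nths sub)
      also have "\<dots> = (\<Sum>j\<in>K i. g (m (d - Suc j)))"
        using Kd by (intro sum.cong refl) (simp add: level \<mu>j)
      also have "\<dots> = (\<Sum>x | x < s \<and> \<gamma> x = i. g (m x))" by (rule sumK)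
      finally show ?thesis .
    qed
    have suma: "sum_fun g (nths a (J i)) = (\<Sum>x | x < ?k \<and> \<gamma> x = i. g (?b x))" for g :: "real \<Rightarrow> real"
      by (simp add: sum_fun_nths sub sumJ)
    have nn: "0 \<le> t" if t: "t \<in> set \<Gamma>" for t
    proof -
      obtain j where "j \<in> K i" "j < d" "t = block_level lam a (K i) (J i) - lam ! j"
        using t by (auto simp: \<Gamma> set_nths len_lam)
      then show ?thesis using level[of j i] D(2) by (simp add: \<mu>j)
    qed
    have "majorized (nths a (J i)) \<Gamma>"
    proof (subst majorized_iff_excess)
      show "0 \<le> u" if "u \<in> set (nths a (J i)) \<union> set \<Gamma>" for u
        using that nn set_nths_subset[of a "J i"] a less_imp_le by blast
      note B = blocks_majorized[OF feas b, where i = i, folded s_def, folded T_def, folded \<gamma>_def]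
      have "sum_list (nths a (J i)) = sum_list \<Gamma>"
        using B(1) suma[of "\<lambda>u. u"] sum\<Gamma>[of "\<lambda>u. u"] by (simp add: sum_fun_def)
      moreover have "\<forall>t\<ge>0. excess t (nths a (J i)) \<le> excess t \<Gamma>"
        using B(2) by (simp add: excess_def suma sum\<Gamma>)
      ultimately show "sum_list (nths a (J i)) = sum_list \<Gamma> \<and>
          (\<forall>t\<ge>0. excess t (nths a (J i)) \<le> excess t \<Gamma>)" by blast
    qed
    then show ?thesis using nn by blast
  qed
  have G: "?\<mu> \<in> Gamma_set d a" by (rule rev_map_in_Gamma_set[OF a feas])
  have zeros: "\<forall>j<r. ?\<mu> ! j = 0"
    using S(3) s by (auto simp: \<mu>j r_def s_def)
  have levels: "\<forall>i<p. \<forall>j\<in>K i. ?\<mu> ! j = block_level lam a (K i) (J i) - lam ! j"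
    using level by auto
  show ?thesis
    unfolding E_set_def lam_def[symmetric] Let_def mem_Collect_eq
    using G partK partJ card_T zeros levels blocks s
    by (intro conjI exI[of _ r] exI[of _ p] exI[of _ K] exI[of _ J])
      (auto simp: Gamma_set_def p_def r_def)
qed

section \<open>The optimal spectrum\<close>

lemma midpoint_feasible:
  assumes "m \<in> feasible d k b" "g \<in> feasible d k b"
  shows "(\<lambda>x. (m x + g x) / 2) \<in> feasible d k b"
proof -
  note M = feasibleD[OF assms(1)] and G = feasibleD[OF assms(2)]
  have sum: "(\<Sum>i<x. (m i + g i) / 2) = ((\<Sum>i<x. m i) + (\<Sum>i<x. g i)) / 2" for x
    by (simp add: sum.distrib sum_divide_distrib[symmetric])
  show ?thesis
    unfolding feasible_def mem_Collect_eq sum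
  proof (intro conjI allI impI)
    show "antimono (\<lambda>x. (m x + g x) / 2)"
      using M(1) G(1) unfolding antimono_def by (simp add: add_mono divide_right_mono)
    show "0 \<le> (m x + g x) / 2" for x using M(2)[of x] G(2)[of x] by simp
    show "(m x + g x) / 2 = 0" if "d \<le> x" for x using M(3)[OF that] G(3)[OF that] by simp
    show "(\<Sum>i<x. b i) \<le> ((\<Sum>i<x. m i) + (\<Sum>i<x. g i)) / 2" for x using M(4)[of x] G(4)[of x] by simp
    show "((\<Sum>i<d. m i) + (\<Sum>i<d. g i)) / 2 = (\<Sum>i<k. b i)" using M(5) G(5) by simp
  qed
qed

text \<open>
  The minimiser \<open>\<mu>\<close> for squares works for \<open>f\<close> as well, because \<open>\<lambda> + \<mu>\<close> precedes every \<open>\<lambda> + \<gamma>\<close> in the convex order.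
  A second minimiser is excluded by strict convexity at the midpoint, which is again feasible.
\<close>

lemma optimal_spectrum_exists:
  assumes F: "set F0 \<subseteq> carrier_vec d" and a: "\<forall>\<alpha>\<in>set a. 0 < \<alpha>"
    and k: "1 \<le> length a" and d: "1 \<le> d" and f: "strictly_convex_on {0..} f"
  defines "lam \<equiv> spec_dec (frame_op d F0)"
  shows "\<exists>\<mu>. \<mu> \<in> Gamma_set d a \<and> \<mu> \<in> E_set d F0 a \<and>
    (\<forall>\<gamma>\<in>Gamma_set d a. sum_fun f (vadd lam \<mu>) \<le> sum_fun f (vadd lam \<gamma>)) \<and>
    (\<forall>\<gamma>\<in>Gamma_set d a. sum_fun f (vadd lam \<gamma>) = sum_fun f (vadd lam \<mu>) \<longrightarrow> \<gamma> = \<mu>)"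
proof -
  let ?b = "top_entry a" and ?k = "length a"
  define l where "l x = lam ! (d - Suc x)" for x
  obtain u e where e: "\<And>i j. i \<le> j \<Longrightarrow> j < d \<Longrightarrow> e j \<le> e i" "\<And>i. i < d \<Longrightarrow> 0 \<le> e i"
    and lam: "lam = map e [0..<d]"
    unfolding lam_def by (rule frame_op_eigen_decomposition[OF F]) (use that in blast)
  have len_lam: "length lam = d" by (simp add: lam)
  have l_mono: "l x \<le> l y" if "x \<le> y" "y < d" for x y
    using e(1)[of "d - Suc y" "d - Suc x"] that by (simp add: l_def lam)
  have l_nn: "0 \<le> l x" if "x < d" for x using e(2)[of "d - Suc x"] that by (simp add: l_def lam)
  have b: "0 \<le> ?b x" "?k \<le> x \<Longrightarrow> ?b x = 0" for x
  proof -
    show "0 \<le> ?b x" using a by (intro top_entry_nonneg) (auto intro: less_imp_le)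
  qed (simp add: top_entry_def)
  obtain m where min: "square_minimal d ?k ?b l m"
    using square_minimal_exists[of ?b ?k d l] b d by blast
  have feas: "m \<in> feasible d ?k ?b" using min by (simp add: square_minimal_def)
  define \<Phi> where "\<Phi> h g = (\<Sum>x<d. h (l x + g x))" for h :: "real \<Rightarrow> real" and g
  have \<Phi>: "sum_fun h (vadd lam (rev (map g [0..<d]))) = \<Phi> h g" for h g
    unfolding \<Phi>_def l_def by (rule sum_fun_vadd_rev_map[OF len_lam])
  have lam_nn: "0 \<le> t" if "t \<in> set lam" for t using that e(2) by (auto simp: lam)
  have vadd_rev_map_nn: "set (vadd lam (rev (map g [0..<d]))) \<subseteq> {0..}"
    if g: "g \<in> feasible d ?k ?b" for g
  proof
    fix t assume t: "t \<in> set (vadd lam (rev (map g [0..<d])))"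
    have "0 \<le> t"
      by (rule vadd_nonneg[OF lam_nn _ t]) (use feasibleD(2)[OF g] in auto)
    then show "t \<in> {0..}" by simp
  qed
  have le: "\<Phi> f m \<le> \<Phi> f g" if g: "g \<in> feasible d ?k ?b" for g
  proof -
    let ?\<mu> = "rev (map m [0..<d])" and ?\<gamma> = "rev (map g [0..<d])"
    have "\<Phi> (\<lambda>u. u) m = \<Phi> (\<lambda>u. u) g"
      using feasibleD(5)[OF feas] feasibleD(5)[OF g] by (simp add: \<Phi>_def sum.distrib)
    then have "sum_list (vadd lam ?\<mu>) = sum_list (vadd lam ?\<gamma>)"
      using \<Phi>[of "\<lambda>u. u" m] \<Phi>[of "\<lambda>u. u" g] by (simp add: sum_fun_def)
    moreover have "excess t (vadd lam ?\<mu>) \<le> excess t (vadd lam ?\<gamma>)" for t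
      unfolding excess_def \<Phi> unfolding \<Phi>_def
      by (rule square_minimal_convex_minimal[OF min g l_mono])
    ultimately have "convex_order (vadd lam ?\<mu>) (vadd lam ?\<gamma>)"
      by (simp add: convex_order_def vadd_def)
    moreover have "set (vadd lam ?\<mu>) \<union> set (vadd lam ?\<gamma>) \<subseteq> {0..}"
      using vadd_rev_map_nn[OF feas] vadd_rev_map_nn[OF g] by blast
    ultimately show ?thesis using convex_order_sum_fun(1)[OF _ f] unfolding \<Phi>[symmetric] by blast
  qed
  have uniq: "g x = m x" if g: "g \<in> feasible d ?k ?b" and eq: "\<Phi> f g = \<Phi> f m" and x: "x < d" for g x
  proof (rule ccontr)
    assume ne: "g x \<noteq> m x"
    define h where "h x = (m x + g x) / 2" for x
    have hx: "l y + h y = (1 - 1/2) * (l y + m y) + 1/2 * (l y + g y)" for y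
      by (simp add: h_def field_simps)
    have conv: "f (l y + h y) \<le> (1 - 1/2) * f (l y + m y) + 1/2 * f (l y + g y)"
      and strict: "m y \<noteq> g y \<Longrightarrow> f (l y + h y) < (1 - 1/2) * f (l y + m y) + 1/2 * f (l y + g y)"
      if y: "y < d" for y
    proof -
      have nn: "l y + m y \<in> {0..}" "l y + g y \<in> {0..}"
        using l_nn[OF y] feasibleD(2)[OF feas, of y] feasibleD(2)[OF g, of y] by auto
      show strict: "f (l y + h y) < (1 - 1/2) * f (l y + m y) + 1/2 * f (l y + g y)" if "m y \<noteq> g y"
        unfolding hx
        by (rule f[unfolded strictly_convex_on_def, THEN conjunct2, rule_format, OF nn]) (use that in auto)
      show "f (l y + h y) \<le> (1 - 1/2) * f (l y + m y) + 1/2 * f (l y + g y)"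
        using strict by (cases "m y = g y") (auto simp: h_def)
    qed
    have "\<Phi> f h < (\<Sum>y<d. (1 - 1/2) * f (l y + m y) + 1/2 * f (l y + g y))"
      unfolding \<Phi>_def
      by (rule sum_strict_mono_ex1) (use conv strict ne x in \<open>auto intro!: bexI[of _ x]\<close>)
    also have "\<dots> = (\<Phi> f m + \<Phi> f g) / 2"
      by (simp add: \<Phi>_def sum.distrib sum_divide_distrib[symmetric])
    also have "\<dots> = \<Phi> f m" using eq by simp
    also have "\<dots> \<le> \<Phi> f h" unfolding h_def[abs_def] by (rule le[OF midpoint_feasible[OF feas g]])
    finally show False by simp
  qed
  show ?thesis
  proof (intro exI[of _ "rev (map m [0..<d])"] conjI)
    show "rev (map m [0..<d]) \<in> Gamma_set d a" by (rule rev_map_in_Gamma_set[OF a feas])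
    show "rev (map m [0..<d]) \<in> E_set d F0 a"
      using min l_mono unfolding l_def lam_def
      by (intro square_minimal_in_E_set[OF F a k]) auto
    have \<Phi>\<gamma>: "sum_fun f (vadd lam \<gamma>) = \<Phi> f (top_entry \<gamma>)" if "\<gamma> \<in> Gamma_set d a" for \<gamma>
      using \<Phi>[of f "top_entry \<gamma>"] Gamma_set_top_entry(2)[OF a that] by simp
    show "\<forall>\<gamma>\<in>Gamma_set d a. sum_fun f (vadd lam (rev (map m [0..<d]))) \<le> sum_fun f (vadd lam \<gamma>)"
      using le[OF Gamma_set_top_entry(1)[OF a]] by (simp add: \<Phi> \<Phi>\<gamma>)
    show "\<forall>\<gamma>\<in>Gamma_set d a. sum_fun f (vadd lam \<gamma>) = sum_fun f (vadd lam (rev (map m [0..<d]))) \<longrightarrow>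
        \<gamma> = rev (map m [0..<d])"
    proof (intro ballI impI)
      fix \<gamma> assume \<gamma>: "\<gamma> \<in> Gamma_set d a"
        and "sum_fun f (vadd lam \<gamma>) = sum_fun f (vadd lam (rev (map m [0..<d])))"
      then have "\<Phi> f (top_entry \<gamma>) = \<Phi> f m" by (simp add: \<Phi> \<Phi>\<gamma>)
      then have eq: "map (top_entry \<gamma>) [0..<d] = map m [0..<d]"
        using uniq[OF Gamma_set_top_entry(1)[OF a \<gamma>]] by (intro map_cong) auto
      show "\<gamma> = rev (map m [0..<d])"
        using Gamma_set_top_entry(2)[OF a \<gamma>] unfolding eq by (rule sym)
    qed
  qed
qed

text \<open>
  Lidskii's inequality combined with the equality case for strictly convex sums.
\<close>

lemma potential_lower_bound:
  assumes F: "set F0 \<subseteq> carrier_vec d" and G: "set G \<subseteq> carrier_vec d" and f: "strictly_convex_on {0..} f"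
  shows "sum_fun f (vadd (spec_dec (frame_op d F0)) (spec_inc (frame_op d G))) \<le> potential f d (F0 @ G)"
    and "potential f d (F0 @ G) = sum_fun f (vadd (spec_dec (frame_op d F0)) (spec_inc (frame_op d G))) \<longleftrightarrow>
      spec_dec (frame_op d (F0 @ G)) = decreasing (vadd (spec_dec (frame_op d F0)) (spec_inc (frame_op d G)))"
proof -
  let ?x = "vadd (spec_dec (frame_op d F0)) (spec_inc (frame_op d G))" and ?y = "spec_dec (frame_op d (F0 @ G))"
  have FG: "set (F0 @ G) \<subseteq> carrier_vec d" using F G by simp
  have ord: "convex_order ?x ?y" by (rule frame_op_append_convex_order[OF F G])
  have "0 \<le> t" if "t \<in> set ?x" for t
  proof (rule vadd_nonneg[OF _ _ that])
    show "0 \<le> t" if "t \<in> set (spec_dec (frame_op d F0))" for t using that by (rule frame_op_spec_dec(2)[OF F])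
    show "0 \<le> t" if "t \<in> set (spec_inc (frame_op d G))" for t
      using that by (intro frame_op_spec_dec(2)[OF G]) (simp add: spec_inc_eq_rev)
  qed
  then have sub: "set ?x \<union> set ?y \<subseteq> {0..}" using frame_op_spec_dec(2)[OF FG] by auto
  have pot: "potential f d (F0 @ G) = sum_fun f ?y" by (rule potential_eq_sum_fun[OF FG])
  show "sum_fun f ?x \<le> potential f d (F0 @ G)"
    unfolding pot by (rule convex_order_sum_fun(1)[OF ord f sub])
  show "potential f d (F0 @ G) = sum_fun f ?x \<longleftrightarrow> ?y = decreasing ?x"
  proof
    assume "potential f d (F0 @ G) = sum_fun f ?x"
    then have "mset ?x = mset ?y" using convex_order_sum_fun(2)[OF ord f sub] pot by simp
    then show "?y = decreasing ?x" using decreasing_cong_mset[of ?x ?y] by (simp add: spec_dec_decreasing)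
  next
    assume "?y = decreasing ?x"
    then have "mset ?y = mset ?x" by simp
    then show "potential f d (F0 @ G) = sum_fun f ?x" unfolding pot by (rule sum_fun_cong_mset)
  qed
qed

theorem theorem5p6:
  fixes d :: nat and F0 :: "complex vec list" and a lam mu :: "real list"
    and f :: "real \<Rightarrow> real"
  assumes "initial_data d F0 a"
    and "\<forall>x\<ge>0. 0 \<le> f x"
    and "strictly_convex_on {0..} f"
    and "lam = spec_dec (frame_op d F0)"
    and "mu = opt_mu d F0 a f"
  shows "mu \<in> E_set d F0 a \<and>
    (\<forall>\<nu>\<in>E_set d F0 a.
       sum_fun f (vadd lam \<nu>) = Min ((\<lambda>\<gamma>. sum_fun f (vadd lam \<gamma>)) ` E_set d F0 a)
         \<longleftrightarrow> \<nu> = mu) \<and>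
    (\<forall>G. F0 @ G \<in> completions d F0 a \<longrightarrow>
       (global_minimizer f d F0 a (F0 @ G) \<longleftrightarrow>
          F0 @ G \<in> op_completions d F0 a \<and>
          spec_inc (frame_op d G) \<in> E_set d F0 a \<and>
          sum_fun f (vadd lam (spec_inc (frame_op d G))) =
            Min ((\<lambda>\<gamma>. sum_fun f (vadd lam \<gamma>)) ` E_set d F0 a)))"
proof -
  have d: "1 \<le> d" and k: "1 \<le> length a" and F: "set F0 \<subseteq> carrier_vec d"
    and a: "\<forall>\<alpha>\<in>set a. 0 < \<alpha>"
    using assms(1) by (auto simp: initial_data_def)
  note f = assms(3) and lam = assms(4)
  let ?\<Phi> = "\<lambda>\<gamma>. sum_fun f (vadd lam \<gamma>)"
  obtain \<mu> where \<mu>: "\<mu> \<in> Gamma_set d a" "\<mu> \<in> E_set d F0 a"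
    and least: "\<forall>\<gamma>\<in>Gamma_set d a. ?\<Phi> \<mu> \<le> ?\<Phi> \<gamma>"
    and unique: "\<forall>\<gamma>\<in>Gamma_set d a. ?\<Phi> \<gamma> = ?\<Phi> \<mu> \<longrightarrow> \<gamma> = \<mu>"
    using optimal_spectrum_exists[OF F a k d f] unfolding lam[symmetric] by (elim exE conjE) (rule that)
  have compl: "F0 @ G \<in> completions d F0 a \<longleftrightarrow> length G = length a \<and> set G \<subseteq> carrier_vec d \<and>
      (\<forall>i<length a. G ! i \<bullet>c G ! i = complex_of_real (a ! i))" for G
    by (auto simp: completions_def)
  have op: "F0 @ G \<in> op_completions d F0 a \<longleftrightarrow> F0 @ G \<in> completions d F0 a \<and>
      spec_dec (frame_op d (F0 @ G)) = decreasing (vadd lam (spec_inc (frame_op d G)))" for G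
    by (auto simp: op_completions_def lam)
  have in_\<Gamma>: "spec_inc (frame_op d G) \<in> Gamma_set d a" if "F0 @ G \<in> completions d F0 a" for G
    using that unfolding compl by (intro frame_op_spec_in_Gamma_set a) auto
  have lower: "?\<Phi> (spec_inc (frame_op d G)) \<le> potential f d (F0 @ G)"
    and tight: "potential f d (F0 @ G) = ?\<Phi> (spec_inc (frame_op d G)) \<longleftrightarrow> F0 @ G \<in> op_completions d F0 a"
    if "F0 @ G \<in> completions d F0 a" for G
    using potential_lower_bound[OF F _ f, of G] that unfolding compl op lam by auto
  obtain H where H: "F0 @ H \<in> completions d F0 a" "spec_inc (frame_op d H) = \<mu>"
    "F0 @ H \<in> op_completions d F0 a"
  proof (rule aligned_completion[OF F \<mu>(1) a])
    fix G assume "length G = length a" "set G \<subseteq> carrier_vec d"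
      "\<And>i. i < length a \<Longrightarrow> G ! i \<bullet>c G ! i = complex_of_real (a ! i)"
      "spec_inc (frame_op d G) = \<mu>"
      "spec_dec (frame_op d (F0 @ G)) = decreasing (vadd (spec_dec (frame_op d F0)) \<mu>)"
    then show thesis using that[of G] unfolding op compl lam by auto
  qed
  have potH: "potential f d (F0 @ H) = ?\<Phi> \<mu>" using tight[OF H(1)] H by simp
  have bound: "?\<Phi> \<mu> \<le> potential f d (F0 @ G)" if "F0 @ G \<in> completions d F0 a" for G
    using order.trans[OF bspec[OF least in_\<Gamma>[OF that]] lower[OF that]] .
  have glob: "global_minimizer f d F0 a (F0 @ G) \<longleftrightarrow> potential f d (F0 @ G) = ?\<Phi> \<mu>"
    if G: "F0 @ G \<in> completions d F0 a" for G
  proof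
    assume "global_minimizer f d F0 a (F0 @ G)"
    then have "potential f d (F0 @ G) \<le> potential f d (F0 @ H)" using H(1) by (simp add: global_minimizer_def)
    then show "potential f d (F0 @ G) = ?\<Phi> \<mu>" using potH bound[OF G] by simp
  next
    assume eq: "potential f d (F0 @ G) = ?\<Phi> \<mu>"
    have "potential f d (F0 @ G) \<le> potential f d X" if X: "X \<in> completions d F0 a" for X
    proof -
      obtain G' where "X = F0 @ G'" using X by (auto simp: completions_def)
      then show ?thesis using bound X eq by simp
    qed
    then show "global_minimizer f d F0 a (F0 @ G)" using G by (simp add: global_minimizer_def)
  qed
  have char: "global_minimizer f d F0 a (F0 @ G) \<longleftrightarrow>
      F0 @ G \<in> op_completions d F0 a \<and> spec_inc (frame_op d G) = \<mu>"
    if G: "F0 @ G \<in> completions d F0 a" for G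
  proof
    assume "global_minimizer f d F0 a (F0 @ G)"
    then have eq: "potential f d (F0 @ G) = ?\<Phi> \<mu>" using glob[OF G] by simp
    then have "?\<Phi> (spec_inc (frame_op d G)) = ?\<Phi> \<mu>"
      using lower[OF G] bspec[OF least in_\<Gamma>[OF G]] by simp
    then have "spec_inc (frame_op d G) = \<mu>" using unique in_\<Gamma>[OF G] by blast
    then show "F0 @ G \<in> op_completions d F0 a \<and> spec_inc (frame_op d G) = \<mu>"
      using eq tight[OF G] by simp
  next
    assume "F0 @ G \<in> op_completions d F0 a \<and> spec_inc (frame_op d G) = \<mu>"
    then show "global_minimizer f d F0 a (F0 @ G)" using tight[OF G] glob[OF G] by simp
  qed
  have mu: "mu = \<mu>"
    unfolding assms(5) opt_mu_def
  proof (rule the_equality)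
    show "\<mu> \<in> Gamma_set d a \<and> (\<forall>G. F0 @ G \<in> completions d F0 a \<longrightarrow>
        (global_minimizer f d F0 a (F0 @ G) \<longleftrightarrow>
           F0 @ G \<in> op_completions d F0 a \<and> spec_inc (frame_op d G) = \<mu>))"
      using \<mu>(1) char by blast
    fix \<mu>' assume "\<mu>' \<in> Gamma_set d a \<and> (\<forall>G. F0 @ G \<in> completions d F0 a \<longrightarrow>
        (global_minimizer f d F0 a (F0 @ G) \<longleftrightarrow>
           F0 @ G \<in> op_completions d F0 a \<and> spec_inc (frame_op d G) = \<mu>'))"
    then have "spec_inc (frame_op d H) = \<mu>'" using H glob[OF H(1)] potH by blast
    then show "\<mu>' = \<mu>" using H(2) by simp
  qed
  note E_\<Gamma> = E_set_subset_Gamma_set[OF F a]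
  have Min: "Min (?\<Phi> ` E_set d F0 a) = ?\<Phi> \<mu>"
    using \<mu>(2) least E_\<Gamma> by (intro Min_eqI finite_imageI finite_E_set) auto
  have E_min: "?\<Phi> \<nu> = ?\<Phi> \<mu> \<longleftrightarrow> \<nu> = \<mu>" if "\<nu> \<in> E_set d F0 a" for \<nu>
    using unique E_\<Gamma> that by auto
  show ?thesis
    unfolding mu Min using \<mu>(2) E_min char by auto
qed

end
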